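(* Let $G$ be a compact transitive groupoid and $H$ a closed wide transitive subgroupoid of $G$. Then every $\varphi\in P(H)$ can be extended to some $\phi\in P(G)$, i.e. there exists $\phi\in P(G)$ with $\phi_{|_H}=\varphi$.
   Context: **Groupoids.** All groupoids are second countable, locally compact and Hausdorff topological groupoids. $G^0$ is the unit space, $r,d:G\to G^0$ are the range and domain maps, and $x,y$ are composable iff $d(x)=r(y)$. $G$ is transitive if for all $u,v\in G^0$ there is $x\in G$ with $r(x)=u$, $d(x)=v$. $G$ carries a (left) Haar system $\lambda$. A subgroupoid $H\subseteq G$ is wide if it contains $G^0$; $H$ is assumed to carry a normalized Haar system $\{\lambda_H^u\}_{u\in G^0}$ (each $\lambda_H^u$ a probability measure). **Standing assumption on $G/H$.** $G/H$ is the quotient of $G$ by $l\sim g\iff r(l)=r(g)$ and $l^{-1}g\in H$, with the quotient topology, $r_{G^0}(xH)=r(x)$, and left $G$-action $g\cdot xH=(gx)H$ when $d(g)=r(x)$. It is assumed that $G/H$ has a full equivariant measure system $\mu=\{\mu^u\}_{u\in G^0}$: positive Radon measures on $G/H$ with (i) $\operatorname{supp}\mu^u=r_{G^0}^{-1}(u)$; (ii) $u\mapsto\int f\,d\mu^u$ continuous for all $f\in C_c(G/H)$; (iii) $\int f(\gamma\cdot\omega)\,d\mu^{d(\gamma)}(\omega)=\int f(\omega)\,d\mu^{r(\gamma)}(\omega)$ for all $\gamma\in G$, $f\in C_c(G/H)$. **Representations and positive definite functions.** A continuous Hilbert bundle over $G^0$ is a continuous field of Hilbert spaces $\{\mathcal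 H_u\}_{u\in G^0}$: it has a linear space $\Gamma\subseteq\prod_u\mathcal H_u$ of continuous sections which is fiberwise dense, has $u\mapsto\|\xi(u)\|$ continuous for $\xi\in\Gamma$, and is closed under locally uniform approximation. $C_0(G^0,\mathcal H)$ and $C_b(G^0,\mathcal H)$ denote the continuous sections vanishing at infinity, respectively bounded. A continuous unitary representation of $G$ is a pair $(\mathcal H^\pi,\pi)$ with $\mathcal H^\pi$ a continuous Hilbert bundle over $G^0$ (then called a $G$-Hilbert bundle) and unitaries $\pi(x):\mathcal H^\pi_{d(x)}\to\mathcal H^\pi_{r(x)}$, $x\in G$, with $\pi(u)=\mathrm{id}$ for $u\in G^0$, $\pi(x)\pi(y)=\pi(xy)$ for composable $x,y$, $\pi(x)^{-1}=\pi(x^{-1})$, and $\pi_{\xi,\eta}(x)=\langle\pi(x)\xi(d(x)),\eta(r(x))\rangle$ continuous in $x$ for all $\xi,\eta\in C_0(G^0,\mathcal H^\pi)$. $P(G)$ is the set of positive definite functions on $G$, i.e. the functions of the form $\pi_{\xi,\xi}$ with $\mathcal H^\pi$ a $G$-Hilbert bundle and $\xi\in C_b(G^0,\mathcal H^\pi)$; $P(H)$ is defined in the same way for the groupoid $H$. *)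

theory Defs
  imports
    "HOL-Algebra.Algebraic_Closure_Type"
    "HOL-Probability.Probability_Measure"
begin

section \<open>Topological groupoids\<close>

text \<open>The arrow space is \<open>topspace (arr_top G)\<close>. Composition \<open>arr_comp G x y\<close> is meaningful only when
  \<open>src G x = rng G y\<close>; its values elsewhere, like all values off the arrow space, are arbitrary.\<close>

record 'g groupoid_struct =
  arr_top :: "'g topology"
  units :: "'g set"
  rng :: "'g \<Rightarrow> 'g"
  src :: "'g \<Rightarrow> 'g"
  arr_comp :: "'g \<Rightarrow> 'g \<Rightarrow> 'g"
  arr_inv :: "'g \<Rightarrow> 'g"

abbreviation arrows :: "'g groupoid_struct \<Rightarrow> 'g set"
  where "arrows G \<equiv> topspace (arr_top G)"

abbreviation unit_space :: "'g groupoid_struct \<Rightarrow> 'g topology"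
  where "unit_space G \<equiv> subtopology (arr_top G) (units G)"

definition composable :: "'g groupoid_struct \<Rightarrow> ('g \<times> 'g) set"
  where "composable G = {(x, y). x \<in> arrows G \<and> y \<in> arrows G \<and> src G x = rng G y}"

locale groupoid =
  fixes G :: "'g groupoid_struct"
  assumes units_subset: "units G \<subseteq> arrows G"
    and rng_closed: "x \<in> arrows G \<Longrightarrow> rng G x \<in> units G"
    and src_closed: "x \<in> arrows G \<Longrightarrow> src G x \<in> units G"
    and rng_unit: "u \<in> units G \<Longrightarrow> rng G u = u"
    and src_unit: "u \<in> units G \<Longrightarrow> src G u = u"
    and comp_closed: "(x, y) \<in> composable G \<Longrightarrow> arr_comp G x y \<in> arrows G"
    and rng_comp: "(x, y) \<in> composable G \<Longrightarrow> rng G (arr_comp G x y) = rng G x"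
    and src_comp: "(x, y) \<in> composable G \<Longrightarrow> src G (arr_comp G x y) = src G y"
    and comp_assoc: "(x, y) \<in> composable G \<Longrightarrow> (y, z) \<in> composable G
      \<Longrightarrow> arr_comp G (arr_comp G x y) z = arr_comp G x (arr_comp G y z)"
    and comp_rng: "x \<in> arrows G \<Longrightarrow> arr_comp G (rng G x) x = x"
    and comp_src: "x \<in> arrows G \<Longrightarrow> arr_comp G x (src G x) = x"
    and inv_closed: "x \<in> arrows G \<Longrightarrow> arr_inv G x \<in> arrows G"
    and rng_inv: "x \<in> arrows G \<Longrightarrow> rng G (arr_inv G x) = src G x"
    and src_inv: "x \<in> arrows G \<Longrightarrow> src G (arr_inv G x) = rng G x"
    and comp_inv_right: "x \<in> arrows G \<Longrightarrow> arr_comp G x (arr_inv G x) = rng G x"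
    and comp_inv_left: "x \<in> arrows G \<Longrightarrow> arr_comp G (arr_inv G x) x = src G x"

text \<open>Continuity of \<open>rng\<close> and \<open>src\<close> follows, as they are \<open>x x\<inverse>\<close> and \<open>x\<inverse> x\<close>.\<close>

locale lch_groupoid = groupoid +
  assumes comp_continuous: "continuous_map
      (subtopology (prod_topology (arr_top G) (arr_top G)) (composable G)) (arr_top G)
      (\<lambda>(x, y). arr_comp G x y)"
    and inv_continuous: "continuous_map (arr_top G) (arr_top G) (arr_inv G)"
    and second_countable: "second_countable (arr_top G)"
    and locally_compact: "locally_compact_space (arr_top G)"
    and Hausdorff: "Hausdorff_space (arr_top G)"

definition transitive_groupoid :: "'g groupoid_struct \<Rightarrow> bool"
  where "transitive_groupoid G \<longleftrightarrow>
    (\<forall>u\<in>units G. \<forall>v\<in>units G. \<exists>x\<in>arrows G. rng G x = u \<and> src G x = v)"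

definition wide_subgroupoid :: "'g set \<Rightarrow> 'g groupoid_struct \<Rightarrow> bool"
  where "wide_subgroupoid H G \<longleftrightarrow>
    H \<subseteq> arrows G \<and> units G \<subseteq> H \<and>
    (\<forall>x\<in>H. \<forall>y\<in>H. src G x = rng G y \<longrightarrow> arr_comp G x y \<in> H) \<and>
    (\<forall>x\<in>H. arr_inv G x \<in> H)"

definition subgroupoid :: "'g groupoid_struct \<Rightarrow> 'g set \<Rightarrow> 'g groupoid_struct"
  where "subgroupoid G H = G\<lparr>arr_top := subtopology (arr_top G) H, units := units G \<inter> H\<rparr>"


section \<open>Equivariant measure systems\<close>

definition Cc :: "'y topology \<Rightarrow> ('y \<Rightarrow> complex) set"
  where "Cc Y = {f. continuous_map Y euclidean f \<and>
    compactin Y (Y closure_of {y \<in> topspace Y. f y \<noteq> 0})}"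

definition radon_measure :: "'y topology \<Rightarrow> 'y measure \<Rightarrow> bool"
  where "radon_measure Y m \<longleftrightarrow>
    sets m = sets (sigma (topspace Y) (Collect (openin Y))) \<and>
    (\<forall>K. compactin Y K \<longrightarrow> K \<in> sets m \<longrightarrow> emeasure m K < \<infinity>) \<and>
    (\<forall>A\<in>sets m. emeasure m A = (INF U\<in>{U. openin Y U \<and> A \<subseteq> U}. emeasure m U)) \<and>
    (\<forall>U. openin Y U \<longrightarrow>
      emeasure m U = (SUP K\<in>{K. compactin Y K \<and> K \<in> sets m \<and> K \<subseteq> U}. emeasure m K))"

definition measure_support :: "'y topology \<Rightarrow> 'y measure \<Rightarrow> 'y set"
  where "measure_support Y m =
    {y \<in> topspace Y. \<forall>U. openin Y U \<and> y \<in> U \<longrightarrow> emeasure m U > 0}"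

text \<open>Full equivariant systems for a left action \<open>act\<close> of \<open>G\<close> on \<open>Y\<close> with anchor map \<open>\<rho>\<close>. Since
  \<open>act \<gamma>\<close> is defined only on the fibre over \<open>src G \<gamma>\<close>, which carries \<open>\<mu> (src G \<gamma>)\<close>, the translated
  integral is taken over that fibre.\<close>

definition full_equivariant_system ::
    "'g groupoid_struct \<Rightarrow> 'y topology \<Rightarrow> ('y \<Rightarrow> 'g) \<Rightarrow> ('g \<Rightarrow> 'y \<Rightarrow> 'y) \<Rightarrow> ('g \<Rightarrow> 'y measure) \<Rightarrow> bool"
  where "full_equivariant_system G Y \<rho> act \<mu> \<longleftrightarrow>
    (\<forall>u\<in>units G. radon_measure Y (\<mu> u) \<and>
      measure_support Y (\<mu> u) = {y \<in> topspace Y. \<rho> y = u}) \<and>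
    (\<forall>f\<in>Cc Y. continuous_map (unit_space G) euclidean (\<lambda>u. integral\<^sup>L (\<mu> u) f)) \<and>
    (\<forall>\<gamma>\<in>arrows G. \<forall>f\<in>Cc Y.
      set_lebesgue_integral (\<mu> (src G \<gamma>)) {y \<in> topspace Y. \<rho> y = src G \<gamma>} (\<lambda>y. f (act \<gamma> y))
      = integral\<^sup>L (\<mu> (rng G \<gamma>)) f)"

definition haar_system :: "'g groupoid_struct \<Rightarrow> ('g \<Rightarrow> 'g measure) \<Rightarrow> bool"
  where "haar_system G lam \<longleftrightarrow> full_equivariant_system G (arr_top G) (rng G) (arr_comp G) lam"

definition normalized_haar_system :: "'g groupoid_struct \<Rightarrow> ('g \<Rightarrow> 'g measure) \<Rightarrow> bool"
  where "normalized_haar_system G lam \<longleftrightarrow> haar_system G lam \<and> (\<forall>u\<in>units G. prob_space (lam u))"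


section \<open>The quotient by a wide subgroupoid\<close>

definition coset_rel :: "'g groupoid_struct \<Rightarrow> 'g set \<Rightarrow> ('g \<times> 'g) set"
  where "coset_rel G H = {(l, g). l \<in> arrows G \<and> g \<in> arrows G \<and> rng G l = rng G g \<and>
    arr_comp G (arr_inv G l) g \<in> H}"

text \<open>The quotient topology on \<open>G/H\<close>: for a set \<open>U\<close> of equivalence classes, \<open>\<Union>U\<close> is its preimage.\<close>

definition coset_space :: "'g groupoid_struct \<Rightarrow> 'g set \<Rightarrow> 'g set topology"
  where "coset_space G H =
    topology (\<lambda>U. U \<subseteq> arrows G // coset_rel G H \<and> openin (arr_top G) (\<Union>U))"

definition coset_rng :: "'g groupoid_struct \<Rightarrow> 'g set \<Rightarrow> 'g"
  where "coset_rng G \<omega> = the_elem (rng G ` \<omega>)"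

definition coset_act :: "'g groupoid_struct \<Rightarrow> 'g set \<Rightarrow> 'g \<Rightarrow> 'g set \<Rightarrow> 'g set"
  where "coset_act G H g \<omega> = (\<Union>x\<in>\<omega>. coset_rel G H `` {arr_comp G g x})"


section \<open>Continuous Hilbert bundles\<close>

record 'e hilbert_struct = "(complex, 'e) module" +
  ip :: "'e \<Rightarrow> 'e \<Rightarrow> complex"

definition hnorm :: "'e hilbert_struct \<Rightarrow> 'e \<Rightarrow> real"
  where "hnorm V v = sqrt (Re (ip V v v))"

text \<open>The ring operations \<open>\<otimes>\<close> and \<open>\<one>\<close> of the underlying module record play no role. The inner
  product is linear in its first argument.\<close>

locale complex_hilbert_space =
  Module.module "ring_of_type_algebra :: complex ring" V for V :: "'e hilbert_struct" (structure) +
  assumes ip_add: "\<lbrakk>v \<in> carrier V; w \<in> carrier V; z \<in> carrier V\<rbrakk>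
      \<Longrightarrow> ip V (v \<oplus> w) z = ip V v z + ip V w z"
    and ip_scale: "\<lbrakk>v \<in> carrier V; w \<in> carrier V\<rbrakk> \<Longrightarrow> ip V (a \<odot> v) w = a * ip V v w"
    and ip_cnj: "\<lbrakk>v \<in> carrier V; w \<in> carrier V\<rbrakk> \<Longrightarrow> ip V w v = cnj (ip V v w)"
    and ip_nonneg: "v \<in> carrier V \<Longrightarrow> 0 \<le> Re (ip V v v)"
    and ip_definite: "\<lbrakk>v \<in> carrier V; ip V v v = 0\<rbrakk> \<Longrightarrow> v = \<zero>"
    and complete: "\<lbrakk>\<And>n::nat. s n \<in> carrier V;
        \<And>\<epsilon>. \<epsilon> > 0 \<Longrightarrow> \<exists>N. \<forall>m\<ge>N. \<forall>n\<ge>N. hnorm V (s m \<ominus> s n) < \<epsilon>\<rbrakk>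
      \<Longrightarrow> \<exists>v\<in>carrier V. (\<lambda>n. hnorm V (s n \<ominus> v)) \<longlonglongrightarrow> 0"

definition unitary_map :: "'e hilbert_struct \<Rightarrow> 'e hilbert_struct \<Rightarrow> ('e \<Rightarrow> 'e) \<Rightarrow> bool"
  where "unitary_map V W T \<longleftrightarrow> bij_betw T (carrier V) (carrier W) \<and>
    (\<forall>v\<in>carrier V. \<forall>w\<in>carrier V. T (v \<oplus>\<^bsub>V\<^esub> w) = T v \<oplus>\<^bsub>W\<^esub> T w) \<and>
    (\<forall>a. \<forall>v\<in>carrier V. T (a \<odot>\<^bsub>V\<^esub> v) = a \<odot>\<^bsub>W\<^esub> T v) \<and>
    (\<forall>v\<in>carrier V. \<forall>w\<in>carrier V. ip W (T v) (T w) = ip V v w)"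

locale hilbert_bundle =
  fixes B :: "'x topology" and fib :: "'x \<Rightarrow> 'e hilbert_struct" and \<Gamma> :: "('x \<Rightarrow> 'e) set"
  assumes fibre: "u \<in> topspace B \<Longrightarrow> complex_hilbert_space (fib u)"
    and sections: "\<Gamma> \<subseteq> (\<Pi>\<^sub>E u\<in>topspace B. carrier (fib u))"
    and section_zero: "(\<lambda>u\<in>topspace B. \<zero>\<^bsub>fib u\<^esub>) \<in> \<Gamma>"
    and section_add: "\<lbrakk>\<xi> \<in> \<Gamma>; \<eta> \<in> \<Gamma>\<rbrakk> \<Longrightarrow> (\<lambda>u\<in>topspace B. \<xi> u \<oplus>\<^bsub>fib u\<^esub> \<eta> u) \<in> \<Gamma>"
    and section_scale: "\<xi> \<in> \<Gamma> \<Longrightarrow> (\<lambda>u\<in>topspace B. a \<odot>\<^bsub>fib u\<^esub> \<xi> u) \<in> \<Gamma>"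
    and fibre_dense: "\<lbrakk>u \<in> topspace B; v \<in> carrier (fib u); \<epsilon> > 0\<rbrakk>
      \<Longrightarrow> \<exists>\<xi>\<in>\<Gamma>. hnorm (fib u) (\<xi> u \<ominus>\<^bsub>fib u\<^esub> v) < \<epsilon>"
    and norm_continuous: "\<xi> \<in> \<Gamma> \<Longrightarrow> continuous_map B euclideanreal (\<lambda>u. hnorm (fib u) (\<xi> u))"
    and locally_uniform_closed: "\<lbrakk>\<xi> \<in> (\<Pi>\<^sub>E u\<in>topspace B. carrier (fib u));
        \<And>u \<epsilon>. \<lbrakk>u \<in> topspace B; \<epsilon> > 0\<rbrakk> \<Longrightarrow> \<exists>U \<eta>. openin B U \<and> u \<in> U \<and> \<eta> \<in> \<Gamma> \<and>
          (\<forall>v\<in>U. hnorm (fib v) (\<xi> v \<ominus>\<^bsub>fib v\<^esub> \<eta> v) < \<epsilon>)\<rbrakk>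
      \<Longrightarrow> \<xi> \<in> \<Gamma>"

definition C0_sections ::
    "'x topology \<Rightarrow> ('x \<Rightarrow> 'e hilbert_struct) \<Rightarrow> ('x \<Rightarrow> 'e) set \<Rightarrow> ('x \<Rightarrow> 'e) set"
  where "C0_sections B fib \<Gamma> = {\<xi> \<in> \<Gamma>. \<forall>\<epsilon>>0. \<exists>K. compactin B K \<and>
    (\<forall>u\<in>topspace B - K. hnorm (fib u) (\<xi> u) < \<epsilon>)}"

definition Cb_sections ::
    "'x topology \<Rightarrow> ('x \<Rightarrow> 'e hilbert_struct) \<Rightarrow> ('x \<Rightarrow> 'e) set \<Rightarrow> ('x \<Rightarrow> 'e) set"
  where "Cb_sections B fib \<Gamma> = {\<xi> \<in> \<Gamma>. \<exists>c. \<forall>u\<in>topspace B. hnorm (fib u) (\<xi> u) \<le> c}"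


section \<open>Representations and positive definite functions\<close>

definition rep_coeff :: "'g groupoid_struct \<Rightarrow> ('g \<Rightarrow> 'e hilbert_struct) \<Rightarrow> ('g \<Rightarrow> 'e \<Rightarrow> 'e) \<Rightarrow>
    ('g \<Rightarrow> 'e) \<Rightarrow> ('g \<Rightarrow> 'e) \<Rightarrow> 'g \<Rightarrow> complex"
  where "rep_coeff G fib \<pi> \<xi> \<eta> =
    (\<lambda>x\<in>arrows G. ip (fib (rng G x)) (\<pi> x (\<xi> (src G x))) (\<eta> (rng G x)))"

locale unitary_representation =
  hilbert_bundle "unit_space G" fib \<Gamma>
  for G :: "'g groupoid_struct" and fib :: "'g \<Rightarrow> 'e hilbert_struct" and \<Gamma> :: "('g \<Rightarrow> 'e) set" +
  fixes \<pi> :: "'g \<Rightarrow> 'e \<Rightarrow> 'e"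
  assumes unitary: "x \<in> arrows G \<Longrightarrow> unitary_map (fib (src G x)) (fib (rng G x)) (\<pi> x)"
    and rep_unit: "\<lbrakk>u \<in> units G; v \<in> carrier (fib u)\<rbrakk> \<Longrightarrow> \<pi> u v = v"
    and rep_comp: "\<lbrakk>(x, y) \<in> composable G; v \<in> carrier (fib (src G y))\<rbrakk>
      \<Longrightarrow> \<pi> x (\<pi> y v) = \<pi> (arr_comp G x y) v"
    and rep_inv: "\<lbrakk>x \<in> arrows G; v \<in> carrier (fib (rng G x))\<rbrakk>
      \<Longrightarrow> inv_into (carrier (fib (src G x))) (\<pi> x) v = \<pi> (arr_inv G x) v"
    and coeff_continuous:
      "\<lbrakk>\<xi> \<in> C0_sections (unit_space G) fib \<Gamma>; \<eta> \<in> C0_sections (unit_space G) fib \<Gamma>\<rbrakk>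
      \<Longrightarrow> continuous_map (arr_top G) euclidean (rep_coeff G fib \<pi> \<xi> \<eta>)"

text \<open>HOL cannot quantify over the type of the fibre vectors, so that type is a parameter \<open>'e\<close>. It is
  immaterial once it is as large as \<open>'g \<Rightarrow> complex\<close>: restricting the bundle of \<open>\<pi>\<close> to the subbundle
  with fibres \<open>K\<^sub>u\<close>, the closed span of the vectors \<open>\<pi>(y)\<xi>(d(y))\<close> with \<open>r(y) = u\<close> (continuous
  sections come from integrating \<open>f(y)\<pi>(y)\<xi>(d(y))\<close> against a Haar system), does not change
  \<open>\<pi>\<^sub>\<xi>\<^sub>,\<^sub>\<xi>\<close>, and \<open>v \<mapsto> (y \<mapsto> \<langle>v, \<pi>(y)\<xi>(d(y))\<rangle>)\<close> embeds \<open>K\<^sub>u\<close> linearly into the functions on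
  \<open>r\<inverse>(u)\<close>. Positive definite functions are extensional, i.e. \<open>undefined\<close> off the arrow space.\<close>

definition pos_def_functions :: "'e itself \<Rightarrow> 'g groupoid_struct \<Rightarrow> ('g \<Rightarrow> complex) set"
  where "pos_def_functions _ G = {rep_coeff G fib \<pi> \<xi> \<xi> | (fib :: 'g \<Rightarrow> 'e hilbert_struct) \<Gamma> \<pi> \<xi>.
    unitary_representation G fib \<Gamma> \<pi> \<and> \<xi> \<in> Cb_sections (unit_space G) fib \<Gamma>}"

end

theory Submission
  imports Defs
begin

text \<open>
  A function \<open>f\<close> on a groupoid is positive definite in the scalar sense if on every fibre of the range
  map the kernel \<open>(s, t) \<mapsto> f (s\<inverse> t)\<close> is positive definite. Both halves of the passage between this
  notion and coefficients of representations are short to describe: the coefficient of a section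
  gives a Gram kernel (\<open>positive_definite_coeff\<close>), and a continuous positive definite function on a
  compact groupoid with Haar system is a coefficient of the bundle of Hilbert spaces which its
  kernels reproduce (\<open>pos_def_function\<close>). What remains is to extend a continuous positive definite
  function from \<open>H\<close> to \<open>G\<close> (\<open>positive_definite_extension\<close>).

  For this, let \<open>r\<close> be positive definite on \<open>H\<close> and \<open>k\<close> continuous on \<open>G\<close>. The convolution \<open>A = k * r\<close>
  over \<open>H\<close> is a function on all of \<open>G\<close>, and its autocorrelation \<open>P (g) = \<integral> cnj (A (z\<inverse>)) A (z\<inverse> g) dz\<close>
  over \<open>G\<close> is positive definite on \<open>G\<close>. By the Cauchy-Schwarz inequality, \<open>P\<close> is below \<open>r\<close> on \<open>H\<close>, in
  the order of positive definite kernels, as soon as \<open>k\<close> is small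
  (\<open>kform_autocor_conv_le\<close>). So \<open>r - P\<close> is again positive definite on \<open>H\<close>, and the step can be repeated.
  Start with the given function \<open>r 0\<close> and put \<open>r (n + 1) = r n - P n\<close>. Then
  \<open>P 0 + \<dots> + P (n - 1) = r 0 - r n\<close> on \<open>H\<close>, so the sum of all \<open>P n\<close> is an extension, provided that
  \<open>r n\<close> tends to zero.

  In the Hilbert space of \<open>r 0\<close>, the kernels \<open>r n\<close> are those of decreasing positive operators \<open>R n\<close> with
  \<open>R (n + 1) = R n - R n T R n\<close>, where \<open>T\<close> is a positive operator that depends on \<open>k\<close>. The limit \<open>R\<close>
  satisfies \<open>R T R = 0\<close>, and \<open>R = 0\<close> if the operators \<open>T\<close> that occur infinitely often are jointly
  injective. Here \<open>k\<close> runs infinitely often through a countable family of bumps which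
  contains arbitrarily narrow ones around every unit, and the argument is carried out on the
  functions \<open>r n\<close> themselves (\<open>r_unit_tendsto\<close>): the inequality \<open>r n \<le> r 0\<close> of kernels makes them
  equicontinuous at the units. Dini's theorem on the compact unit space then makes
  the sum converge uniformly, so the extension is continuous.
\<close>

section \<open>Positive definite kernels\<close>

text \<open>A list \<open>c\<close> of pairs \<open>(a, x)\<close> stands for the formal combination of the points \<open>x\<close> with coefficients \<open>a\<close>;
  a point may occur several times, so concatenation is addition. With the kernel functions
  as vectors, \<open>kcomb k c\<close> is the vector of \<open>c\<close>, \<open>ev c f\<close> the inner product of \<open>f\<close> with it, and \<open>kform\<close> the
  Gram form, conjugate linear in its first list.\<close>
definition ev :: "(complex \<times> 'a) list \<Rightarrow> ('a \<Rightarrow> complex) \<Rightarrow> complex"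
  where "ev c f = (\<Sum>(a, x)\<leftarrow>c. cnj a * f x)"

definition kcomb :: "('a \<Rightarrow> 'a \<Rightarrow> complex) \<Rightarrow> (complex \<times> 'a) list \<Rightarrow> 'a \<Rightarrow> complex"
  where "kcomb k c x = (\<Sum>(b, y)\<leftarrow>c. b * k x y)"

definition kform :: "('a \<Rightarrow> 'a \<Rightarrow> complex) \<Rightarrow> (complex \<times> 'a) list \<Rightarrow> (complex \<times> 'a) list \<Rightarrow> complex"
  where "kform k c d = ev c (kcomb k d)"

definition scl :: "complex \<Rightarrow> (complex \<times> 'a) list \<Rightarrow> (complex \<times> 'a) list"
  where "scl t c = map (\<lambda>(a, x). (t * a, x)) c"

definition supported :: "'a set \<Rightarrow> (complex \<times> 'a) list \<Rightarrow> bool"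
  where "supported S c \<longleftrightarrow> (\<forall>p\<in>set c. snd p \<in> S)"

definition pd_kernel :: "'a set \<Rightarrow> ('a \<Rightarrow> 'a \<Rightarrow> complex) \<Rightarrow> bool"
  where "pd_kernel S k \<longleftrightarrow>
    (\<forall>c. supported S c \<longrightarrow> Im (kform k c c) = 0 \<and> 0 \<le> Re (kform k c c))"

lemma supported_simps [simp]:
  "supported S []" "supported S ((a, x) # c) \<longleftrightarrow> x \<in> S \<and> supported S c"
  "supported S (c @ d) \<longleftrightarrow> supported S c \<and> supported S d"
  "supported S (scl t c) \<longleftrightarrow> supported S c"
  by (auto simp: supported_def scl_def)

lemma ev_simps [simp]:
  "ev [] f = 0" "ev ((a, x) # c) f = cnj a * f x + ev c f"
  "ev (c @ d) f = ev c f + ev d f"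
  by (auto simp: ev_def)

lemma ev_scl [simp]: "ev (scl t c) f = cnj t * ev c f"
  by (induction c) (auto simp: ev_def scl_def algebra_simps)

lemma ev_add: "ev c (\<lambda>x. f x + g x) = ev c f + ev c g"
  by (induction c) (auto simp: algebra_simps)

lemma ev_diff: "ev c (\<lambda>x. f x - g x) = ev c f - ev c g"
  by (induction c) (auto simp: algebra_simps)

lemma ev_mult: "ev c (\<lambda>x. t * f x) = t * ev c f"
  by (induction c) (auto simp: algebra_simps)

lemma ev_zero [simp]: "ev c (\<lambda>x. 0) = 0"
  by (induction c) auto

lemma ev_cong: "supported S c \<Longrightarrow> (\<And>x. x \<in> S \<Longrightarrow> f x = g x) \<Longrightarrow> ev c f = ev c g"
  by (induction c) auto

lemma tendsto_ev:
  "supported S c \<Longrightarrow> (\<And>x. x \<in> S \<Longrightarrow> ((\<lambda>n. f n x) \<longlongrightarrow> g x) F) \<Longrightarrow> ((\<lambda>n. ev c (f n)) \<longlongrightarrow> ev c g) F"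
  by (induction c) (auto intro!: tendsto_intros)

lemma kcomb_simps [simp]:
  "kcomb k [] x = 0" "kcomb k ((b, y) # c) x = b * k x y + kcomb k c x"
  "kcomb k (c @ d) = (\<lambda>x. kcomb k c x + kcomb k d x)"
  by (auto simp: kcomb_def fun_eq_iff)

lemma kcomb_scl [simp]: "kcomb k (scl t c) = (\<lambda>x. t * kcomb k c x)"
  by (induction c) (auto simp: kcomb_def scl_def algebra_simps fun_eq_iff)

lemma kform_append:
  "kform k (c @ d) e = kform k c e + kform k d e"
  "kform k c (d @ e) = kform k c d + kform k c e"
  by (auto simp: kform_def simp flip: ev_add)

lemma kform_scl:
  "kform k (scl t c) d = cnj t * kform k c d" "kform k c (scl t d) = t * kform k c d"
  by (auto simp: kform_def simp flip: ev_mult)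

lemma kform_diff: "kform (\<lambda>x y. k x y - l x y) c d = kform k c d - kform l c d"
proof -
  have "kcomb (\<lambda>x y. k x y - l x y) d = (\<lambda>x. kcomb k d x - kcomb l d x)"
    by (induction d) (auto simp: algebra_simps fun_eq_iff)
  then show ?thesis by (simp add: kform_def ev_diff)
qed

lemma kform_add: "kform (\<lambda>x y. k x y + l x y) c d = kform k c d + kform l c d"
proof -
  have "kcomb (\<lambda>x y. k x y + l x y) d = (\<lambda>x. kcomb k d x + kcomb l d x)"
    by (induction d) (auto simp: algebra_simps fun_eq_iff)
  then show ?thesis by (simp add: kform_def ev_add)
qed

lemma kform_cong:
  assumes "supported S c" "supported S d" "\<And>x y. x \<in> S \<Longrightarrow> y \<in> S \<Longrightarrow> k x y = l x y"
  shows "kform k c d = kform l c d"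
proof -
  have "x \<in> S \<Longrightarrow> kcomb k d x = kcomb l d x" for x
    using assms(2,3) by (induction d) auto
  then show ?thesis unfolding kform_def by (rule ev_cong[OF assms(1)])
qed

lemma tendsto_kform:
  assumes "supported S c" "supported S d"
    "\<And>x y. x \<in> S \<Longrightarrow> y \<in> S \<Longrightarrow> ((\<lambda>n. k n x y) \<longlongrightarrow> l x y) F"
  shows "((\<lambda>n. kform (k n) c d) \<longlongrightarrow> kform l c d) F"
proof -
  have "x \<in> S \<Longrightarrow> ((\<lambda>n. kcomb (k n) d x) \<longlongrightarrow> kcomb l d x) F" for x
    using assms(2,3) by (induction d) (auto intro!: tendsto_intros)
  then show ?thesis unfolding kform_def by (rule tendsto_ev[OF assms(1)])
qed

lemma kform_single [simp]: "kform k [(a, x)] [(b, y)] = cnj a * (b * k x y)"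
  by (simp add: kform_def)

lemma pd_kernelD:
  "pd_kernel S k \<Longrightarrow> supported S c \<Longrightarrow> Im (kform k c c) = 0"
  "pd_kernel S k \<Longrightarrow> supported S c \<Longrightarrow> 0 \<le> Re (kform k c c)"
  by (auto simp: pd_kernel_def)

text \<open>The form is real on the combinations \<open>c + d\<close> and \<open>c + \<i> d\<close>.\<close>
lemma pd_kernel_cnj:
  assumes "pd_kernel S k" "supported S c" "supported S d"
  shows "kform k d c = cnj (kform k c d)"
proof (rule complex_eqI)
  have "Im (kform k (c @ d) (c @ d)) = 0" "Im (kform k (c @ scl \<i> d) (c @ scl \<i> d)) = 0"
    "Im (kform k c c) = 0" "Im (kform k d d) = 0"
    using assms by (auto intro!: pd_kernelD(1))
  then show "Re (kform k d c) = Re (cnj (kform k c d))" "Im (kform k d c) = Im (cnj (kform k c d))"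
    by (auto simp: kform_append kform_scl)
qed

text \<open>The usual discriminant argument, in the direction \<open>cnj (kform k c d)\<close>, which makes the cross
  term real.\<close>
lemma pd_kernel_Cauchy_Schwarz:
  assumes k: "pd_kernel S k" and c: "supported S c" and d: "supported S d"
  shows "(cmod (kform k c d))\<^sup>2 \<le> Re (kform k c c) * Re (kform k d d)"
proof -
  define B where "B = kform k c d"
  define p where "p = Re (kform k c c)"
  define q where "q = Re (kform k d d)"
  have pq: "p \<ge> 0" "q \<ge> 0" using assms pd_kernelD by (auto simp: p_def q_def)
  have dc: "kform k d c = cnj B" using pd_kernel_cnj[OF k c d] by (simp add: B_def)
  have mm: "(cmod B)\<^sup>2 = Re B * Re B + Im B * Im B"
    using cmod_power2[of B] by (simp only: power2_eq_square)
  have *: "0 \<le> p + 2 * t * (cmod B)\<^sup>2 + t\<^sup>2 * (cmod B)\<^sup>2 * q" for t :: real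
  proof -
    let ?e = "c @ scl (of_real t * cnj B) d"
    have "Re (kform k ?e ?e) = p + 2 * t * (cmod B)\<^sup>2 + t\<^sup>2 * (cmod B)\<^sup>2 * q"
      unfolding kform_append kform_scl dc B_def[symmetric] p_def q_def mm
      by (simp add: power2_eq_square[of t] algebra_simps pd_kernelD(1)[OF k d])
    then show ?thesis using pd_kernelD(2)[OF k, of ?e] c d by simp
  qed
  have "(cmod B)\<^sup>2 \<le> p * q"
  proof (cases "B = 0")
    case False
    then have B: "(cmod B)\<^sup>2 > 0" by simp
    show ?thesis
    proof (cases "q = 0")
      case True
      have "0 \<le> p + 2 * (- (p + 1) / (cmod B)\<^sup>2) * (cmod B)\<^sup>2"
        using *[of "- (p + 1) / (cmod B)\<^sup>2"] True by simp
      then have "0 \<le> p + 2 * - (p + 1)" using B by (simp add: field_simps del: zero_less_power2)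
      then show ?thesis using pq by simp
    next
      case False
      have "0 \<le> p + 2 * (- 1 / q) * (cmod B)\<^sup>2 + (- 1 / q)\<^sup>2 * (cmod B)\<^sup>2 * q" by (rule *)
      also have "\<dots> = p - (cmod B)\<^sup>2 / q" using False by (simp add: power2_eq_square)
      finally show ?thesis using False pq by (simp add: field_simps)
    qed
  qed (use pq in simp)
  then show ?thesis by (simp add: B_def p_def q_def)
qed

lemma pd_kernel_diag:
  assumes "pd_kernel S k" "x \<in> S"
  shows "Im (k x x) = 0" "0 \<le> Re (k x x)"
  using pd_kernelD[OF assms(1), of "[(1, x)]"] assms(2) by auto

lemma pd_kernel_cmod_le:
  assumes "pd_kernel S k" "x \<in> S" "y \<in> S"
  shows "(cmod (k x y))\<^sup>2 \<le> Re (k x x) * Re (k y y)"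
  using pd_kernel_Cauchy_Schwarz[OF assms(1), of "[(1, x)]" "[(1, y)]"] assms by simp

lemma pd_kernel_symm:
  assumes "pd_kernel S k" "x \<in> S" "y \<in> S"
  shows "k y x = cnj (k x y)"
  using pd_kernel_cnj[OF assms(1), of "[(1, x)]" "[(1, y)]"] assms by simp

lemma pd_kernel_add: "pd_kernel S k \<Longrightarrow> pd_kernel S l \<Longrightarrow> pd_kernel S (\<lambda>x y. k x y + l x y)"
  by (auto simp: pd_kernel_def kform_add)

lemma pd_kernel_cong:
  assumes "pd_kernel S k" "\<And>x y. x \<in> S \<Longrightarrow> y \<in> S \<Longrightarrow> l x y = k x y"
  shows "pd_kernel S l"
  unfolding pd_kernel_def
proof (intro allI impI)
  fix c assume c: "supported S c"
  have "kform l c c = kform k c c" by (rule kform_cong[OF c c assms(2)])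
  then show "Im (kform l c c) = 0 \<and> 0 \<le> Re (kform l c c)" using pd_kernelD[OF assms(1) c] by simp
qed

section \<open>The Hilbert space of a positive definite kernel\<close>

locale kernel_space =
  fixes S :: "'a set" and k :: "'a \<Rightarrow> 'a \<Rightarrow> complex"
  assumes pd: "pd_kernel S k"
begin

text \<open>The Hilbert space consists of the functions \<open>f\<close> for which \<open>c \<mapsto> ev c f\<close> is bounded with respect to
  the seminorm \<open>nrm\<close>. It is the dual space of the formal combinations, hence complete without a
  completion, and membership of a function defined by an integral is a mere estimate. The square
  \<open>N2\<close> of the dual norm is taken as a supremum in which a shift of \<open>c\<close> completes the square.\<close>
definition nrm :: "(complex \<times> 'a) list \<Rightarrow> real"
  where "nrm c = sqrt (Re (kform k c c))"

definition space :: "('a \<Rightarrow> complex) set"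
  where "space = {f. (\<forall>x. x \<notin> S \<longrightarrow> f x = 0) \<and>
    (\<exists>B\<ge>0. \<forall>c. supported S c \<longrightarrow> cmod (ev c f) \<le> B * nrm c)}"

definition N2 :: "('a \<Rightarrow> complex) \<Rightarrow> real"
  where "N2 f = (SUP c\<in>Collect (supported S). 2 * Re (ev c f) - (nrm c)\<^sup>2)"

definition N :: "('a \<Rightarrow> complex) \<Rightarrow> real"
  where "N f = sqrt (N2 f)"

abbreviation dst :: "('a \<Rightarrow> complex) \<Rightarrow> ('a \<Rightarrow> complex) \<Rightarrow> real"
  where "dst f g \<equiv> N (\<lambda>x. f x - g x)"

definition kf :: "(complex \<times> 'a) list \<Rightarrow> 'a \<Rightarrow> complex"
  where "kf c x = (if x \<in> S then kcomb k c x else 0)"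

lemma nrm_nonneg [simp]: "supported S c \<Longrightarrow> 0 \<le> nrm c"
  using pd_kernelD[OF pd] by (auto simp: nrm_def)

lemma nrm_sq: "supported S c \<Longrightarrow> (nrm c)\<^sup>2 = Re (kform k c c)"
  using pd_kernelD[OF pd] by (auto simp: nrm_def)

lemma nrm_scl: "supported S c \<Longrightarrow> nrm (scl t c) = cmod t * nrm c"
proof -
  assume c: "supported S c"
  have "kform k (scl t c) (scl t c) = of_real ((cmod t)\<^sup>2) * kform k c c"
    unfolding kform_scl mult.assoc[symmetric] complex_norm_square by (simp add: mult_ac)
  then have "Re (kform k (scl t c) (scl t c)) = (cmod t)\<^sup>2 * Re (kform k c c)"
    by (metis Re_complex_of_real Im_complex_of_real diff_zero mult_zero_left times_complex.sel(1))
  then show ?thesis by (simp add: nrm_def real_sqrt_mult)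
qed

lemma ev_kf: "supported S c \<Longrightarrow> ev c (kf d) = kform k c d"
  unfolding kform_def by (rule ev_cong) (auto simp: kf_def)

text \<open>Over all multiples of \<open>c\<close>, the supremum of \<open>2 * Re (ev c f) - (nrm c)\<^sup>2\<close> is
  \<open>(cmod (ev c f) / nrm c)\<^sup>2\<close>.\<close>
lemma bound_iff:
  assumes "B \<ge> 0"
  shows "(\<forall>c. supported S c \<longrightarrow> cmod (ev c f) \<le> B * nrm c) \<longleftrightarrow>
    (\<forall>c. supported S c \<longrightarrow> 2 * Re (ev c f) - (nrm c)\<^sup>2 \<le> B\<^sup>2)" (is "?L \<longleftrightarrow> ?R")
proof
  assume L: ?L
  show ?R
  proof (intro allI impI)
    fix c assume c: "supported S c"
    have "2 * Re (ev c f) \<le> 2 * (B * nrm c)"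
      using L c complex_Re_le_cmod[of "ev c f"] by (smt (verit))
    moreover have "0 \<le> (B - nrm c)\<^sup>2" by simp
    ultimately show "2 * Re (ev c f) - (nrm c)\<^sup>2 \<le> B\<^sup>2"
      by (simp add: power2_eq_square algebra_simps)
  qed
next
  assume R: ?R
  show ?L
  proof (intro allI impI)
    fix c assume c: "supported S c"
    define p where "p = cmod (ev c f)"
    have *: "2 * (t * p\<^sup>2) - t\<^sup>2 * (p\<^sup>2 * (nrm c)\<^sup>2) \<le> B\<^sup>2" for t :: real
    proof -
      have "Re (ev (scl (of_real t * ev c f) c) f) = t * p\<^sup>2"
        unfolding p_def cmod_power2 by (simp add: power2_eq_square algebra_simps)
      moreover have "(nrm (scl (of_real t * ev c f) c))\<^sup>2 = t\<^sup>2 * (p\<^sup>2 * (nrm c)\<^sup>2)"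
        using c by (simp add: nrm_scl norm_mult p_def power_mult_distrib)
      ultimately show ?thesis using R[rule_format, of "scl (of_real t * ev c f) c"] c by simp
    qed
    show "cmod (ev c f) \<le> B * nrm c"
    proof (cases "p = 0")
      case False
      then have p: "p\<^sup>2 > 0" by simp
      have "nrm c \<noteq> 0"
      proof
        assume "nrm c = 0"
        then have "2 * ((B\<^sup>2 + 1) / p\<^sup>2 * p\<^sup>2) \<le> B\<^sup>2" using *[of "(B\<^sup>2 + 1) / p\<^sup>2"] by simp
        then have "2 * (B\<^sup>2 + 1) \<le> B\<^sup>2" using False by simp
        moreover have "0 \<le> B\<^sup>2" by simp
        ultimately show False by (simp add: algebra_simps)
      qed
      then have n: "nrm c > 0" using nrm_nonneg[OF c] by linarith
      have "2 * (1 / (nrm c)\<^sup>2 * p\<^sup>2) - (1 / (nrm c)\<^sup>2)\<^sup>2 * (p\<^sup>2 * (nrm c)\<^sup>2) = p\<^sup>2 / (nrm c)\<^sup>2"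
        using n by (simp add: power2_eq_square field_simps)
      then have "p\<^sup>2 / (nrm c)\<^sup>2 \<le> B\<^sup>2" using *[of "1 / (nrm c)\<^sup>2"] by linarith
      then have "p\<^sup>2 \<le> (B * nrm c)\<^sup>2" using n by (simp add: field_simps power_mult_distrib)
      then show ?thesis using assms n unfolding p_def
        by (simp add: power_mono_iff)
    qed (use assms c in \<open>simp add: p_def\<close>)
  qed
qed

lemma space_outside: "f \<in> space \<Longrightarrow> x \<notin> S \<Longrightarrow> f x = 0"
  by (auto simp: space_def)

lemma spaceI:
  assumes "\<And>x. x \<notin> S \<Longrightarrow> f x = 0" "B \<ge> 0"
    "\<And>c. supported S c \<Longrightarrow> cmod (ev c f) \<le> B * nrm c"
  shows "f \<in> space"
  using assms by (auto simp: space_def)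

lemma N2_upper:
  assumes "f \<in> space" "supported S c"
  shows "2 * Re (ev c f) - (nrm c)\<^sup>2 \<le> N2 f"
  unfolding N2_def
proof (rule cSUP_upper)
  obtain B where B: "B \<ge> 0" "\<forall>c. supported S c \<longrightarrow> cmod (ev c f) \<le> B * nrm c"
    using assms by (auto simp: space_def)
  then show "bdd_above ((\<lambda>c. 2 * Re (ev c f) - (nrm c)\<^sup>2) ` Collect (supported S))"
    using bound_iff[OF B(1), of f] by (auto intro!: bdd_aboveI[of _ "B\<^sup>2"])
qed (use assms in auto)

lemma N2_least:
  assumes "\<And>c. supported S c \<Longrightarrow> 2 * Re (ev c f) - (nrm c)\<^sup>2 \<le> B"
  shows "N2 f \<le> B"
  unfolding N2_def
proof (rule cSUP_least)
  show "Collect (supported S) \<noteq> {}" using supported_simps(1) by blast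
qed (use assms in auto)

lemma N2_nonneg: "f \<in> space \<Longrightarrow> 0 \<le> N2 f"
  using N2_upper[of f "[]"] by (simp add: nrm_def kform_def)

lemma N_nonneg: "f \<in> space \<Longrightarrow> 0 \<le> N f"
  by (simp add: N_def N2_nonneg)

lemma N_sq: "f \<in> space \<Longrightarrow> (N f)\<^sup>2 = N2 f"
  by (simp add: N_def N2_nonneg)

lemma N_bound:
  assumes "f \<in> space" "supported S c"
  shows "cmod (ev c f) \<le> N f * nrm c"
  using bound_iff[OF N_nonneg[OF assms(1)], of f] N2_upper[OF assms(1)] assms
  by (simp add: N_sq)

lemma N_least:
  assumes "B \<ge> 0" "\<And>c. supported S c \<Longrightarrow> cmod (ev c f) \<le> B * nrm c"
  shows "N f \<le> B"
proof -
  have "N2 f \<le> B\<^sup>2" using bound_iff[OF assms(1), of f] assms(2) by (intro N2_least) auto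
  then show ?thesis using assms(1) unfolding N_def by (simp add: real_le_lsqrt)
qed

lemma space_zero: "(\<lambda>x. 0) \<in> space"
  by (rule spaceI[of _ 0]) auto

lemma space_add:
  assumes "f \<in> space" "g \<in> space"
  shows "(\<lambda>x. f x + g x) \<in> space" "N (\<lambda>x. f x + g x) \<le> N f + N g"
proof -
  have *: "cmod (ev c (\<lambda>x. f x + g x)) \<le> (N f + N g) * nrm c" if c: "supported S c" for c
    unfolding ev_add distrib_right
    using N_bound[OF assms(1) c] N_bound[OF assms(2) c] norm_triangle_ineq[of "ev c f" "ev c g"]
    by linarith
  have "0 \<le> N f + N g" using N_nonneg assms by auto
  then show "(\<lambda>x. f x + g x) \<in> space" "N (\<lambda>x. f x + g x) \<le> N f + N g"
    using * assms by (auto intro!: spaceI[of _ "N f + N g"] N_least simp: space_outside)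
qed

lemma space_mult:
  assumes "f \<in> space"
  shows "(\<lambda>x. t * f x) \<in> space" "N (\<lambda>x. t * f x) \<le> cmod t * N f"
proof -
  have *: "cmod (ev c (\<lambda>x. t * f x)) \<le> (cmod t * N f) * nrm c" if c: "supported S c" for c
    unfolding ev_mult norm_mult mult.assoc
    using N_bound[OF assms(1) c] by (simp add: mult_left_mono)
  have "0 \<le> cmod t * N f" using N_nonneg assms by auto
  then show "(\<lambda>x. t * f x) \<in> space" "N (\<lambda>x. t * f x) \<le> cmod t * N f"
    using * assms by (auto intro!: spaceI[of _ "cmod t * N f"] N_least simp: space_outside)
qed

lemma space_diff:
  assumes "f \<in> space" "g \<in> space"
  shows "(\<lambda>x. f x - g x) \<in> space" "dst f g \<le> N f + N g"
  using space_add[OF assms(1) space_mult(1)[OF assms(2), of "- 1"]] space_mult(2)[OF assms(2), of "- 1"]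
  by auto

lemma N_diff_commute:
  assumes "f \<in> space" "g \<in> space"
  shows "dst f g = dst g f"
  using space_mult(2)[OF space_diff(1)[OF assms], of "-1"]
    space_mult(2)[OF space_diff(1)[OF assms(2,1)], of "-1"] by simp

lemma N_triangle:
  assumes "f \<in> space" "g \<in> space" "h \<in> space"
  shows "dst f h \<le> dst f g + dst g h"
  using space_add(2)[OF space_diff(1)[OF assms(1,2)] space_diff(1)[OF assms(2,3)]] by simp

lemma kf_space: assumes "supported S c" shows "kf c \<in> space"
proof (rule spaceI[of _ "nrm c"])
  fix d assume d: "supported S d"
  have "(cmod (kform k d c))\<^sup>2 \<le> (nrm c * nrm d)\<^sup>2"
    using pd_kernel_Cauchy_Schwarz[OF pd d assms] assms d by (simp add: nrm_sq power_mult_distrib mult_ac)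
  then show "cmod (ev d (kf c)) \<le> nrm c * nrm d"
    using assms d by (simp add: ev_kf power_mono_iff)
qed (use assms in \<open>auto simp: kf_def\<close>)

text \<open>Completing the square: shifting \<open>d\<close> by \<open>c\<close> in the supremum gives the polarization identity
  for \<open>f\<close> and \<open>kf c\<close>, with \<open>ev c f\<close> in the place of the inner product.\<close>
lemma N2_diff_kf:
  assumes f: "f \<in> space" and c: "supported S c"
  shows "N2 (\<lambda>x. f x - kf c x) = N2 f - 2 * Re (ev c f) + (nrm c)\<^sup>2"
proof -
  have g: "(\<lambda>x. f x - kf c x) \<in> space" using space_diff[OF f kf_space[OF c]] by simp
  have shift: "2 * Re (ev (d @ c) f) - (nrm (d @ c))\<^sup>2
      = (2 * Re (ev d (\<lambda>x. f x - kf c x)) - (nrm d)\<^sup>2) + 2 * Re (ev c f) - (nrm c)\<^sup>2"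
    if d: "supported S d" for d
    using c d pd_kernel_cnj[OF pd c d]
    by (simp add: nrm_sq kform_append ev_diff ev_kf)
  show ?thesis
  proof (rule antisym)
    show "N2 (\<lambda>x. f x - kf c x) \<le> N2 f - 2 * Re (ev c f) + (nrm c)\<^sup>2"
    proof (rule N2_least)
      fix d assume d: "supported S d"
      show "2 * Re (ev d (\<lambda>x. f x - kf c x)) - (nrm d)\<^sup>2 \<le> N2 f - 2 * Re (ev c f) + (nrm c)\<^sup>2"
        using N2_upper[OF f, of "d @ c"] shift[OF d] c d by simp
    qed
    have "N2 f \<le> N2 (\<lambda>x. f x - kf c x) + 2 * Re (ev c f) - (nrm c)\<^sup>2"
    proof (rule N2_least)
      fix d assume d: "supported S d"
      let ?e = "d @ scl (- 1) c"
      have e: "supported S ?e" using c d by simp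
      have "ev (?e @ c) f = ev d f" by simp
      moreover have "kform k (?e @ c) (?e @ c) = kform k d d"
        by (simp add: kform_append kform_scl)
      then have "(nrm (?e @ c))\<^sup>2 = (nrm d)\<^sup>2" by (simp add: nrm_def)
      ultimately show "2 * Re (ev d f) - (nrm d)\<^sup>2 \<le> N2 (\<lambda>x. f x - kf c x) + 2 * Re (ev c f) - (nrm c)\<^sup>2"
        using N2_upper[OF g e] shift[OF e] by simp
    qed
    then show "N2 f - 2 * Re (ev c f) + (nrm c)\<^sup>2 \<le> N2 (\<lambda>x. f x - kf c x)" by simp
  qed
qed

lemma N_kf: "supported S c \<Longrightarrow> N (kf c) = nrm c"
proof -
  assume c: "supported S c"
  have "N2 (\<lambda>x. kf c x - kf c x) = 0"
    using N2_least[of "\<lambda>x. 0" 0] N2_nonneg[OF space_zero] by simp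
  then have "N2 (kf c) = (nrm c)\<^sup>2"
    using N2_diff_kf[OF kf_space[OF c] c] by (simp add: ev_kf nrm_sq c)
  then show ?thesis using c by (simp add: N_def)
qed

text \<open>By \<open>N2_diff_kf\<close>, a list \<open>c\<close> that nearly attains the supremum \<open>N2 f\<close> approximates \<open>f\<close>.\<close>
lemma kf_dense:
  assumes f: "f \<in> space" and "\<epsilon> > 0"
  shows "\<exists>c. supported S c \<and> dst f (kf c) < \<epsilon>"
proof -
  have "\<exists>c. supported S c \<and> N2 f - \<epsilon>\<^sup>2 < 2 * Re (ev c f) - (nrm c)\<^sup>2"
  proof (rule ccontr)
    assume "\<not> ?thesis"
    then have "N2 f \<le> N2 f - \<epsilon>\<^sup>2" by (intro N2_least) (meson not_less)
    then show False using assms by simp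
  qed
  then obtain c where c: "supported S c" "N2 f - \<epsilon>\<^sup>2 < 2 * Re (ev c f) - (nrm c)\<^sup>2" by blast
  then have "N2 (\<lambda>x. f x - kf c x) < \<epsilon>\<^sup>2" using N2_diff_kf[OF f] by simp
  then have "dst f (kf c) < \<epsilon>"
    unfolding N_def using assms(2) by (simp add: real_less_lsqrt)
  then show ?thesis using c by blast
qed

definition approx :: "('a \<Rightarrow> complex) \<Rightarrow> nat \<Rightarrow> (complex \<times> 'a) list"
  where "approx f n = (SOME c. supported S c \<and> dst f (kf c) < 1 / real (Suc n))"

lemma approx:
  assumes "f \<in> space"
  shows "supported S (approx f n)" "dst f (kf (approx f n)) < 1 / real (Suc n)"
proof -
  have "\<exists>c. supported S c \<and> dst f (kf c) < 1 / real (Suc n)"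
    by (rule kf_dense[OF assms]) simp
  then have "supported S (approx f n) \<and> dst f (kf (approx f n)) < 1 / real (Suc n)"
    unfolding approx_def by (rule someI_ex)
  then show "supported S (approx f n)" "dst f (kf (approx f n)) < 1 / real (Suc n)" by auto
qed

lemma approx_lim:
  assumes "f \<in> space"
  shows "(\<lambda>n. dst f (kf (approx f n))) \<longlonglongrightarrow> 0"
proof (rule tendsto_sandwich[of "\<lambda>_. 0" _ _ "\<lambda>n. 1 / real (Suc n)"])
  show "(\<lambda>n. 1 / real (Suc n)) \<longlonglongrightarrow> 0" by (rule LIMSEQ_Suc[OF lim_1_over_n])
  show "\<forall>\<^sub>F n in sequentially. dst f (kf (approx f n)) \<le> 1 / real (Suc n)"
    by (intro always_eventually allI less_imp_le approx assms)
qed (auto intro!: always_eventually approx N_nonneg space_diff kf_space assms)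

text \<open>As \<open>ev c f\<close> is the inner product of \<open>f\<close> with \<open>kf c\<close>, the inner product with \<open>g\<close> is the limit along
  combinations that approximate \<open>g\<close>. This makes linearity in \<open>f\<close> immediate.\<close>
definition inner :: "('a \<Rightarrow> complex) \<Rightarrow> ('a \<Rightarrow> complex) \<Rightarrow> complex"
  where "inner f g = lim (\<lambda>n. ev (approx g n) f)"

text \<open>Two combinations close to \<open>g\<close> are close to each other, and \<open>ev\<close> is Lipschitz in the combination.\<close>
lemma inner_lim:
  assumes f: "f \<in> space" and g: "g \<in> space"
    and c: "\<And>n. supported S (c n)" and lim: "(\<lambda>n. dst g (kf (c n))) \<longlonglongrightarrow> 0"
  shows "(\<lambda>n. ev (c n) f) \<longlonglongrightarrow> inner f g"
proof -
  note kfs = kf_space[OF c] kf_space[OF approx(1)[OF g]]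
  have dist: "cmod (ev c f - ev d f) \<le> N f * (dst g (kf c) + dst g (kf d))"
    if "supported S c" "supported S d" for c d
  proof -
    have s: "supported S (c @ scl (-1) d)" using that by simp
    have "kf (c @ scl (-1) d) = (\<lambda>x. kf c x - kf d x)" by (auto simp: kf_def)
    then have "nrm (c @ scl (-1) d) = dst (kf c) (kf d)" using N_kf[OF s] by simp
    also have "\<dots> \<le> dst g (kf c) + dst g (kf d)"
      using N_triangle[OF kf_space[OF that(1)] g kf_space[OF that(2)]]
        N_diff_commute[OF kf_space[OF that(1)] g] by simp
    finally show ?thesis
      using N_bound[OF f s] N_nonneg[OF f] by (simp add: mult_left_mono order_trans)
  qed
  have "Cauchy (\<lambda>n. ev (approx g n) f)"
  proof (rule metric_CauchyI)
    fix e :: real assume e: "e > 0"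
    define B where "B = N f + 1"
    have B: "B > 0" "N f \<le> B" using N_nonneg[OF f] by (auto simp: B_def)
    have "\<forall>\<^sub>F n in sequentially. dst g (kf (approx g n)) < e / (2 * B)"
      by (rule order_tendstoD(2)[OF approx_lim[OF g]]) (use e B in simp)
    then obtain M where M: "\<And>n. n \<ge> M \<Longrightarrow> dst g (kf (approx g n)) < e / (2 * B)"
      by (auto simp: eventually_sequentially)
    show "\<exists>M. \<forall>m\<ge>M. \<forall>n\<ge>M. dist (ev (approx g m) f) (ev (approx g n) f) < e"
    proof (intro exI allI impI)
      fix m n assume mn: "m \<ge> M" "n \<ge> M"
      have "dist (ev (approx g m) f) (ev (approx g n) f)
          \<le> N f * (dst g (kf (approx g m)) + dst g (kf (approx g n)))"
        unfolding dist_norm by (rule dist) (auto intro: approx g)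
      also have "\<dots> \<le> B * (dst g (kf (approx g m)) + dst g (kf (approx g n)))"
        using B by (intro mult_right_mono add_nonneg_nonneg N_nonneg space_diff g kfs) auto
      also have "\<dots> < B * (e / (2 * B) + e / (2 * B))"
        using M[OF mn(1)] M[OF mn(2)] B by (intro mult_strict_left_mono add_strict_mono) auto
      also have "\<dots> = e" using B by simp
      finally show "dist (ev (approx g m) f) (ev (approx g n) f) < e" .
    qed
  qed
  then have A: "(\<lambda>n. ev (approx g n) f) \<longlonglongrightarrow> inner f g"
    unfolding inner_def by (simp add: convergent_LIMSEQ_iff[symmetric] Cauchy_convergent_iff)
  have "(\<lambda>n. N f * (dst g (kf (c n)) + dst g (kf (approx g n)))) \<longlonglongrightarrow> N f * (0 + 0)"
    by (intro tendsto_intros lim approx_lim g)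
  then have "(\<lambda>n. ev (c n) f - ev (approx g n) f) \<longlonglongrightarrow> 0"
    by (intro Lim_null_comparison[OF always_eventually[OF allI[OF dist[OF c approx(1)[OF g]]]]]) simp
  from tendsto_add[OF this A] show ?thesis by simp
qed

lemma inner_approx:
  "f \<in> space \<Longrightarrow> g \<in> space \<Longrightarrow> (\<lambda>n. ev (approx g n) f) \<longlonglongrightarrow> inner f g"
  by (rule inner_lim) (auto intro: approx approx_lim)

lemma inner_kf:
  assumes "f \<in> space" "supported S c"
  shows "inner f (kf c) = ev c f"
proof -
  have "dst (kf c) (kf c) = 0" using N_least[of 0 "\<lambda>x. 0"] N_nonneg[OF space_zero] by simp
  then have "(\<lambda>n. ev c f) \<longlonglongrightarrow> inner f (kf c)"
    using assms by (intro inner_lim) (auto intro: kf_space)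
  then show ?thesis by (simp add: tendsto_const_iff)
qed

lemma inner_add:
  assumes "f \<in> space" "g \<in> space" "h \<in> space"
  shows "inner (\<lambda>x. f x + g x) h = inner f h + inner g h"
proof (rule LIMSEQ_unique)
  show "(\<lambda>n. ev (approx h n) (\<lambda>x. f x + g x)) \<longlonglongrightarrow> inner (\<lambda>x. f x + g x) h"
    by (intro inner_approx space_add assms)
  show "(\<lambda>n. ev (approx h n) (\<lambda>x. f x + g x)) \<longlonglongrightarrow> inner f h + inner g h"
    unfolding ev_add by (intro tendsto_intros inner_approx assms)
qed

lemma inner_mult:
  assumes "f \<in> space" "h \<in> space"
  shows "inner (\<lambda>x. t * f x) h = t * inner f h"
proof (rule LIMSEQ_unique)
  show "(\<lambda>n. ev (approx h n) (\<lambda>x. t * f x)) \<longlonglongrightarrow> inner (\<lambda>x. t * f x) h"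
    by (intro inner_approx space_mult assms)
  show "(\<lambda>n. ev (approx h n) (\<lambda>x. t * f x)) \<longlonglongrightarrow> t * inner f h"
    unfolding ev_mult by (intro tendsto_intros inner_approx assms)
qed

lemma nrm_approx_lim:
  assumes "f \<in> space" shows "(\<lambda>n. nrm (approx f n)) \<longlonglongrightarrow> N f"
proof -
  have "\<bar>nrm (approx f n) - N f\<bar> \<le> dst f (kf (approx f n))" for n
  proof -
    note a = approx(1)[OF assms, of n]
    have "N f \<le> dst f (kf (approx f n)) + nrm (approx f n)"
      using space_add(2)[OF space_diff(1)[OF assms kf_space[OF a]] kf_space[OF a]] by (simp add: N_kf a)
    moreover have "nrm (approx f n) \<le> dst f (kf (approx f n)) + N f"
      using space_diff(2)[OF assms space_diff(1)[OF assms kf_space[OF a]]] by (simp add: N_kf a)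
    ultimately show ?thesis by linarith
  qed
  then have "(\<lambda>n. nrm (approx f n) - N f) \<longlonglongrightarrow> 0"
    by (intro Lim_null_comparison[OF _ approx_lim[OF assms]]) (auto intro!: always_eventually)
  then show ?thesis by (simp add: LIM_zero_iff)
qed

text \<open>The symmetric form of the limit, from which \<open>inner_cnj\<close> follows.\<close>
lemma inner_approx2:
  assumes f: "f \<in> space" and g: "g \<in> space"
  shows "(\<lambda>n. kform k (approx g n) (approx f n)) \<longlonglongrightarrow> inner f g"
proof -
  note a = approx(1)[OF f] approx(1)[OF g]
  have "(\<lambda>n. dst f (kf (approx f n)) * nrm (approx g n)) \<longlonglongrightarrow> 0 * N g"
    by (intro tendsto_intros approx_lim nrm_approx_lim f g)
  then have L: "(\<lambda>n. dst f (kf (approx f n)) * nrm (approx g n)) \<longlonglongrightarrow> 0" by simp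
  have "(\<lambda>n. ev (approx g n) (\<lambda>x. f x - kf (approx f n) x)) \<longlonglongrightarrow> 0"
    by (rule Lim_null_comparison[OF _ L], intro always_eventually allI N_bound space_diff f kf_space a)
  from tendsto_diff[OF inner_approx[OF f g] this] show ?thesis
    by (simp add: ev_diff ev_kf a)
qed

lemma inner_cnj:
  assumes "f \<in> space" "g \<in> space"
  shows "inner g f = cnj (inner f g)"
proof (rule LIMSEQ_unique)
  show "(\<lambda>n. kform k (approx f n) (approx g n)) \<longlonglongrightarrow> inner g f"
    by (rule inner_approx2[OF assms(2,1)])
  have "(\<lambda>n. cnj (kform k (approx g n) (approx f n))) \<longlonglongrightarrow> cnj (inner f g)"
    by (intro tendsto_intros inner_approx2 assms)
  then show "(\<lambda>n. kform k (approx f n) (approx g n)) \<longlonglongrightarrow> cnj (inner f g)"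
    using pd_kernel_cnj[OF pd approx(1)[OF assms(2)] approx(1)[OF assms(1)]] by simp
qed

lemma inner_self:
  assumes "f \<in> space" shows "inner f f = of_real ((N f)\<^sup>2)"
proof (rule LIMSEQ_unique)
  show "(\<lambda>n. kform k (approx f n) (approx f n)) \<longlonglongrightarrow> inner f f"
    by (rule inner_approx2[OF assms assms])
  have "kform k (approx f n) (approx f n) = of_real ((nrm (approx f n))\<^sup>2)" for n
    using pd_kernelD(1)[OF pd approx(1)[OF assms]] nrm_sq[OF approx(1)[OF assms]]
    by (simp add: complex_eq_iff)
  then show "(\<lambda>n. kform k (approx f n) (approx f n)) \<longlonglongrightarrow> of_real ((N f)\<^sup>2)"
    using tendsto_of_real[OF tendsto_power[OF nrm_approx_lim[OF assms]]] by simp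
qed

lemma inner_bound:
  assumes f: "f \<in> space" and g: "g \<in> space"
  shows "cmod (inner f g) \<le> N f * N g"
proof (rule LIMSEQ_le)
  show "(\<lambda>n. cmod (ev (approx g n) f)) \<longlonglongrightarrow> cmod (inner f g)"
    by (intro tendsto_norm inner_approx assms)
  show "(\<lambda>n. N f * nrm (approx g n)) \<longlonglongrightarrow> N f * N g"
    by (intro tendsto_intros nrm_approx_lim assms)
qed (auto intro!: exI[of _ 0] N_bound approx f g)

lemma N_eq_0:
  assumes "f \<in> space" "N f = 0" shows "f = (\<lambda>x. 0)"
proof
  fix x show "f x = 0"
    using N_bound[OF assms(1), of "[(1, x)]"] assms space_outside by (cases "x \<in> S") auto
qed

lemma N_zero: "N (\<lambda>x. 0) = 0"
  by (rule antisym[OF N_least N_nonneg[OF space_zero]]) simp_all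

lemma N_reverse_triangle:
  assumes "f \<in> space" "g \<in> space"
  shows "\<bar>N f - N g\<bar> \<le> dst f g"
proof -
  have "N f \<le> dst f g + N g"
    using space_add(2)[OF space_diff(1)[OF assms] assms(2)] by simp
  moreover have "N g \<le> dst f g + N f"
    using space_add(2)[OF space_diff(1)[OF assms(2,1)] assms(1)] N_diff_commute[OF assms] by simp
  ultimately show ?thesis by linarith
qed

lemma inner_diff_bound:
  assumes "f \<in> space" "f' \<in> space" "g \<in> space" "g' \<in> space"
  shows "cmod (inner f g - inner f' g') \<le> dst f f' * N g + N f' * dst g g'"
proof -
  note d = space_diff(1)[OF assms(1,2)] space_diff(1)[OF assms(3,4)]
  have 1: "inner f g = inner (\<lambda>x. f x - f' x) g + inner f' g"
    using inner_add[OF d(1) assms(2,3)] by simp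
  have "inner g f' = inner (\<lambda>x. g x - g' x) f' + inner g' f'"
    using inner_add[OF d(2) assms(4,2)] by simp
  then have 2: "inner f' g = inner f' (\<lambda>x. g x - g' x) + inner f' g'"
    using inner_cnj assms d by (metis complex_cnj_add)
  have "inner f g - inner f' g' = inner (\<lambda>x. f x - f' x) g + inner f' (\<lambda>x. g x - g' x)"
    unfolding 1 2 by simp
  then have "cmod (inner f g - inner f' g') \<le> cmod (inner (\<lambda>x. f x - f' x) g) + cmod (inner f' (\<lambda>x. g x - g' x))"
    by (simp only: norm_triangle_ineq)
  also have "\<dots> \<le> dst f f' * N g + N f' * dst g g'"
    by (intro add_mono inner_bound d assms)
  finally show ?thesis .
qed

lemma space_complete:
  assumes s: "\<And>n::nat. s n \<in> space"
    and Cauchy: "\<And>\<epsilon>. \<epsilon> > 0 \<Longrightarrow> \<exists>M. \<forall>m\<ge>M. \<forall>n\<ge>M. dst (s m) (s n) < \<epsilon>"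
  shows "\<exists>f\<in>space. (\<lambda>n. dst (s n) f) \<longlonglongrightarrow> 0"
proof -
  have "Cauchy (\<lambda>n. s n x)" for x
  proof (rule metric_CauchyI)
    fix e :: real assume e: "e > 0"
    show "\<exists>M. \<forall>m\<ge>M. \<forall>n\<ge>M. dist (s m x) (s n x) < e"
    proof (cases "x \<in> S")
      case True
      define B where "B = nrm [(1, x)] + 1"
      have "0 \<le> nrm [(1, x)]" by (rule nrm_nonneg) (use True in simp)
      then have B: "B > 0" "nrm [(1, x)] \<le> B" unfolding B_def by linarith+
      obtain M where M: "\<And>m n. m \<ge> M \<Longrightarrow> n \<ge> M \<Longrightarrow> dst (s m) (s n) < e / B"
        using Cauchy[OF divide_pos_pos[OF e B(1)]] by blast
      have "dist (s m x) (s n x) < e" if "m \<ge> M" "n \<ge> M" for m n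
      proof -
        have d: "(\<lambda>x. s m x - s n x) \<in> space" by (intro space_diff s)
        have "dist (s m x) (s n x) \<le> dst (s m) (s n) * nrm [(1, x)]"
          using N_bound[OF d, of "[(1, x)]"] True by (simp add: dist_norm)
        also have "\<dots> \<le> dst (s m) (s n) * B"
          using B N_nonneg[OF d] by (intro mult_left_mono) auto
        also have "\<dots> < e / B * B" using M[OF that] B by (intro mult_strict_right_mono) auto
        finally show ?thesis using B by simp
      qed
      then show ?thesis by blast
    next
      case False
      then have "s n x = 0" for n using space_outside[OF s] by blast
      then show ?thesis using e by simp
    qed
  qed
  then have "\<forall>x. \<exists>l. (\<lambda>n. s n x) \<longlonglongrightarrow> l"
    by (simp add: Cauchy_convergent_iff convergent_def)
  then obtain f where f: "\<And>x. (\<lambda>n. s n x) \<longlonglongrightarrow> f x" by metis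
  have lim: "\<exists>M. \<forall>n\<ge>M. \<forall>c. supported S c \<longrightarrow> cmod (ev c (\<lambda>x. s n x - f x)) \<le> \<epsilon> * nrm c"
    if "\<epsilon> > 0" for \<epsilon> :: real
  proof -
    obtain M where M: "\<And>m n. m \<ge> M \<Longrightarrow> n \<ge> M \<Longrightarrow> dst (s m) (s n) < \<epsilon>"
      using Cauchy[OF \<open>\<epsilon> > 0\<close>] by blast
    have "cmod (ev c (\<lambda>x. s n x - f x)) \<le> \<epsilon> * nrm c" if n: "n \<ge> M" and c: "supported S c" for n c
    proof (rule LIMSEQ_le_const2)
      show "(\<lambda>m. cmod (ev c (\<lambda>x. s n x - s m x))) \<longlonglongrightarrow> cmod (ev c (\<lambda>x. s n x - f x))"
        by (intro tendsto_norm tendsto_ev[OF c] tendsto_intros f)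
      have "cmod (ev c (\<lambda>x. s n x - s m x)) \<le> \<epsilon> * nrm c" if m: "m \<ge> M" for m
      proof -
        have "cmod (ev c (\<lambda>x. s n x - s m x)) \<le> dst (s n) (s m) * nrm c"
          by (intro N_bound space_diff s c)
        also have "\<dots> \<le> \<epsilon> * nrm c" using M[OF n m] nrm_nonneg[OF c] by (intro mult_right_mono) auto
        finally show ?thesis .
      qed
      then show "\<exists>M. \<forall>m\<ge>M. cmod (ev c (\<lambda>x. s n x - s m x)) \<le> \<epsilon> * nrm c" by blast
    qed
    then show ?thesis by blast
  qed
  have out: "f x = 0" if "x \<notin> S" for x
  proof -
    have "s n x = 0" for n using space_outside[OF s that] .
    with f[of x] show ?thesis by (simp add: tendsto_const_iff)
  qed
  have d: "(\<lambda>x. s n x - f x) \<in> space" if "\<forall>c. supported S c \<longrightarrow> cmod (ev c (\<lambda>x. s n x - f x)) \<le> 1 * nrm c" for n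
  proof (rule spaceI[of _ 1])
    show "s n x - f x = 0" if "x \<notin> S" for x
      using out[OF that] space_outside[OF s that] by simp
  qed (use that in simp_all)
  obtain M where M: "\<forall>n\<ge>M. \<forall>c. supported S c \<longrightarrow> cmod (ev c (\<lambda>x. s n x - f x)) \<le> 1 * nrm c"
    using lim[OF zero_less_one] by blast
  have "(\<lambda>x. s M x - f x) \<in> space" by (rule d) (use M in blast)
  then have "(\<lambda>x. s M x - (s M x - f x)) \<in> space" by (rule space_diff(1)[OF s])
  moreover have "(\<lambda>x. s M x - (s M x - f x)) = f" by (simp add: fun_eq_iff)
  ultimately have fs: "f \<in> space" by simp
  have "(\<lambda>n. dst (s n) f) \<longlonglongrightarrow> 0"
  proof (rule LIMSEQ_I)
    fix r :: real assume r: "r > 0"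
    obtain L where L: "\<forall>n\<ge>L. \<forall>c. supported S c \<longrightarrow> cmod (ev c (\<lambda>x. s n x - f x)) \<le> r / 2 * nrm c"
      using lim[of "r / 2"] half_gt_zero[OF r] by blast
    have "norm (dst (s n) f - 0) < r" if n: "n \<ge> L" for n
    proof -
      have "dst (s n) f \<le> r / 2" by (rule N_least) (use r in simp, use L n in blast)
      then show ?thesis using r N_nonneg[OF space_diff(1)[OF s[of n] fs]] by simp
    qed
    then show "\<exists>L. \<forall>n\<ge>L. norm (dst (s n) f - 0) < r" by blast
  qed
  then show ?thesis using fs by blast
qed

definition hilbert :: "('a \<Rightarrow> complex) hilbert_struct"
  where "hilbert = \<lparr>partial_object.carrier = space, monoid.mult = (\<lambda>f g. f), monoid.one = (\<lambda>x. 0),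
    ring.zero = (\<lambda>x. 0), ring.add = (\<lambda>f g x. f x + g x), module.smult = (\<lambda>a f x. a * f x), hilbert_struct.ip = inner\<rparr>"

lemma hilbert_simps [simp]:
  "carrier hilbert = space" "\<zero>\<^bsub>hilbert\<^esub> = (\<lambda>x. 0)" "f \<oplus>\<^bsub>hilbert\<^esub> g = (\<lambda>x. f x + g x)"
  "a \<odot>\<^bsub>hilbert\<^esub> f = (\<lambda>x. a * f x)" "ip hilbert = inner"
  by (auto simp: hilbert_def)

lemma hilbert_module: "Module.module (ring_of_type_algebra :: complex ring) hilbert"
proof (rule moduleI)
  show "cring (ring_of_type_algebra :: complex ring)" by (rule cring_from_type_algebra)
  have "\<exists>g\<in>space. (\<lambda>x. g x + f x) = (\<lambda>x. 0)" if "f \<in> space" for f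
    using space_mult(1)[OF that, of "-1"] by (intro bexI[of _ "\<lambda>x. - 1 * f x"]) auto
  then show "abelian_group hilbert"
    by (intro abelian_groupI) (auto simp: space_add space_zero algebra_simps)
qed (auto simp: space_mult ring_of_type_algebra_def algebra_simps)

lemma hilbert_minus:
  assumes "f \<in> space" "g \<in> space"
  shows "f \<ominus>\<^bsub>hilbert\<^esub> g = (\<lambda>x. f x - g x)"
proof -
  interpret M: Module.module "ring_of_type_algebra :: complex ring" hilbert by (rule hilbert_module)
  have "\<ominus>\<^bsub>hilbert\<^esub> g = (\<lambda>x. - 1 * g x)"
    by (rule M.minus_equality) (use assms space_mult(1)[OF assms(2), of "-1"] in auto)
  then show ?thesis unfolding a_minus_def by simp
qed

lemma hnorm_hilbert: "f \<in> space \<Longrightarrow> hnorm hilbert f = N f"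
  by (simp add: hnorm_def inner_self N_nonneg)

lemma hilbert: "complex_hilbert_space hilbert"
proof (intro complex_hilbert_space.intro hilbert_module complex_hilbert_space_axioms.intro)
  fix s :: "nat \<Rightarrow> 'a \<Rightarrow> complex"
  assume s: "\<And>n. s n \<in> carrier hilbert"
    and C: "\<And>\<epsilon>. 0 < \<epsilon> \<Longrightarrow> \<exists>N. \<forall>m\<ge>N. \<forall>n\<ge>N. hnorm hilbert (s m \<ominus>\<^bsub>hilbert\<^esub> s n) < \<epsilon>"
  have s': "s n \<in> space" for n using s by simp
  have "\<exists>f\<in>space. (\<lambda>n. dst (s n) f) \<longlonglongrightarrow> 0"
    by (rule space_complete) (use s' C in \<open>simp_all add: hilbert_minus hnorm_hilbert space_diff\<close>)
  then show "\<exists>v\<in>carrier hilbert. (\<lambda>n. hnorm hilbert (s n \<ominus>\<^bsub>hilbert\<^esub> v)) \<longlonglongrightarrow> 0"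
    by (auto simp: hilbert_minus hnorm_hilbert space_diff s')
next
  fix f assume "f \<in> carrier hilbert" "ip hilbert f f = 0"
  then show "f = \<zero>\<^bsub>hilbert\<^esub>" by (simp add: inner_self N_eq_0)
qed (auto simp: inner_add inner_mult inner_self intro: inner_cnj)

end

section \<open>Integration over the fibres of a compact space\<close>

lemma continuous_map_locally_uniform_limit:
  fixes f :: "'a \<Rightarrow> 'b::metric_space"
  assumes "\<And>z \<epsilon>. z \<in> topspace Z \<Longrightarrow> \<epsilon> > 0 \<Longrightarrow>
    \<exists>U h. openin Z U \<and> z \<in> U \<and> continuous_map Z euclidean h \<and> (\<forall>w\<in>U. dist (f w) (h w) < \<epsilon>)"
  shows "continuous_map Z euclidean f"
  unfolding continuous_map_eq_topcontinuous_at topcontinuous_at_def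
proof (intro ballI conjI allI impI)
  fix z V assume z: "z \<in> topspace Z" and V: "openin euclidean V \<and> f z \<in> V"
  then obtain \<epsilon> where \<epsilon>: "\<epsilon> > 0" "ball (f z) \<epsilon> \<subseteq> V" by (auto simp: open_contains_ball)
  obtain U h where U: "openin Z U" "z \<in> U" "continuous_map Z euclidean h" "\<forall>w\<in>U. dist (f w) (h w) < \<epsilon> / 3"
    using assms[OF z, of "\<epsilon> / 3"] \<epsilon> by auto
  let ?W = "U \<inter> {w \<in> topspace Z. h w \<in> ball (h z) (\<epsilon> / 3)}"
  have "f w \<in> V" if w: "w \<in> ?W" for w
  proof -
    have "dist (f z) (f w) \<le> dist (f z) (h z) + dist (h z) (h w) + dist (f w) (h w)"
      by (metis add.assoc dist_commute dist_triangle_le dist_triangle add_left_mono order_trans)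
    moreover have "dist (f z) (h z) < \<epsilon> / 3" "dist (f w) (h w) < \<epsilon> / 3" "dist (h z) (h w) < \<epsilon> / 3"
      using U w by auto
    ultimately have "dist (f z) (f w) < \<epsilon>" by linarith
    then show ?thesis using \<epsilon>(2) by auto
  qed
  moreover have "openin Z ?W" using U by (intro openin_Int openin_continuous_map_preimage[OF U(3)]) auto
  moreover have "z \<in> ?W" using U z \<epsilon> by auto
  ultimately show "\<exists>U. openin Z U \<and> z \<in> U \<and> (\<forall>y\<in>U. f y \<in> V)" by blast
qed (auto)

lemma continuous_map_after:
  "continuous_map Z T a \<Longrightarrow> continuous_map T Y f \<Longrightarrow> continuous_map Z Y (\<lambda>z. f (a z))"
  using continuous_map_compose[of Z T a Y f] by (simp add: o_def)

lemma continuous_map_sub_prod: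
  "continuous_map (subtopology (prod_topology Z T) S) Z fst"
  "continuous_map (subtopology (prod_topology Z T) S) T snd"
  by (auto intro: continuous_map_from_subtopology continuous_map_fst continuous_map_snd)

lemma restrict_continuous_map:
  "continuous_map Z Y (restrict f (topspace Z)) \<longleftrightarrow> continuous_map Z Y f"
  by (intro iffI; erule continuous_map_eq) simp_all

lemma continuous_map_on_compose:
  "continuous_on UNIV h \<Longrightarrow> continuous_map Z euclidean f \<Longrightarrow> continuous_map Z euclidean (\<lambda>z. h (f z))"
  using continuous_map_compose[of Z euclidean f euclidean h] by (simp add: o_def)

lemma continuous_map_cmult:
  fixes f g :: "'a \<Rightarrow> complex"
  assumes "continuous_map Z euclidean f" "continuous_map Z euclidean g"
  shows "continuous_map Z euclidean (\<lambda>z. f z * g z)"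
proof -
  have "continuous_map Z (prod_topology euclidean euclidean) (\<lambda>z. (f z, g z))"
    by (intro continuous_map_pairedI assms)
  moreover have "continuous_on UNIV (\<lambda>p::complex \<times> complex. fst p * snd p)"
    by (intro continuous_intros)
  ultimately show ?thesis
    using continuous_map_on_compose[of "\<lambda>p::complex \<times> complex. fst p * snd p" Z "\<lambda>z. (f z, g z)"] by simp
qed

lemma continuous_map_complex_intros:
  fixes f :: "'a \<Rightarrow> complex" and g :: "'a \<Rightarrow> real"
  shows continuous_map_cnj: "continuous_map Z euclidean f \<Longrightarrow> continuous_map Z euclidean (\<lambda>z. cnj (f z))"
    and continuous_map_Re: "continuous_map Z euclidean f \<Longrightarrow> continuous_map Z euclidean (\<lambda>z. Re (f z))"
    and continuous_map_Im: "continuous_map Z euclidean f \<Longrightarrow> continuous_map Z euclidean (\<lambda>z. Im (f z))"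
    and continuous_map_cmod: "continuous_map Z euclidean f \<Longrightarrow> continuous_map Z euclidean (\<lambda>z. cmod (f z))"
    and continuous_map_of_real:
      "continuous_map Z euclidean g \<Longrightarrow> continuous_map Z euclidean (\<lambda>z. complex_of_real (g z))"
    and continuous_map_sqrt: "continuous_map Z euclidean g \<Longrightarrow> continuous_map Z euclidean (\<lambda>z. sqrt (g z))"
proof -
  have "continuous_on UNIV cnj" "continuous_on UNIV Re" "continuous_on UNIV Im" "continuous_on UNIV cmod"
    "continuous_on UNIV complex_of_real" "continuous_on UNIV sqrt"
    by (intro continuous_intros)+
  note * = this[THEN continuous_map_on_compose]
  show "continuous_map Z euclidean f \<Longrightarrow> continuous_map Z euclidean (\<lambda>z. cnj (f z))"
    "continuous_map Z euclidean f \<Longrightarrow> continuous_map Z euclidean (\<lambda>z. Re (f z))"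
    "continuous_map Z euclidean f \<Longrightarrow> continuous_map Z euclidean (\<lambda>z. Im (f z))"
    "continuous_map Z euclidean f \<Longrightarrow> continuous_map Z euclidean (\<lambda>z. cmod (f z))"
    "continuous_map Z euclidean g \<Longrightarrow> continuous_map Z euclidean (\<lambda>z. complex_of_real (g z))"
    "continuous_map Z euclidean g \<Longrightarrow> continuous_map Z euclidean (\<lambda>z. sqrt (g z))"
    by (rule *, assumption)+
qed

text \<open>Tietze's theorem for real and imaginary part.\<close>
lemma compact_Hausdorff_complex_extension:
  fixes f :: "'a \<Rightarrow> complex"
  assumes "compact_space T" "Hausdorff_space T" "closedin T C"
    and f: "continuous_map (subtopology T C) euclidean f"
  obtains F where "continuous_map T euclidean F" "\<And>x. x \<in> C \<Longrightarrow> F x = f x"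
proof -
  have T: "normal_space T"
    using assms compact_Hausdorff_or_regular_imp_normal_space by blast
  obtain A where A: "continuous_map T euclideanreal A" "\<And>x. x \<in> C \<Longrightarrow> A x = Re (f x)"
    using Tietze_extension_realinterval[OF T assms(3) is_interval_univ _ continuous_map_complex_intros(2)[OF f]]
    by auto
  obtain B where B: "continuous_map T euclideanreal B" "\<And>x. x \<in> C \<Longrightarrow> B x = Im (f x)"
    using Tietze_extension_realinterval[OF T assms(3) is_interval_univ _ continuous_map_complex_intros(3)[OF f]]
    by auto
  show thesis
  proof
    show "continuous_map T euclidean (\<lambda>x. complex_of_real (A x) + \<i> * complex_of_real (B x))"
      by (intro continuous_map_add continuous_map_cmult continuous_map_of_real continuous_map_canonical_const A B)
    show "complex_of_real (A x) + \<i> * complex_of_real (B x) = f x" if "x \<in> C" for x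
      using A B that by (simp add: complex_eq_iff)
  qed
qed

text \<open>A continuous system of measures on the fibres of \<open>p\<close>, the setting common to \<open>G\<close> and \<open>H\<close>. Integrals \<open>I u f\<close> are taken over
  the fibre only, because the integrands \<open>f\<close> are usually defined and continuous just there.\<close>
locale fibre_integral =
  fixes T :: "'a topology" and B :: "'b topology" and p :: "'a \<Rightarrow> 'b" and m :: "'b \<Rightarrow> 'a measure"
  assumes compact: "compact_space T" and Hausdorff: "Hausdorff_space T"
    and compact_base: "compact_space B" and Hausdorff_base: "Hausdorff_space B"
    and p: "continuous_map T B p"
    and radon: "u \<in> topspace B \<Longrightarrow> radon_measure T (m u)"
    and support: "u \<in> topspace B \<Longrightarrow> measure_support T (m u) = {y \<in> topspace T. p y = u}"
    and continuous_integral: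
      "f \<in> Cc T \<Longrightarrow> continuous_map B euclidean (\<lambda>u. integral\<^sup>L (m u) f)"
begin

definition fib :: "'b \<Rightarrow> 'a set"
  where "fib u = {y \<in> topspace T. p y = u}"

abbreviation cont_on_fib :: "'b \<Rightarrow> ('a \<Rightarrow> 'c::topological_space) \<Rightarrow> bool"
  where "cont_on_fib u f \<equiv> continuous_map (subtopology T (fib u)) euclidean f"

abbreviation I :: "'b \<Rightarrow> ('a \<Rightarrow> 'c::{banach, second_countable_topology}) \<Rightarrow> 'c"
  where "I u f \<equiv> set_lebesgue_integral (m u) (fib u) f"

definition mass :: "'b \<Rightarrow> real"
  where "mass u = I u (\<lambda>_. 1)"

lemma fibD: "y \<in> fib u \<Longrightarrow> y \<in> topspace T" "y \<in> fib u \<Longrightarrow> p y = u"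
  by (auto simp: fib_def)

lemma cont_on_fib: "continuous_map T euclidean f \<Longrightarrow> cont_on_fib u f"
  by (rule continuous_map_from_subtopology)

lemma closed_fib: "closedin T (fib u)"
proof (cases "u \<in> topspace B")
  case True
  then have "closedin B {u}" using Hausdorff_base
    by (simp add: Hausdorff_imp_t1_space closedin_t1_singleton)
  from closedin_continuous_map_preimage[OF p this] show ?thesis by (simp add: fib_def)
next
  case False
  then have "fib u = {}" using continuous_map_image_subset_topspace[OF p] by (auto simp: fib_def)
  then show ?thesis by simp
qed

lemma Cc_iff: "f \<in> Cc T \<longleftrightarrow> continuous_map T euclidean f"
  using compact by (auto simp: Cc_def intro: closedin_compact_space)

context
  fixes u assumes u: "u \<in> topspace B"
begin

lemma sets_m: "sets (m u) = sets (sigma (topspace T) (Collect (openin T)))"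
  using radon[OF u] by (simp add: radon_measure_def)

lemma space_m: "space (m u) = topspace T"
  using sets_eq_imp_space_eq[OF sets_m] openin_subset by (subst (asm) space_measure_of) auto

lemma open_sets: "openin T U \<Longrightarrow> U \<in> sets (m u)"
  unfolding sets_m by (subst sets_measure_of) (use openin_subset in auto)

lemma closed_sets: "closedin T U \<Longrightarrow> U \<in> sets (m u)"
  using open_sets[of "topspace T - U"] sets.compl_sets[of "topspace T - U" "m u"]
  by (simp add: space_m closedin_def Diff_Diff_Int Int_absorb1)

lemma measurable:
  fixes f :: "'a \<Rightarrow> 'c::{second_countable_topology, banach}"
  assumes "continuous_map T euclidean f" shows "f \<in> borel_measurable (m u)"
proof (rule borel_measurableI)
  fix V :: "'c set" assume "open V"
  then have "openin T {x \<in> topspace T. f x \<in> V}"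
    using openin_continuous_map_preimage[OF assms] by auto
  then show "f -` V \<inter> space (m u) \<in> sets (m u)"
    using open_sets by (simp add: space_m vimage_def Int_def conj_commute)
qed

lemma finite_measure: "finite_measure (m u)"
proof
  have "compactin T (topspace T)" using compact by (simp add: compact_space_def)
  then have "emeasure (m u) (topspace T) < \<infinity>"
    using radon[OF u] open_sets[of "topspace T"] by (auto simp: radon_measure_def)
  then show "emeasure (m u) (space (m u)) \<noteq> \<infinity>" by (simp add: space_m)
qed

text \<open>Every compact set off the fibre is covered by finitely many open null sets, so the open
  complement of the fibre is null by inner regularity.\<close>
lemma null_outside: "emeasure (m u) (topspace T - fib u) = 0"
proof -
  let ?U = "topspace T - fib u"
  have "openin T ?U" using closed_fib by (simp add: openin_diff)
  then have eq: "emeasure (m u) ?U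
      = (SUP K\<in>{K. compactin T K \<and> K \<in> sets (m u) \<and> K \<subseteq> ?U}. emeasure (m u) K)"
    using radon[OF u] by (auto simp: radon_measure_def)
  have "emeasure (m u) K = 0" if K: "compactin T K" "K \<in> sets (m u)" "K \<subseteq> ?U" for K
  proof -
    have "\<exists>U. openin T U \<and> y \<in> U \<and> emeasure (m u) U = 0" if "y \<in> K" for y
      using that K support[OF u] by (auto simp: fib_def measure_support_def)
    then obtain U where U: "\<And>y. y \<in> K \<Longrightarrow> openin T (U y) \<and> y \<in> U y \<and> emeasure (m u) (U y) = 0"
      by metis
    have "(\<forall>V\<in>U ` K. openin T V) \<and> K \<subseteq> \<Union> (U ` K)" using U by auto
    then obtain \<F> where \<F>: "finite \<F>" "\<F> \<subseteq> U ` K" "K \<subseteq> \<Union> \<F>"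
      using K(1)[unfolded compactin_def, THEN conjunct2, rule_format, of "U ` K"] by blast
    have null: "V \<in> null_sets (m u)" if V: "V \<in> \<F>" for V
    proof -
      obtain y where "y \<in> K" "V = U y" using V \<F>(2) by blast
      then show ?thesis using U[of y] open_sets by (auto simp: null_sets_def)
    qed
    have "\<Union> \<F> \<in> null_sets (m u)" using \<F>(1) null by (intro null_sets.finite_Union) auto
    then have "emeasure (m u) K \<le> 0"
      using emeasure_mono[OF \<F>(3), of "m u"] by (auto simp: null_sets_def)
    then show ?thesis by simp
  qed
  then have "emeasure (m u) ?U \<le> 0" unfolding eq by (intro SUP_least) auto
  then show ?thesis by simp
qed

lemma AE_fib: "AE y in m u. y \<in> fib u"
proof (rule AE_I')
  show "topspace T - fib u \<in> null_sets (m u)"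
    using null_outside open_sets closed_fib by (auto simp: null_sets_def openin_diff)
qed (auto simp: space_m)

lemma integrable_cont:
  assumes "continuous_map T euclidean (f :: 'a \<Rightarrow> complex)" shows "integrable (m u) f"
proof -
  interpret finite_measure "m u" by (rule finite_measure)
  have "compactin euclidean (f ` topspace T)"
    using assms compact image_compactin unfolding compact_space_def by blast
  then have "bounded (f ` topspace T)" using compact_imp_bounded by auto
  then obtain C where C: "\<forall>y\<in>topspace T. cmod (f y) \<le> C" by (auto simp: bounded_iff)
  show ?thesis
    by (rule integrable_const_bound[of _ C]) (use C in \<open>auto simp: space_m intro: measurable assms\<close>)
qed

lemma I_eq_integral:
  fixes f :: "'a \<Rightarrow> complex"
  assumes "continuous_map T euclidean f"
  shows "I u f = integral\<^sup>L (m u) f"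
proof -
  have "fib u \<in> sets (m u)" by (rule closed_sets[OF closed_fib])
  moreover have "AE y in m u. indicat_real (fib u) y *\<^sub>R f y = f y"
    using AE_fib by (rule eventually_mono) simp
  ultimately show ?thesis unfolding set_lebesgue_integral_def
    by (intro integral_cong_AE borel_measurable_scaleR borel_measurable_indicator measurable assms)
qed

lemma I_cong: "(\<And>y. y \<in> fib u \<Longrightarrow> f y = g y) \<Longrightarrow> I u f = I u g"
  unfolding set_lebesgue_integral_def
  by (rule Bochner_Integration.integral_cong) (auto simp: indicator_def)

lemma set_integrable:
  assumes "cont_on_fib u (f :: 'a \<Rightarrow> complex)" shows "set_integrable (m u) (fib u) f"
proof -
  obtain F where F: "continuous_map T euclidean F" "\<And>y. y \<in> fib u \<Longrightarrow> F y = f y"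
    using compact_Hausdorff_complex_extension[OF compact Hausdorff closed_fib assms] by blast
  have "fib u \<in> sets (m u)" by (rule closed_sets[OF closed_fib])
  then have "set_integrable (m u) (fib u) F"
    unfolding set_integrable_def by (rule integrable_mult_indicator[OF _ integrable_cont[OF F(1)]])
  moreover have "(\<lambda>y. indicat_real (fib u) y *\<^sub>R F y) = (\<lambda>y. indicat_real (fib u) y *\<^sub>R f y)"
    by (auto simp: indicator_def fun_eq_iff F)
  ultimately show ?thesis by (simp add: set_integrable_def)
qed

lemma set_integrable_real:
  assumes "cont_on_fib u (f :: 'a \<Rightarrow> real)" shows "set_integrable (m u) (fib u) f"
proof -
  have "set_integrable (m u) (fib u) (\<lambda>y. complex_of_real (f y))"
    by (intro set_integrable continuous_map_of_real assms)
  then have "integrable (m u) (\<lambda>y. complex_of_real (indicat_real (fib u) y *\<^sub>R f y))"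
    unfolding set_integrable_def by (simp add: scaleR_conv_of_real)
  from integrable_Re[OF this] show ?thesis by (simp add: set_integrable_def)
qed

lemma I_of_real: "I u (\<lambda>y. complex_of_real (f y)) = of_real (I u f)"
  by (rule set_integral_complex_of_real)

lemma I_add:
  fixes f g :: "'a \<Rightarrow> complex"
  assumes "cont_on_fib u f" "cont_on_fib u g" shows "I u (\<lambda>y. f y + g y) = I u f + I u g"
  by (intro set_integral_add set_integrable assms)

lemma I_diff:
  fixes f g :: "'a \<Rightarrow> complex"
  assumes "cont_on_fib u f" "cont_on_fib u g" shows "I u (\<lambda>y. f y - g y) = I u f - I u g"
  by (intro set_integral_diff set_integrable assms)

lemma I_mono:
  fixes f g :: "'a \<Rightarrow> real"
  assumes "cont_on_fib u f" "cont_on_fib u g" "\<And>y. y \<in> fib u \<Longrightarrow> f y \<le> g y"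
  shows "I u f \<le> I u g"
  by (intro set_integral_mono set_integrable_real assms)

lemma I_norm:
  fixes f :: "'a \<Rightarrow> complex"
  assumes "cont_on_fib u f" shows "cmod (I u f) \<le> I u (\<lambda>y. cmod (f y))"
  using integral_norm_bound[of "m u" "\<lambda>y. indicat_real (fib u) y *\<^sub>R f y"]
  by (simp add: set_lebesgue_integral_def)

lemma mass_nonneg: "0 \<le> mass u"
  unfolding mass_def set_lebesgue_integral_def by (rule integral_nonneg_AE) simp

lemma I_const: "I u (\<lambda>_. c :: real) = c * mass u"
  unfolding mass_def using set_integral_mult_right[of "m u" "fib u" c "\<lambda>_. 1"] by simp

lemma I_bound:
  fixes f :: "'a \<Rightarrow> complex"
  assumes "cont_on_fib u f" "\<And>y. y \<in> fib u \<Longrightarrow> cmod (f y) \<le> C"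
  shows "cmod (I u f) \<le> C * mass u"
proof -
  have "cmod (I u f) \<le> I u (\<lambda>y. cmod (f y))" by (rule I_norm[OF assms(1)])
  also have "\<dots> \<le> I u (\<lambda>_. C)" by (intro I_mono continuous_map_cmod assms continuous_map_canonical_const)
  finally show ?thesis by (simp add: I_const)
qed

lemma I_nonneg: "(\<And>y. y \<in> fib u \<Longrightarrow> 0 \<le> (f y :: real)) \<Longrightarrow> 0 \<le> I u f"
  unfolding set_lebesgue_integral_def
  by (rule integral_nonneg_AE) (auto simp: indicator_def intro!: AE_I2)

text \<open>The fibre is the whole support of its measure, so a neighbourhood of \<open>y\<close> on which \<open>f\<close> is at least
  \<open>f y / 2\<close> has positive measure.\<close>
lemma I_pos:
  fixes f :: "'a \<Rightarrow> real"
  assumes f: "cont_on_fib u f" and nonneg: "\<And>y. y \<in> fib u \<Longrightarrow> 0 \<le> f y"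
    and y: "y \<in> fib u" "0 < f y"
  shows "0 < I u f"
proof -
  interpret finite_measure "m u" by (rule finite_measure)
  obtain F' where F': "continuous_map T euclidean F'" "\<And>y. y \<in> fib u \<Longrightarrow> F' y = complex_of_real (f y)"
    using compact_Hausdorff_complex_extension[OF compact Hausdorff closed_fib continuous_map_of_real[OF f]]
    by blast
  define F where "F y = Re (F' y)" for y
  have F: "continuous_map T euclideanreal F" "\<And>y. y \<in> fib u \<Longrightarrow> F y = f y"
    unfolding F_def using F' by (auto intro: continuous_map_Re)
  define V where "V = {z \<in> topspace T. F z \<in> {f y / 2<..}}"
  have V: "openin T V" unfolding V_def by (rule openin_continuous_map_preimage[OF F(1)]) auto
  have "y \<in> V" using y F(2)[OF y(1)] fibD(1)[OF y(1)] by (simp add: V_def)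
  moreover have "y \<in> measure_support T (m u)" unfolding support[OF u] using y(1) by (simp add: fib_def)
  ultimately have "0 < emeasure (m u) V" using V unfolding measure_support_def by blast
  then have *: "0 < measure (m u) V" by (simp add: emeasure_eq_measure)
  have sets: "V \<in> sets (m u)" "fib u \<in> sets (m u)"
    using open_sets[OF V] closed_sets[OF closed_fib] by auto
  have "0 < f y / 2 * measure (m u) V" using * y by simp
  also have "measure (m u) V = measure (m u) (V \<inter> fib u)"
  proof (rule finite_measure_eq_AE)
    show "AE z in m u. z \<in> V \<longleftrightarrow> z \<in> V \<inter> fib u" using AE_fib by (rule eventually_mono) simp
  qed (use sets in simp_all)
  also have "f y / 2 * measure (m u) (V \<inter> fib u) = (\<integral>z. f y / 2 * indicator (V \<inter> fib u) z \<partial>m u)"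
  proof -
    have "V \<inter> fib u \<inter> space (m u) = V \<inter> fib u" using fibD(1) by (auto simp: space_m)
    then show ?thesis by simp
  qed
  also have "\<dots> \<le> I u f"
    unfolding set_lebesgue_integral_def
  proof (rule integral_mono)
    show "integrable (m u) (\<lambda>z. f y / 2 * indicat_real (V \<inter> fib u) z)"
      by (intro integrable_mult_right integrable_real_indicator sets.Int sets) (simp add: emeasure_eq_measure)
    show "integrable (m u) (\<lambda>z. indicat_real (fib u) z *\<^sub>R f z)"
      using set_integrable_real[OF f] by (simp add: set_integrable_def)
    show "f y / 2 * indicat_real (V \<inter> fib u) z \<le> indicat_real (fib u) z *\<^sub>R f z" for z
    proof (cases "z \<in> fib u")
      case True
      then show ?thesis using nonneg[OF True] F(2)[OF True] by (simp add: indicator_def V_def)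
    qed simp
  qed
  finally show ?thesis .
qed

end

lemma mass_bounded: "\<exists>\<Lambda>>0. \<forall>u\<in>topspace B. mass u \<le> \<Lambda>"
proof -
  have c: "continuous_map T euclidean (\<lambda>_. 1 :: complex)" by (rule continuous_map_canonical_const)
  from c have "(\<lambda>_. 1) \<in> Cc T" by (simp only: Cc_iff)
  note continuous_integral[OF this]
  from image_compactin[OF compact_base[unfolded compact_space_def] this]
  have "compactin euclidean ((\<lambda>u. integral\<^sup>L (m u) (\<lambda>_. 1 :: complex)) ` topspace B)" .
  then have "bounded ((\<lambda>u. integral\<^sup>L (m u) (\<lambda>_. 1 :: complex)) ` topspace B)"
    by (simp only: compactin_euclidean_iff compact_imp_bounded)
  then obtain C where C: "\<forall>u\<in>topspace B. cmod (integral\<^sup>L (m u) (\<lambda>_. 1 :: complex)) \<le> C"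
    by (auto simp: bounded_iff)
  have "mass u \<le> max C 1" if u: "u \<in> topspace B" for u
  proof -
    have "complex_of_real (mass u) = integral\<^sup>L (m u) (\<lambda>_. 1 :: complex)"
      unfolding mass_def I_eq_integral[OF u c, symmetric]
      using I_of_real[OF u, of "\<lambda>_. 1"] by (simp only: of_real_1)
    then have "cmod (complex_of_real (mass u)) \<le> C" using C[rule_format, OF u] by simp
    then have "\<bar>mass u\<bar> \<le> C" by simp
    then show ?thesis by linarith
  qed
  moreover have "0 < max C 1" by simp
  ultimately show ?thesis by blast
qed

text \<open>Near \<open>z\<close>, the fibre functions \<open>F w\<close> are uniformly close to one continuous function \<open>H\<close> on
  the whole of \<open>T\<close>, namely an extension of \<open>F z\<close>: the set where they are not is closed, and its
  projection along the compact space \<open>T\<close> is a closed set which misses \<open>z\<close>.\<close>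
lemma continuous_parametric_I:
  fixes F :: "'z \<Rightarrow> 'a \<Rightarrow> complex"
  assumes \<rho>: "continuous_map Z B \<rho>"
    and F: "continuous_map (subtopology (prod_topology Z T) {(z, y). p y = \<rho> z}) euclidean (\<lambda>(z, y). F z y)"
  shows "continuous_map Z euclidean (\<lambda>z. I (\<rho> z) (F z))"
proof (rule continuous_map_locally_uniform_limit)
  fix z and \<epsilon> :: real assume z: "z \<in> topspace Z" and "\<epsilon> > 0"
  let ?P = "prod_topology Z T"
  define S where "S = topspace ?P \<inter> {(z, y). p y = \<rho> z}"
  have F': "continuous_map (subtopology ?P S) euclidean (\<lambda>(z, y). F z y)"
    using F by (simp only: S_def subtopology_restrict)
  obtain \<Lambda> where \<Lambda>: "\<Lambda> > 0" "\<And>u. u \<in> topspace B \<Longrightarrow> mass u \<le> \<Lambda>" using mass_bounded by blast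
  define \<delta> where "\<delta> = \<epsilon> / (2 * \<Lambda>)"
  have \<delta>: "\<delta> > 0" "\<delta> * \<Lambda> < \<epsilon>" using \<open>\<epsilon> > 0\<close> \<Lambda> by (auto simp: \<delta>_def)
  have base: "\<rho> w \<in> topspace B" if "w \<in> topspace Z" for w
    using continuous_map_image_subset_topspace[OF \<rho>] that by auto
  have slice: "cont_on_fib (\<rho> w) (F w)" if w: "w \<in> topspace Z" for w
  proof -
    have "continuous_map (subtopology T (fib (\<rho> w))) (subtopology ?P S) (\<lambda>y. (w, y))"
    proof (rule continuous_map_into_subtopology)
      show "continuous_map (subtopology T (fib (\<rho> w))) ?P (\<lambda>y. (w, y))"
        using w by (intro continuous_map_pairedI continuous_map_from_subtopology) auto
    qed (use w in \<open>auto simp: fib_def S_def\<close>)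
    from continuous_map_compose[OF this F'] show ?thesis by (simp add: o_def)
  qed
  obtain H where H: "continuous_map T euclidean H" "\<And>y. y \<in> fib (\<rho> z) \<Longrightarrow> H y = F z y"
    using compact_Hausdorff_complex_extension[OF compact Hausdorff closed_fib slice[OF z]] by blast
  let ?f = "\<lambda>q. cmod ((case q of (w, y) \<Rightarrow> F w y) - H (snd q))"
  define bad where "bad = {q \<in> topspace (subtopology ?P S). ?f q \<in> {\<delta>..}}"
  have "closedin ?P {q \<in> topspace ?P. p (snd q) = \<rho> (fst q)}"
    by (intro closedin_continuous_maps_eq[OF Hausdorff_base]
        continuous_map_compose[OF continuous_map_snd p, unfolded o_def]
        continuous_map_compose[OF continuous_map_fst \<rho>, unfolded o_def])
  moreover have "S = {q \<in> topspace ?P. p (snd q) = \<rho> (fst q)}" by (auto simp: S_def)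
  ultimately have S: "closedin ?P S" by simp
  have "continuous_map (subtopology ?P S) euclidean (\<lambda>q. H (snd q))"
    by (rule continuous_map_from_subtopology[OF continuous_map_compose[OF continuous_map_snd H(1), unfolded o_def]])
  then have "continuous_map (subtopology ?P S) euclidean ?f"
    by (intro continuous_map_cmod continuous_map_diff F')
  then have "closedin (subtopology ?P S) bad"
    unfolding bad_def by (rule closedin_continuous_map_preimage) auto
  then have "closedin ?P bad" using S by (rule closedin_trans_full)
  then have cl: "closedin Z (fst ` bad)" using closed_map_fst[OF compact, of Z] unfolding closed_map_def by blast
  let ?U = "topspace Z - fst ` bad"
  show "\<exists>U h. openin Z U \<and> z \<in> U \<and> continuous_map Z euclidean h \<and> (\<forall>w\<in>U. dist (I (\<rho> w) (F w)) (h w) < \<epsilon>)"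
  proof (intro exI conjI ballI)
    show "openin Z ?U" using cl by (simp add: openin_diff)
    have "q \<notin> bad" if q: "fst q = z" for q
    proof
      assume "q \<in> bad"
      then have "snd q \<in> fib (\<rho> z)" "\<delta> \<le> cmod (F z (snd q) - H (snd q))"
        using q by (auto simp: bad_def S_def fib_def)
      then show False using H(2) \<delta>(1) by simp
    qed
    then show "z \<in> ?U" using z by blast
    have "continuous_map B euclidean (\<lambda>u. integral\<^sup>L (m u) H)"
      using H(1) by (intro continuous_integral) (simp only: Cc_iff)
    from continuous_map_compose[OF \<rho> this] show "continuous_map Z euclidean (\<lambda>w. integral\<^sup>L (m (\<rho> w)) H)"
      by (simp add: o_def)
    fix w assume w: "w \<in> ?U"
    then have w': "w \<in> topspace Z" by simp
    note \<rho>w = base[OF w']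
    have "dist (I (\<rho> w) (F w)) (integral\<^sup>L (m (\<rho> w)) H) = cmod (I (\<rho> w) (\<lambda>y. F w y - H y))"
      by (simp add: dist_norm I_diff[OF \<rho>w slice[OF w'] cont_on_fib[OF H(1)]] I_eq_integral[OF \<rho>w H(1)])
    also have "\<dots> \<le> \<delta> * mass (\<rho> w)"
    proof (rule I_bound[OF \<rho>w])
      show "cont_on_fib (\<rho> w) (\<lambda>y. F w y - H y)"
        by (intro continuous_map_diff slice w' cont_on_fib H)
      fix y assume y: "y \<in> fib (\<rho> w)"
      show "cmod (F w y - H y) \<le> \<delta>"
      proof (rule ccontr)
        assume "\<not> ?thesis"
        then have "(w, y) \<in> bad" using w' y by (simp add: bad_def S_def fib_def)
        then have "w \<in> fst ` bad" by (rule image_eqI[rotated]) simp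
        then show False using w by blast
      qed
    qed
    also have "\<dots> \<le> \<delta> * \<Lambda>" using \<delta> \<Lambda>(2)[OF \<rho>w] by simp
    finally show "dist (I (\<rho> w) (F w)) (integral\<^sup>L (m (\<rho> w)) H) < \<epsilon>" using \<delta> by simp
  qed
qed

lemma continuous_parametric_I':
  fixes F :: "'z \<Rightarrow> 'a \<Rightarrow> complex"
  assumes "continuous_map Z B \<rho>"
    "continuous_map (subtopology (prod_topology Z T) {(z, y). p y = \<rho> z}) euclidean (\<lambda>q. F (fst q) (snd q))"
  shows "continuous_map Z euclidean (\<lambda>z. I (\<rho> z) (F z))"
  using assms by (intro continuous_parametric_I) (simp_all add: case_prod_beta')

end

section \<open>Compact groupoids with a Haar system\<close>

definition positive_definite :: "'g groupoid_struct \<Rightarrow> ('g \<Rightarrow> complex) \<Rightarrow> bool"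
  where "positive_definite G f \<longleftrightarrow> (\<forall>u\<in>units G.
    pd_kernel {y \<in> arrows G. rng G y = u} (\<lambda>s t. f (arr_comp G (arr_inv G s) t)))"

context groupoid
begin

abbreviation ldiv :: "'g \<Rightarrow> 'g \<Rightarrow> 'g"
  where "ldiv s t \<equiv> arr_comp G (arr_inv G s) t"

lemma composable_iff: "(x, y) \<in> composable G \<longleftrightarrow> x \<in> arrows G \<and> y \<in> arrows G \<and> src G x = rng G y"
  by (simp add: composable_def)

lemma unit_arrow: "u \<in> units G \<Longrightarrow> u \<in> arrows G"
  using units_subset by blast

lemma comp:
  assumes "x \<in> arrows G" "y \<in> arrows G" "src G x = rng G y"
  shows "arr_comp G x y \<in> arrows G" "rng G (arr_comp G x y) = rng G x" "src G (arr_comp G x y) = src G y"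
  using assms comp_closed rng_comp src_comp by (auto simp: composable_iff)

lemma assoc:
  assumes "x \<in> arrows G" "y \<in> arrows G" "z \<in> arrows G" "src G x = rng G y" "src G y = rng G z"
  shows "arr_comp G (arr_comp G x y) z = arr_comp G x (arr_comp G y z)"
  using assms by (intro comp_assoc) (auto simp: composable_iff)

lemma inv_comp_cancel:
  assumes "x \<in> arrows G" "y \<in> arrows G"
  shows "src G x = rng G y \<Longrightarrow> ldiv x (arr_comp G x y) = y"
    and "rng G x = rng G y \<Longrightarrow> arr_comp G x (ldiv x y) = y"
  using assoc[of "arr_inv G x" x y] assoc[of x "arr_inv G x" y] assms
  by (auto simp: inv_closed rng_inv src_inv comp_inv_left comp_inv_right comp_rng)

lemma comp_right_cancel:
  assumes "x \<in> arrows G" "y \<in> arrows G" "src G x = src G y"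
  shows "arr_comp G (arr_comp G x (arr_inv G y)) y = x"
  using assoc[of x "arr_inv G y" y] assms
  by (simp add: inv_closed rng_inv src_inv comp_inv_left) (metis comp_src)

lemma inv_inv: assumes "x \<in> arrows G" shows "arr_inv G (arr_inv G x) = x"
proof -
  have "arr_comp G (ldiv (arr_inv G x) (arr_inv G x)) x
      = ldiv (arr_inv G x) (ldiv x x)"
    using assms by (intro assoc) (auto simp: inv_closed rng_inv src_inv)
  moreover have "ldiv (arr_inv G x) (src G x) = arr_inv G (arr_inv G x)"
    using comp_src[of "arr_inv G (arr_inv G x)"] assms by (simp add: inv_closed rng_inv src_inv)
  ultimately show ?thesis
    using assms by (simp add: comp_inv_left comp_rng inv_closed src_inv)
qed

lemma inv_unique:
  assumes "x \<in> arrows G" "y \<in> arrows G" "src G x = rng G y" "arr_comp G x y = rng G x"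
  shows "y = arr_inv G x"
  using inv_comp_cancel(1)[OF assms(1-3)] comp_src[OF inv_closed[OF assms(1)]] assms
  by (simp add: src_inv)

lemma inv_comp:
  assumes "x \<in> arrows G" "y \<in> arrows G" "src G x = rng G y"
  shows "arr_inv G (arr_comp G x y) = ldiv y (arr_inv G x)"
proof (rule inv_unique[symmetric])
  have "arr_comp G (arr_comp G x y) (ldiv y (arr_inv G x))
      = arr_comp G x (arr_comp G y (ldiv y (arr_inv G x)))"
    using assms by (intro assoc) (auto simp: inv_closed rng_inv src_inv comp)
  also have "\<dots> = rng G x"
    using assms by (simp add: inv_comp_cancel inv_closed rng_inv comp_inv_right)
  finally show "arr_comp G (arr_comp G x y) (ldiv y (arr_inv G x)) = rng G (arr_comp G x y)"
    using assms by (simp add: comp)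
qed (use assms in \<open>auto simp: inv_closed rng_inv src_inv comp\<close>)

lemma inv_unit: "u \<in> units G \<Longrightarrow> arr_inv G u = u"
  using inv_unique[of u u] comp_rng[of u] by (simp add: unit_arrow rng_unit src_unit)

lemma unit_comp: "u \<in> units G \<Longrightarrow> y \<in> arrows G \<Longrightarrow> rng G y = u \<Longrightarrow> arr_comp G u y = y"
  using comp_rng by auto

lemma inv_comp_closed:
  assumes "s \<in> arrows G" "t \<in> arrows G" "rng G s = rng G t"
  shows "ldiv s t \<in> arrows G" "rng G (ldiv s t) = src G s"
    "src G (ldiv s t) = src G t"
  using assms by (auto simp: comp inv_closed src_inv rng_inv)

lemma positive_definiteD:
  "positive_definite G f \<Longrightarrow> u \<in> units G \<Longrightarrow>
    pd_kernel {y \<in> arrows G. rng G y = u} (\<lambda>s t. f (ldiv s t))"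
  by (simp add: positive_definite_def)

lemma positive_definite_unit:
  assumes "positive_definite G f" "u \<in> units G"
  shows "Im (f u) = 0" "0 \<le> Re (f u)"
  using pd_kernel_diag[OF positive_definiteD[OF assms], of u] assms(2)
  by (auto simp: unit_arrow rng_unit src_unit comp_inv_left)

lemma positive_definite_inv:
  assumes "positive_definite G f" "x \<in> arrows G"
  shows "f (arr_inv G x) = cnj (f x)"
  using pd_kernel_symm[OF positive_definiteD[OF assms(1) rng_closed[OF assms(2)]], of "rng G x" x] assms(2)
  by (simp add: rng_closed unit_arrow rng_unit inv_unit comp_rng)
    (metis comp_src inv_closed src_inv)

lemma positive_definite_cmod_le:
  assumes "positive_definite G f" "x \<in> arrows G"
  shows "(cmod (f x))\<^sup>2 \<le> Re (f (rng G x)) * Re (f (src G x))"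
  using pd_kernel_cmod_le[OF positive_definiteD[OF assms(1) rng_closed[OF assms(2)]], of "rng G x" x] assms(2)
  by (simp add: rng_closed unit_arrow rng_unit src_unit inv_unit comp_rng comp_inv_left unit_comp)

end

context lch_groupoid
begin

abbreviation contG
  where "contG f \<equiv> continuous_map (arr_top G) euclidean f"

lemma continuous_inv:
  "continuous_map Z (arr_top G) a \<Longrightarrow> continuous_map Z (arr_top G) (\<lambda>z. arr_inv G (a z))"
  using continuous_map_compose[OF _ inv_continuous, of Z a] by (simp add: o_def)

lemma continuous_comp:
  assumes "continuous_map Z (arr_top G) a" "continuous_map Z (arr_top G) b"
    "\<And>z. z \<in> topspace Z \<Longrightarrow> src G (a z) = rng G (b z)"
  shows "continuous_map Z (arr_top G) (\<lambda>z. arr_comp G (a z) (b z))"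
proof -
  have "a z \<in> arrows G" "b z \<in> arrows G" if "z \<in> topspace Z" for z
    using assms(1,2) that continuous_map_image_subset_topspace by blast+
  then have "continuous_map Z (subtopology (prod_topology (arr_top G) (arr_top G)) (composable G)) (\<lambda>z. (a z, b z))"
    using assms(3) by (intro continuous_map_into_subtopology continuous_map_pairedI assms(1,2))
      (auto simp: composable_iff)
  from continuous_map_compose[OF this comp_continuous] show ?thesis by (simp add: o_def)
qed

lemma continuous_rng: "continuous_map (arr_top G) (arr_top G) (rng G)"
proof -
  have "continuous_map (arr_top G) (arr_top G) (\<lambda>x. arr_comp G x (arr_inv G x))"
    by (intro continuous_comp continuous_inv) (auto simp: rng_inv)
  then show ?thesis by (rule continuous_map_eq) (simp add: comp_inv_right)
qed

lemma continuous_src: "continuous_map (arr_top G) (arr_top G) (src G)"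
proof -
  have "continuous_map (arr_top G) (arr_top G) (\<lambda>x. ldiv x x)"
    by (intro continuous_comp continuous_inv) (auto simp: src_inv)
  then show ?thesis by (rule continuous_map_eq) (simp add: comp_inv_left)
qed

lemma topspace_unit_space: "topspace (unit_space G) = units G"
  using units_subset by auto

lemma continuous_rng_unit: "continuous_map (arr_top G) (unit_space G) (rng G)"
  by (rule continuous_map_into_subtopology[OF continuous_rng]) (auto simp: rng_closed)

lemma continuous_src_unit: "continuous_map (arr_top G) (unit_space G) (src G)"
  by (rule continuous_map_into_subtopology[OF continuous_src]) (auto simp: src_closed)

lemma closed_units: "closedin (arr_top G) (units G)"
proof -
  have "closedin (arr_top G) {x \<in> arrows G. rng G x = x}"
    by (rule closedin_continuous_maps_eq[OF Hausdorff continuous_rng]) simp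
  moreover have "{x \<in> arrows G. rng G x = x} = units G"
    using rng_closed rng_unit unit_arrow by force
  ultimately show ?thesis by simp
qed

end

locale haar_groupoid = lch_groupoid G for G :: "'g groupoid_struct" +
  fixes lam :: "'g \<Rightarrow> 'g measure"
  assumes compact_arrows: "compact_space (arr_top G)" and haar: "haar_system G lam"
begin

lemma compact_units: "compact_space (unit_space G)"
  using closedin_compact_space[OF compact_arrows closed_units] by (simp add: compact_space_subtopology)

sublocale fibre_integral "arr_top G" "unit_space G" "rng G" lam
proof
  show "Hausdorff_space (arr_top G)" by (rule Hausdorff)
  show "Hausdorff_space (unit_space G)" by (rule Hausdorff_space_subtopology[OF Hausdorff])
  show "radon_measure (arr_top G) (lam u)" "measure_support (arr_top G) (lam u) = {y \<in> arrows G. rng G y = u}"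
    if "u \<in> topspace (unit_space G)" for u
    using haar that by (auto simp: haar_system_def full_equivariant_system_def)
  show "continuous_map (unit_space G) euclidean (\<lambda>u. integral\<^sup>L (lam u) f)" if "f \<in> Cc (arr_top G)" for f
    using haar that by (auto simp: haar_system_def full_equivariant_system_def)
qed (fact compact_arrows compact_units continuous_rng_unit)+

lemma fib_iff: "y \<in> fib u \<longleftrightarrow> y \<in> arrows G \<and> rng G y = u"
  by (auto simp: fib_def)

text \<open>The axiom concerns functions on all arrows; an integrand on one fibre is first extended to them.\<close>
lemma I_invariant:
  fixes f :: "'g \<Rightarrow> complex"
  assumes \<gamma>: "\<gamma> \<in> arrows G" and f: "cont_on_fib (rng G \<gamma>) f"
  shows "I (src G \<gamma>) (\<lambda>y. f (arr_comp G \<gamma> y)) = I (rng G \<gamma>) f"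
proof -
  obtain F where F: "contG F" "\<And>y. y \<in> fib (rng G \<gamma>) \<Longrightarrow> F y = f y"
    using compact_Hausdorff_complex_extension[OF compact_arrows Hausdorff closed_fib f] by blast
  have s: "src G \<gamma> \<in> topspace (unit_space G)" "rng G \<gamma> \<in> topspace (unit_space G)"
    unfolding topspace_unit_space using \<gamma> by (auto simp: src_closed rng_closed)
  have "I (src G \<gamma>) (\<lambda>y. f (arr_comp G \<gamma> y)) = I (src G \<gamma>) (\<lambda>y. F (arr_comp G \<gamma> y))"
    by (rule I_cong[OF s(1)]) (use \<gamma> F(2) in \<open>simp add: fib_iff comp\<close>)
  also have "\<dots> = integral\<^sup>L (lam (rng G \<gamma>)) F"
    using haar \<gamma> F(1) by (simp add: haar_system_def full_equivariant_system_def fib_def flip: Cc_iff)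
  also have "\<dots> = I (rng G \<gamma>) F" by (rule I_eq_integral[OF s(2) F(1), symmetric])
  also have "\<dots> = I (rng G \<gamma>) f" by (rule I_cong[OF s(2)]) (rule F(2))
  finally show ?thesis .
qed

text \<open>The coefficient of the left regular representation at the section \<open>u \<mapsto> (z \<mapsto> a (z\<inverse>))\<close>.\<close>
definition autocor :: "('g \<Rightarrow> complex) \<Rightarrow> 'g \<Rightarrow> complex"
  where "autocor a g = I (rng G g) (\<lambda>z. cnj (a (arr_inv G z)) * a (ldiv z g))"

lemma continuous_autocor:
  assumes a: "contG a"
  shows "contG (autocor a)"
  unfolding autocor_def
proof (rule continuous_parametric_I'[OF continuous_rng_unit])
  let ?P = "subtopology (prod_topology (arr_top G) (arr_top G)) {(g, z). rng G z = rng G g}"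
  have i: "continuous_map ?P (arr_top G) (\<lambda>q. arr_inv G (snd q))"
    by (rule continuous_inv[OF continuous_map_sub_prod(2)])
  have c: "continuous_map ?P (arr_top G) (\<lambda>q. ldiv (snd q) (fst q))"
    by (rule continuous_comp[OF i continuous_map_sub_prod(1)]) (auto simp: src_inv)
  show "continuous_map ?P euclidean
      (\<lambda>q. cnj (a (arr_inv G (snd q))) * a (ldiv (snd q) (fst q)))"
    by (intro continuous_map_cmult continuous_map_cnj continuous_map_after[OF i a] continuous_map_after[OF c a])
qed

context
  fixes a :: "'g \<Rightarrow> complex" and u :: 'g
  assumes a: "contG a" and u: "u \<in> units G"
begin

lemma continuous_translate:
  assumes "x \<in> fib u"
  shows "cont_on_fib u (\<lambda>z. a (ldiv z x))"
proof -
  have i: "continuous_map (subtopology (arr_top G) (fib u)) (arr_top G) (\<lambda>z. arr_inv G z)"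
    by (rule continuous_map_from_subtopology[OF inv_continuous])
  have "continuous_map (subtopology (arr_top G) (fib u)) (arr_top G) (\<lambda>z. ldiv z x)"
    using assms by (intro continuous_comp[OF i]) (auto simp: fib_iff src_inv)
  from continuous_map_after[OF this a] show ?thesis .
qed

text \<open>The substitution \<open>z = s y\<close>. It shows that the kernel of \<open>autocor a\<close> is a Gram kernel: its
  entries are inner products of left translates of \<open>a\<close>.\<close>
lemma autocor_translate:
  assumes "s \<in> fib u" "t \<in> fib u"
  shows "autocor a (ldiv s t)
    = I u (\<lambda>z. cnj (a (ldiv z s)) * a (ldiv z t))"
proof -
  let ?f = "\<lambda>z. cnj (a (ldiv z s)) * a (ldiv z t)"
  have s: "s \<in> arrows G" "rng G s = u" and t: "t \<in> arrows G" "rng G t = u"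
    using assms by (auto simp: fib_iff)
  have "I u ?f = I (src G s) (\<lambda>y. ?f (arr_comp G s y))"
  proof -
    have "cont_on_fib (rng G s) ?f"
      unfolding s(2) by (intro continuous_map_cmult continuous_map_cnj continuous_translate assms)
    from I_invariant[OF s(1) this] s(2) show ?thesis by simp
  qed
  also have "\<dots> = I (src G s) (\<lambda>y. cnj (a (arr_inv G y)) * a (ldiv y (ldiv s t)))"
  proof (rule I_cong)
    show "src G s \<in> topspace (unit_space G)" using s src_closed topspace_unit_space by auto
    fix y assume "y \<in> fib (src G s)"
    then have y: "y \<in> arrows G" "rng G y = src G s" by (auto simp: fib_iff)
    have "ldiv (arr_comp G s y) s = arr_inv G y"
      using s y by (simp add: inv_comp comp_right_cancel inv_closed src_inv)
    moreover have "ldiv (arr_comp G s y) t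
        = ldiv y (ldiv s t)"
      using s t y by (simp add: inv_comp assoc inv_closed src_inv rng_inv)
    ultimately show "?f (arr_comp G s y)
        = cnj (a (arr_inv G y)) * a (ldiv y (ldiv s t))" by simp
  qed
  also have "\<dots> = autocor a (ldiv s t)"
    unfolding autocor_def using s t by (simp add: inv_comp_closed)
  finally show ?thesis ..
qed

lemma continuous_kcomb_translate:
  "supported (fib u) c \<Longrightarrow> cont_on_fib u (kcomb (\<lambda>z x. a (ldiv z x)) c)"
proof (induction c)
  case Nil
  then show ?case by (simp add: kcomb_def)
next
  case (Cons p c)
  obtain b x where p: "p = (b, x)" by (cases p)
  have eq: "kcomb (\<lambda>z x. a (ldiv z x)) (p # c)
      = (\<lambda>z. b * a (ldiv z x) + kcomb (\<lambda>z x. a (ldiv z x)) c z)"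
    by (simp add: p fun_eq_iff)
  show ?case unfolding eq using Cons p
    by (intro continuous_map_add continuous_map_cmult continuous_map_canonical_const continuous_translate) auto
qed

lemma kform_autocor:
  assumes c: "supported (fib u) c" and d: "supported (fib u) d"
  shows "kform (\<lambda>s t. autocor a (ldiv s t)) c d
    = I u (\<lambda>z. cnj (kcomb (\<lambda>z x. a (ldiv z x)) c z)
        * kcomb (\<lambda>z x. a (ldiv z x)) d z)"
proof -
  let ?k = "\<lambda>z x. a (ldiv z x)"
  have u': "u \<in> topspace (unit_space G)" using u by (simp add: unit_arrow)
  have 1: "kcomb (\<lambda>s t. autocor a (ldiv s t)) d s = I u (\<lambda>z. cnj (?k z s) * kcomb ?k d z)"
    if s: "s \<in> fib u" for s
    using d
  proof (induction d)
    case (Cons q d)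
    obtain b t where q: "q = (b, t)" by (cases q)
    have t: "t \<in> fib u" and d: "supported (fib u) d" using Cons q by auto
    have "I u (\<lambda>z. cnj (?k z s) * kcomb ?k (q # d) z)
        = I u (\<lambda>z. b * (cnj (?k z s) * ?k z t) + cnj (?k z s) * kcomb ?k d z)"
      by (simp add: q algebra_simps)
    also have "\<dots> = I u (\<lambda>z. b * (cnj (?k z s) * ?k z t)) + I u (\<lambda>z. cnj (?k z s) * kcomb ?k d z)"
      by (rule I_add[OF u']) (intro continuous_map_cmult continuous_map_cnj continuous_map_canonical_const
        continuous_translate continuous_kcomb_translate s t d)+
    finally show ?case
      using autocor_translate[OF s t] Cons.IH[OF d] by (simp add: q)
  qed simp
  have "ev c (\<lambda>s. I u (\<lambda>z. cnj (?k z s) * kcomb ?k d z)) = I u (\<lambda>z. cnj (kcomb ?k c z) * kcomb ?k d z)"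
    using c
  proof (induction c)
    case (Cons q c)
    obtain b s where q: "q = (b, s)" by (cases q)
    have s: "s \<in> fib u" and c: "supported (fib u) c" using Cons q by auto
    have "I u (\<lambda>z. cnj (kcomb ?k (q # c) z) * kcomb ?k d z)
        = I u (\<lambda>z. cnj b * (cnj (?k z s) * kcomb ?k d z) + cnj (kcomb ?k c z) * kcomb ?k d z)"
      by (simp add: q algebra_simps)
    also have "\<dots> = I u (\<lambda>z. cnj b * (cnj (?k z s) * kcomb ?k d z)) + I u (\<lambda>z. cnj (kcomb ?k c z) * kcomb ?k d z)"
      by (rule I_add[OF u']) (intro continuous_map_cmult continuous_map_cnj continuous_map_canonical_const
        continuous_translate continuous_kcomb_translate s c d)+
    finally show ?case using Cons.IH[OF c] by (simp add: q)
  qed simp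
  then show ?thesis unfolding kform_def using ev_cong[OF c 1] by simp
qed

lemma kform_autocor_self:
  assumes c: "supported (fib u) c"
  shows "kform (\<lambda>s t. autocor a (ldiv s t)) c c
    = of_real (I u (\<lambda>z. (cmod (kcomb (\<lambda>z x. a (ldiv z x)) c z))\<^sup>2))"
proof -
  have "cnj w * w = of_real ((cmod w)\<^sup>2)" for w by (simp add: complex_norm_square mult.commute del: of_real_power)
  then show ?thesis unfolding kform_autocor[OF c c]
    by (simp only: set_integral_complex_of_real)
qed

end

lemma autocor_unit:
  assumes "contG a" "u \<in> units G"
  shows "autocor a u = of_real (I u (\<lambda>z. (cmod (a (arr_inv G z)))\<^sup>2))"
proof -
  have "u \<in> fib u" using assms(2) by (simp add: fib_iff unit_arrow rng_unit)
  then have "autocor a (ldiv u u)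
      = of_real (I u (\<lambda>z. (cmod (a (ldiv z u)))\<^sup>2))"
    using kform_autocor_self[OF assms, of "[(1, u)]"] by simp
  moreover have "I u (\<lambda>z. (cmod (a (ldiv z u)))\<^sup>2) = I u (\<lambda>z. (cmod (a (arr_inv G z)))\<^sup>2)"
  proof (rule I_cong)
    show "u \<in> topspace (unit_space G)" using assms(2) by (simp add: unit_arrow)
    fix z assume "z \<in> fib u"
    then show "(cmod (a (ldiv z u)))\<^sup>2 = (cmod (a (arr_inv G z)))\<^sup>2"
      using comp_src[of "arr_inv G z"] by (simp add: fib_iff inv_closed src_inv)
  qed
  ultimately show ?thesis using assms(2) by (simp add: inv_unit unit_comp unit_arrow rng_unit)
qed

lemma positive_definite_autocor:
  assumes "contG a"
  shows "positive_definite G (autocor a)"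
  unfolding positive_definite_def pd_kernel_def
proof (intro ballI allI impI)
  fix u c assume u: "u \<in> units G" and c: "supported {y \<in> arrows G. rng G y = u} c"
  then have c': "supported (fib u) c" by (simp add: fib_def)
  have "0 \<le> I u (\<lambda>z. (cmod (kcomb (\<lambda>z x. a (ldiv z x)) c z))\<^sup>2)"
    using u by (intro I_nonneg) (auto simp: unit_arrow)
  then show "Im (kform (\<lambda>s t. autocor a (ldiv s t)) c c) = 0 \<and>
      0 \<le> Re (kform (\<lambda>s t. autocor a (ldiv s t)) c c)"
    unfolding kform_autocor_self[OF assms u c'] by simp
qed

end

section \<open>Subgroupoids\<close>

lemma subgroupoid_simps:
  "arr_top (subgroupoid G H) = subtopology (arr_top G) H" "units (subgroupoid G H) = units G \<inter> H"
  "rng (subgroupoid G H) = rng G" "src (subgroupoid G H) = src G"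
  "arr_comp (subgroupoid G H) = arr_comp G" "arr_inv (subgroupoid G H) = arr_inv G"
  by (auto simp: subgroupoid_def)

locale haar_subgroupoid = haar_groupoid G lam + H: haar_groupoid "subgroupoid G H" lamH
  for G :: "'g groupoid_struct" and lam and H :: "'g set" and lamH +
  assumes wide: "wide_subgroupoid H G"
begin

lemma H_closure: "x \<in> H \<Longrightarrow> x \<in> arrows G" "u \<in> units G \<Longrightarrow> u \<in> H" "x \<in> H \<Longrightarrow> arr_inv G x \<in> H"
  "x \<in> H \<Longrightarrow> y \<in> H \<Longrightarrow> src G x = rng G y \<Longrightarrow> arr_comp G x y \<in> H"
  using wide by (auto simp: wide_subgroupoid_def)

lemma H_arrows: "arrows (subgroupoid G H) = H" "units (subgroupoid G H) = units G"
  unfolding subgroupoid_simps using H_closure by auto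

lemma H_fib_iff: "y \<in> H.fib u \<longleftrightarrow> y \<in> H \<and> rng G y = u"
  using H.fib_iff[of y u] by (simp only: H_arrows subgroupoid_simps(3))

lemma H_unit_space: "unit_space (subgroupoid G H) = unit_space G"
  using H_arrows(2) by (simp add: subgroupoid_simps subtopology_subtopology Int_commute)

abbreviation contH
  where "contH f \<equiv> continuous_map (arr_top (subgroupoid G H)) euclidean f"

lemma H_incl: "continuous_map (arr_top (subgroupoid G H)) (arr_top G) (\<lambda>x. x)"
  unfolding subgroupoid_simps by (simp add: continuous_map_from_subtopology)

text \<open>For positive definite \<open>r\<close>, where \<open>cnj (r y) = r (y\<inverse>)\<close>, this is the convolution of \<open>k\<close> and \<open>r\<close> over \<open>H\<close>. As \<open>w\<close>
  may be any arrow of \<open>G\<close>, it carries \<open>r\<close> from \<open>H\<close> to \<open>G\<close>.\<close>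
definition conv :: "('g \<Rightarrow> complex) \<Rightarrow> ('g \<Rightarrow> complex) \<Rightarrow> 'g \<Rightarrow> complex"
  where "conv k r w = H.I (src G w) (\<lambda>y. k (arr_comp G w y) * cnj (r y))"

context
  fixes k r :: "'g \<Rightarrow> complex"
  assumes k: "contG k"
    and r: "contH r"
begin

lemma continuous_conv: "contG (conv k r)"
  unfolding conv_def
proof (rule H.continuous_parametric_I')
  show "continuous_map (arr_top G) (unit_space (subgroupoid G H)) (src G)"
    unfolding H_unit_space by (rule continuous_src_unit)
  let ?P = "subtopology (prod_topology (arr_top G) (arr_top (subgroupoid G H)))
    {(w, y). rng (subgroupoid G H) y = src G w}"
  have "continuous_map ?P (arr_top G) (\<lambda>q. snd q)"
    by (rule continuous_map_after[OF continuous_map_sub_prod(2) H_incl])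
  then have c: "continuous_map ?P (arr_top G) (\<lambda>q. arr_comp G (fst q) (snd q))"
    by (rule continuous_comp[OF continuous_map_sub_prod(1)]) (auto simp: subgroupoid_simps)
  show "continuous_map ?P euclidean (\<lambda>q. k (arr_comp G (fst q) (snd q)) * cnj (r (snd q)))"
    by (intro continuous_map_cmult continuous_map_cnj continuous_map_after[OF c k]
        continuous_map_after[OF continuous_map_sub_prod(2) r])
qed

lemma continuous_conv_integrand:
  assumes w: "w \<in> arrows G" and h: "h \<in> H" "rng G h = src G w"
  shows "H.cont_on_fib (src G w) (\<lambda>y. k (arr_comp G w y))"
    "H.cont_on_fib (src G w) (\<lambda>y. r (ldiv h y))"
proof -
  let ?S = "subtopology (arr_top (subgroupoid G H)) (H.fib (src G w))"
  have i: "continuous_map ?S (arr_top (subgroupoid G H)) (\<lambda>y. y)"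
    by (simp add: continuous_map_from_subtopology)
  have c: "continuous_map ?S (arr_top G) (\<lambda>y. arr_comp G w y)"
    using w by (intro continuous_comp[OF _ continuous_map_after[OF i H_incl]]) (auto simp: H_fib_iff)
  show "H.cont_on_fib (src G w) (\<lambda>y. k (arr_comp G w y))"
    by (rule continuous_map_after[OF c k])
  have "continuous_map ?S (arr_top (subgroupoid G H)) (\<lambda>y. arr_comp (subgroupoid G H) (arr_inv G h) y)"
  proof (rule H.continuous_comp[OF _ i])
    show "continuous_map ?S (arr_top (subgroupoid G H)) (\<lambda>y. arr_inv G h)"
      using h H_closure(3) H_arrows(1) by simp
    fix y assume "y \<in> topspace ?S"
    then have "rng G y = src G w" using H_fib_iff[of y "src G w"] by simp
    then show "src (subgroupoid G H) (arr_inv G h) = rng (subgroupoid G H) y"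
      unfolding subgroupoid_simps using h H_closure(1) by (simp add: src_inv)
  qed
  from continuous_map_after[OF this r]
  show "H.cont_on_fib (src G w) (\<lambda>y. r (ldiv h y))" unfolding subgroupoid_simps(5) .
qed

text \<open>The substitution of \<open>h\<inverse> y\<close> for \<open>y\<close>. In this form \<open>h\<close> enters the integrand through the kernel of \<open>r\<close>
  only.\<close>
lemma conv_translate:
  assumes w: "w \<in> arrows G" and h: "h \<in> H" "rng G h = src G w"
  shows "conv k r (arr_comp G w h) = H.I (src G w) (\<lambda>y. k (arr_comp G w y) * cnj (r (ldiv h y)))"
proof -
  let ?f = "\<lambda>y. k (arr_comp G w y) * cnj (r (ldiv h y))"
  have "H.cont_on_fib (rng (subgroupoid G H) h) ?f"
    unfolding subgroupoid_simps(3)[THEN fun_cong, of G H h] h(2)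
    by (intro continuous_map_cmult continuous_map_cnj continuous_conv_integrand[OF w h])
  with H.I_invariant[of h ?f]
  have "H.I (src (subgroupoid G H) h) (\<lambda>y. ?f (arr_comp (subgroupoid G H) h y)) = H.I (rng (subgroupoid G H) h) ?f"
    using h(1) unfolding H_arrows by blast
  then have "H.I (src G h) (\<lambda>y. ?f (arr_comp G h y)) = H.I (src G w) ?f"
    unfolding subgroupoid_simps(4)[THEN fun_cong, of G H h] subgroupoid_simps(3)[THEN fun_cong, of G H h]
      subgroupoid_simps(5) h(2) .
  moreover have "H.I (src G h) (\<lambda>y. ?f (arr_comp G h y)) = H.I (src G h) (\<lambda>y. k (arr_comp G (arr_comp G w h) y) * cnj (r y))"
  proof (rule H.I_cong)
    show "src G h \<in> topspace (unit_space (subgroupoid G H))"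
      unfolding H_unit_space topspace_unit_space using h H_closure src_closed by auto
    fix y assume "y \<in> H.fib (src G h)"
    then have y: "y \<in> arrows G" "rng G y = src G h" using H_closure by (auto simp: H_fib_iff)
    show "?f (arr_comp G h y) = k (arr_comp G (arr_comp G w h) y) * cnj (r y)"
      using w h y H_closure(1)[OF h(1)] by (simp add: assoc inv_comp_cancel)
  qed
  ultimately show ?thesis unfolding conv_def using w h H_closure(1)[OF h(1)] by (simp add: comp)
qed

end

end

section \<open>Extension of positive definite functions\<close>

text \<open>Urysohn functions for the pairs \<open>V, W\<close> of basic open sets with the closure of \<open>V\<close> inside \<open>W\<close>. There
  are countably many of them, which lets one sequence of bumps serve all units at once.\<close>
lemma compact_second_countable_bumps:
  assumes T: "compact_space T" "Hausdorff_space T" "second_countable T"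
  obtains b :: "nat \<Rightarrow> 'a \<Rightarrow> real"
  where "\<And>j. continuous_map T euclideanreal (b j)"
    "\<And>j x. x \<in> topspace T \<Longrightarrow> 0 \<le> b j x" "\<And>j x. x \<in> topspace T \<Longrightarrow> b j x \<le> 1"
    "\<And>x N. openin T N \<Longrightarrow> x \<in> N \<Longrightarrow> \<exists>j. b j x > 0 \<and> (\<forall>y\<in>topspace T - N. b j y = 0)"
proof -
  have normal: "normal_space T" using T compact_Hausdorff_or_regular_imp_normal_space by blast
  obtain \<B> where base: "countable \<B>" "\<forall>V\<in>\<B>. openin T V"
    "\<forall>U x. openin T U \<and> x \<in> U \<longrightarrow> (\<exists>V\<in>\<B>. x \<in> V \<and> V \<subseteq> U)"
    using T(3) unfolding second_countable_def by (elim exE conjE)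
  have \<B>: "countable \<B>" "\<And>V. V \<in> \<B> \<Longrightarrow> openin T V"
    "\<And>U x. openin T U \<Longrightarrow> x \<in> U \<Longrightarrow> \<exists>V\<in>\<B>. x \<in> V \<and> V \<subseteq> U"
    by (simp_all only: base)
  define good where "good V W f \<longleftrightarrow> continuous_map T (top_of_set {0..1::real}) f \<and>
    (T closure_of V \<subseteq> W \<longrightarrow> f ` (T closure_of V) \<subseteq> {1} \<and> f ` (topspace T - W) \<subseteq> {0})" for V W f
  have "\<exists>f. good V W f" if "W \<in> \<B>" for V W
  proof (cases "T closure_of V \<subseteq> W")
    case True
    have 1: "closedin T (topspace T - W)" using \<B>(2)[OF that] by blast
    have 2: "disjnt (topspace T - W) (T closure_of V)" using True by (auto simp: disjnt_def)
    obtain g where "continuous_map T (top_of_set {0..1}) g"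
      "g ` (topspace T - W) \<subseteq> {0 :: real}" "g ` (T closure_of V) \<subseteq> {1}"
      by (rule Urysohn_lemma[OF normal 1 closedin_closure_of 2 zero_le_one])
    then show ?thesis unfolding good_def by blast
  next
    case False
    have "continuous_map T (top_of_set {0..1::real}) (\<lambda>_. 0)" by simp
    then show ?thesis using False unfolding good_def by blast
  qed
  then have "\<forall>V W. \<exists>f. W \<in> \<B> \<longrightarrow> good V W f" by blast
  then obtain f where f: "\<And>V W. W \<in> \<B> \<Longrightarrow> good V W (f V W)" unfolding choice_iff by blast
  define S where "S = insert (\<lambda>_. 0 :: real) ((\<lambda>(V, W). f V W) ` (\<B> \<times> \<B>))"
  have S: "countable S" "S \<noteq> {}" unfolding S_def using \<B>(1) by simp_all
  have mem: "continuous_map T (top_of_set {0..1::real}) (from_nat_into S j)" for j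
  proof -
    have cont: "continuous_map T (top_of_set {0..1::real}) g" if "g \<in> S" for g
      using that unfolding S_def
    proof (elim insertE imageE)
      fix p assume "g = (case p of (V, W) \<Rightarrow> f V W)" "p \<in> \<B> \<times> \<B>"
      then show ?thesis using f[of "snd p" "fst p"] by (simp add: good_def case_prod_beta mem_Times_iff)
    qed simp
    show ?thesis by (rule cont[OF from_nat_into[OF S(2)]])
  qed
  show thesis
  proof (rule that[of "from_nat_into S"])
    show "continuous_map T euclideanreal (from_nat_into S j)" for j
      using mem[of j] by (simp add: continuous_map_in_subtopology)
    show "0 \<le> from_nat_into S j x" "from_nat_into S j x \<le> 1" if "x \<in> topspace T" for j x
      using continuous_map_image_subset_topspace[OF mem[of j]] that by auto
    show "\<exists>j. from_nat_into S j x > 0 \<and> (\<forall>y\<in>topspace T - N. from_nat_into S j y = 0)"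
      if N: "openin T N" "x \<in> N" for N x
    proof -
      obtain W where W: "W \<in> \<B>" "x \<in> W" "W \<subseteq> N" using \<B>(3)[OF N] by blast
      have x: "x \<in> topspace T" using N openin_subset by blast
      have "closedin T {x}" using T(2) x by (simp add: Hausdorff_imp_t1_space closedin_t1_singleton)
      moreover have "{x} \<subseteq> W" using W by simp
      ultimately obtain O' where O': "openin T O'" "{x} \<subseteq> O'" "T closure_of O' \<subseteq> W"
        using normal[unfolded normal_space_alt, rule_format, of "{x}" W] \<B>(2)[OF W(1)] by blast
      obtain V where V: "V \<in> \<B>" "x \<in> V" "V \<subseteq> O'" using \<B>(3)[OF O'(1)] O'(2) by blast
      have cl: "T closure_of V \<subseteq> W" using closure_of_mono[OF V(3)] O'(3) by blast
      have "x \<in> T closure_of V" using closure_of_subset[OF openin_subset[OF \<B>(2)[OF V(1)]]] V(2) by blast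
      then have 1: "f V W x = 1" "\<forall>y\<in>topspace T - N. f V W y = 0"
        using f[OF W(1), of V] cl W(3) unfolding good_def by blast+
      have "(V, W) \<in> \<B> \<times> \<B>" using V W by simp
      then have "f V W \<in> S" unfolding S_def by (intro insertI2 image_eqI[of _ _ "(V, W)"]) simp
      then obtain j where j: "from_nat_into S j = f V W" using from_nat_into_surj[OF S(1)] by blast
      show ?thesis by (rule exI[of _ j]) (simp only: j 1, use 1 in auto)
    qed
  qed
qed

context haar_subgroupoid
begin

lemma positive_definite_H:
  "positive_definite (subgroupoid G H) f \<longleftrightarrow> (\<forall>u\<in>units G.
    pd_kernel {y \<in> H. rng G y = u} (\<lambda>s t. f (ldiv s t)))"
  unfolding positive_definite_def H_arrows by (simp only: subgroupoid_simps)

lemma supported_H: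
  "supported {y \<in> H. rng G y = u} c \<Longrightarrow> supported (fib u) c"
  using H_closure by (auto simp: supported_def fib_iff)

lemma H_kform_diag:
  "y \<in> H \<Longrightarrow> kform (\<lambda>s t. f (ldiv s t)) [(1, y)] [(1, y)] = f (src G y)"
  using H_closure by (simp add: comp_inv_left)

text \<open>For \<open>z\<close> in the fibre of \<open>G\<close>, \<open>kcomb \<dots> c z\<close> is an integral over the fibre of \<open>H\<close>, whose integrand
  contains the inner product of \<open>c\<close> with the point \<open>y\<close> for the kernel of \<open>r\<close>. The Cauchy-Schwarz
  inequality bounds it by the norm of \<open>c\<close> for that kernel.\<close>
lemma kform_autocor_conv_le:
  assumes k: "contG k" and r: "contH r"
    and pd: "positive_definite (subgroupoid G H) r"
    and M: "\<And>u. u \<in> units G \<Longrightarrow> Re (r u) \<le> M"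
    and \<kappa>: "0 \<le> \<kappa>" "\<And>w. w \<in> arrows G \<Longrightarrow> cmod (k w) \<le> \<kappa>"
    and mass: "\<And>u. u \<in> units G \<Longrightarrow> mass u \<le> \<Lambda>" "\<And>u. u \<in> units G \<Longrightarrow> H.mass u \<le> \<Lambda>'"
    and const: "(\<kappa> * \<Lambda>')\<^sup>2 * M * \<Lambda> \<le> 1"
    and u: "u \<in> units G" and c: "supported {y \<in> H. rng G y = u} c"
  shows "Re (kform (\<lambda>s t. autocor (conv k r) (ldiv s t)) c c)
    \<le> Re (kform (\<lambda>s t. r (ldiv s t)) c c)"
proof -
  let ?K = "\<lambda>s t. r (ldiv s t)"
  let ?A = "\<lambda>z x. conv k r (ldiv z x)"
  let ?D = "{y \<in> H. rng G y = u}"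
  define n where "n = Re (kform ?K c c)"
  have pdK: "pd_kernel ?D ?K" using pd u unfolding positive_definite_H by blast
  have n: "n \<ge> 0" unfolding n_def by (rule pd_kernelD(2)[OF pdK c])
  have "0 \<le> Re (r u)"
    using H.positive_definite_unit(2)[OF pd, of u] u unfolding H_arrows by blast
  then have M0: "0 \<le> M" using M[OF u] by linarith
  have u': "u \<in> topspace (unit_space G)" "u \<in> topspace (unit_space (subgroupoid G H))"
    unfolding H_unit_space topspace_unit_space using u by auto
  have \<Lambda>': "0 \<le> \<Lambda>'" using H.mass_nonneg[OF u'(2)] mass(2)[OF u] by linarith
  have bound: "cmod (kcomb ?A c z) \<le> \<kappa> * sqrt (n * M) * \<Lambda>'" if z: "z \<in> fib u" for z
  proof -
    have z: "z \<in> arrows G" "rng G z = u" using z by (auto simp: fib_iff)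
    define w where "w = arr_inv G z"
    have w: "w \<in> arrows G" "src G w = u" using z by (auto simp: w_def inv_closed src_inv)
    have uH: "u \<in> H" "rng G u = src G w" using H_closure(2) u w by (auto simp: rng_unit)
    have ck: "H.cont_on_fib u (\<lambda>y. k (arr_comp G w y))"
      using continuous_conv_integrand(1)[OF k r w(1) uH] w by simp
    have cr: "H.cont_on_fib u (\<lambda>y. r (ldiv h y))" if "h \<in> ?D" for h
      using continuous_conv_integrand(2)[OF k r w(1), of h] w that by simp
    have cev: "supported ?D d \<Longrightarrow> H.cont_on_fib u (\<lambda>y. ev d (\<lambda>h. r (ldiv h y)))" for d
    proof (induction d)
      case (Cons p d)
      obtain a h where p: "p = (a, h)" by (cases p)
      show ?case using Cons unfolding p ev_simps
        by (intro continuous_map_add continuous_map_cmult continuous_map_canonical_const cr) auto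
    qed simp
    have "kcomb ?A c z = H.I u (\<lambda>y. k (arr_comp G w y) * cnj (ev c (\<lambda>h. r (ldiv h y))))"
      using c
    proof (induction c)
      case (Cons p c)
      obtain a h where p: "p = (a, h)" by (cases p)
      have h: "h \<in> ?D" and c: "supported ?D c" using Cons.prems p by auto
      let ?e = "\<lambda>y. ev c (\<lambda>h. r (ldiv h y))"
      have "H.I u (\<lambda>y. k (arr_comp G w y) * cnj (ev (p # c) (\<lambda>h. r (ldiv h y))))
        = H.I u (\<lambda>y. a * (k (arr_comp G w y) * cnj (r (ldiv h y))) + k (arr_comp G w y) * cnj (?e y))"
        by (simp add: p algebra_simps)
      also have "\<dots> = H.I u (\<lambda>y. a * (k (arr_comp G w y) * cnj (r (ldiv h y))))
          + H.I u (\<lambda>y. k (arr_comp G w y) * cnj (?e y))"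
        by (rule H.I_add[OF u'(2)]) (intro continuous_map_cmult continuous_map_cnj continuous_map_canonical_const
          ck cr[OF h] cev[OF c])+
      also have "H.I u (\<lambda>y. a * (k (arr_comp G w y) * cnj (r (ldiv h y)))) = a * ?A z h"
        using conv_translate[OF k r w(1), of h] h w by (simp add: w_def)
      finally show ?case using Cons.IH[OF c] by (simp add: p)
    qed simp
    also have "cmod \<dots> \<le> \<kappa> * sqrt (n * M) * H.mass u"
    proof (rule H.I_bound[OF u'(2)])
      show "H.cont_on_fib u (\<lambda>y. k (arr_comp G w y) * cnj (ev c (\<lambda>h. r (ldiv h y))))"
        by (intro continuous_map_cmult continuous_map_cnj ck cev c)
      fix y assume "y \<in> H.fib u"
      then have y: "y \<in> ?D" by (simp add: H_fib_iff)
      then have y': "y \<in> arrows G" using H_closure by auto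
      have "kcomb ?K [(1, y)] = (\<lambda>h. r (ldiv h y))" by (simp add: fun_eq_iff)
      then have "kform ?K c [(1, y)] = ev c (\<lambda>h. r (ldiv h y))"
        by (simp add: kform_def)
      then have "(cmod (ev c (\<lambda>h. r (ldiv h y))))\<^sup>2 \<le> n * Re (r (src G y))"
        using pd_kernel_Cauchy_Schwarz[OF pdK c, of "[(1, y)]"] y H_kform_diag[of y r] by (simp add: n_def)
      also have "\<dots> \<le> n * M" using M[OF src_closed[OF y']] n by (intro mult_left_mono)
      finally have "cmod (ev c (\<lambda>h. r (ldiv h y))) \<le> sqrt (n * M)"
        by (rule real_le_rsqrt)
      moreover have "arr_comp G w y \<in> arrows G" using w y y' by (intro comp) auto
      ultimately show "cmod (k (arr_comp G w y) * cnj (ev c (\<lambda>h. r (ldiv h y)))) \<le> \<kappa> * sqrt (n * M)"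
        unfolding norm_mult using \<kappa> n M0 by (intro mult_mono) auto
    qed
    also have "\<dots> \<le> \<kappa> * sqrt (n * M) * \<Lambda>'"
      using mass(2)[OF u] \<kappa> n M0 by (intro mult_left_mono) auto
    finally show ?thesis .
  qed
  have "Re (kform (\<lambda>s t. autocor (conv k r) (ldiv s t)) c c) = I u (\<lambda>z. (cmod (kcomb ?A c z))\<^sup>2)"
    using kform_autocor_self[OF continuous_conv[OF k r] u supported_H[OF c]] by simp
  also have "\<dots> \<le> I u (\<lambda>z. (\<kappa> * sqrt (n * M) * \<Lambda>')\<^sup>2)"
  proof (rule I_mono[OF u'(1)])
    show "cont_on_fib u (\<lambda>z. (cmod (kcomb ?A c z))\<^sup>2)"
      by (intro continuous_map_real_pow continuous_map_cmod
          continuous_kcomb_translate[OF continuous_conv[OF k r] u supported_H[OF c]])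
    show "(cmod (kcomb ?A c z))\<^sup>2 \<le> (\<kappa> * sqrt (n * M) * \<Lambda>')\<^sup>2" if "z \<in> fib u" for z
      by (intro power_mono bound that) simp
  qed simp
  also have "\<dots> = (\<kappa> * sqrt (n * M) * \<Lambda>')\<^sup>2 * mass u" by (rule I_const[OF u'(1)])
  also have "(\<kappa> * sqrt (n * M) * \<Lambda>')\<^sup>2 = (\<kappa> * \<Lambda>')\<^sup>2 * M * n"
    using n M0 by (simp add: power_mult_distrib)
  also have "(\<kappa> * \<Lambda>')\<^sup>2 * M * n * mass u \<le> (\<kappa> * \<Lambda>')\<^sup>2 * M * n * \<Lambda>"
    using n M0 mass(1)[OF u] by (intro mult_left_mono) auto
  also have "\<dots> = ((\<kappa> * \<Lambda>')\<^sup>2 * M * \<Lambda>) * n" by simp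
  also have "\<dots> \<le> 1 * n" using const n by (intro mult_right_mono)
  finally show ?thesis by (simp add: n_def)
qed

text \<open>Equicontinuity at the units of the functions \<open>f\<close> below \<open>g\<close>: the bound is the Cauchy-Schwarz
  inequality for the kernel of \<open>f\<close>, applied to the unit and to the difference of \<open>y\<close> and the unit, and its
  last factor, which tends to zero as \<open>y\<close> approaches the unit, comes from \<open>g\<close> alone.\<close>
lemma positive_definite_H_diff_unit:
  assumes f: "positive_definite (subgroupoid G H) f" and y: "y \<in> H"
    and le: "\<And>c. supported {x \<in> H. rng G x = rng G y} c \<Longrightarrow>
      Re (kform (\<lambda>s t. f (ldiv s t)) c c) \<le> Re (kform (\<lambda>s t. g (ldiv s t)) c c)"
    and g: "positive_definite (subgroupoid G H) g"
  shows "(cmod (f y - f (rng G y)))\<^sup>2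
    \<le> Re (f (rng G y)) * (Re (g (src G y)) + Re (g (rng G y)) - 2 * Re (g y))"
proof -
  let ?u = "rng G y" and ?K = "\<lambda>f s t. f (ldiv s t)"
  let ?c = "[(1, y), (- 1, ?u)]"
  have y': "y \<in> arrows G" using H_closure y by blast
  have u: "?u \<in> units G" by (rule rng_closed[OF y'])
  have s: "supported {x \<in> H. rng G x = ?u} ?c" "supported {x \<in> H. rng G x = ?u} [(1, ?u)]"
    using y u H_closure(2) rng_unit by auto
  have pd: "pd_kernel {x \<in> H. rng G x = ?u} (?K f)" using f u unfolding positive_definite_H by blast
  have inv: "g (arr_inv G y) = cnj (g y)"
    using H.positive_definite_inv[OF g, of y] y unfolding H_arrows by (simp add: subgroupoid_simps)
  have [simp]: "ldiv y y = src G y" "ldiv y ?u = arr_inv G y"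
    "ldiv ?u y = y" "ldiv ?u ?u = ?u"
    using y' u comp_src[OF inv_closed[OF y']]
    by (simp_all add: comp_inv_left inv_unit comp_rng src_inv unit_comp unit_arrow rng_unit src_unit)
  have "kform (?K f) [(1, ?u)] ?c = f y - f ?u" by (simp add: kform_def)
  then have "(cmod (f y - f ?u))\<^sup>2 \<le> Re (f ?u) * Re (kform (?K f) ?c ?c)"
    using pd_kernel_Cauchy_Schwarz[OF pd s(2,1)] by (simp add: kform_def)
  also have "\<dots> \<le> Re (f ?u) * Re (kform (?K g) ?c ?c)"
    using H.positive_definite_unit(2)[OF f, of ?u] u unfolding H_arrows
    by (intro mult_left_mono le s(1)) blast
  also have "Re (kform (?K g) ?c ?c) = Re (g (src G y)) + Re (g ?u) - 2 * Re (g y)"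
    by (simp add: kform_def inv)
  finally show ?thesis .
qed

end

text \<open>The hypothesis \<open>const\<close> is that of \<open>kform_autocor_conv_le\<close>, with \<open>\<kappa>\<close> a bound for the bumps and \<open>\<Lambda>\<close>, \<open>\<Lambda>'\<close>
  bounds for the masses of the fibres of \<open>G\<close> and \<open>H\<close>.\<close>
locale extension_sequence = haar_subgroupoid G lam H lamH
  for G :: "'g groupoid_struct" and lam and H :: "'g set" and lamH +
  fixes r\<^sub>0 :: "'g \<Rightarrow> complex" and b :: "nat \<Rightarrow> 'g \<Rightarrow> real" and M \<kappa> \<Lambda> \<Lambda>' :: real
  assumes continuous_r0: "contH r\<^sub>0"
    and pd_r0: "positive_definite (subgroupoid G H) r\<^sub>0"
    and M0: "\<And>u. u \<in> units G \<Longrightarrow> Re (r\<^sub>0 u) \<le> M" "0 < M"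
    and continuous_b: "\<And>j. continuous_map (arr_top G) euclideanreal (b j)"
    and b_nonneg: "\<And>j x. x \<in> arrows G \<Longrightarrow> 0 \<le> b j x"
    and b_le: "\<And>j x. x \<in> arrows G \<Longrightarrow> b j x \<le> \<kappa>"
    and b_bump: "\<And>x N. openin (arr_top G) N \<Longrightarrow> x \<in> N \<Longrightarrow> \<exists>j. b j x > 0 \<and> (\<forall>y\<in>arrows G - N. b j y = 0)"
    and \<kappa>: "0 \<le> \<kappa>"
    and masses: "\<And>u. u \<in> units G \<Longrightarrow> mass u \<le> \<Lambda>" "\<And>u. u \<in> units G \<Longrightarrow> H.mass u \<le> \<Lambda>'"
    and const: "(\<kappa> * \<Lambda>')\<^sup>2 * M * \<Lambda> \<le> 1"
begin

text \<open>As \<open>prod_decode\<close> is a bijection onto the pairs, every bump is used infinitely often.\<close>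
definition k :: "nat \<Rightarrow> 'g \<Rightarrow> complex"
  where "k n w = of_real (b (fst (prod_decode n)) w)"

primrec r :: "nat \<Rightarrow> 'g \<Rightarrow> complex"
  where "r 0 = r\<^sub>0" | "r (Suc n) = (\<lambda>x. r n x - autocor (conv (k n) (r n)) x)"

definition P :: "nat \<Rightarrow> 'g \<Rightarrow> complex"
  where "P n = autocor (conv (k n) (r n))"

lemma r_Suc: "r (Suc n) x = r n x - P n x"
  by (simp add: P_def)

abbreviation K :: "('g \<Rightarrow> complex) \<Rightarrow> 'g \<Rightarrow> 'g \<Rightarrow> complex"
  where "K f \<equiv> \<lambda>s t. f (ldiv s t)"

lemma continuous_k: "contG (k n)"
  unfolding k_def by (rule continuous_map_of_real[OF continuous_b])

lemma k_le: "w \<in> arrows G \<Longrightarrow> cmod (k n w) \<le> \<kappa>"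
  using b_nonneg b_le by (simp add: k_def)

lemma unit_H: "u \<in> units G \<Longrightarrow> u \<in> units (subgroupoid G H)"
  by (simp add: H_arrows)

lemma kform_K_Suc: "kform (K (r (Suc n))) c c = kform (K (r n)) c c - kform (K (P n)) c c"
  unfolding r_Suc by (rule kform_diff)

lemma pd_H_of_G:
  assumes "positive_definite G f" shows "positive_definite (subgroupoid G H) f"
  unfolding positive_definite_H pd_kernel_def
proof (intro ballI allI impI)
  fix u c assume u: "u \<in> units G" and c: "supported {y \<in> H. rng G y = u} c"
  have "supported {y \<in> arrows G. rng G y = u} c" using supported_H[OF c] by (simp add: fib_def)
  then show "Im (kform (K f) c c) = 0 \<and> 0 \<le> Re (kform (K f) c c)"
    using positive_definiteD[OF assms u] unfolding pd_kernel_def by blast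
qed

lemma continuous_H_of_G:
  "contG f \<Longrightarrow> contH f"
  by (rule continuous_map_after[OF H_incl])

text \<open>Continuity, positivity and the bound \<open>M\<close> are proved together: each is needed for \<open>r n\<close> in order that
  the next autocorrelation be below \<open>r n\<close>.\<close>
lemma r_all_properties:
  "contH (r n) \<and>
   positive_definite (subgroupoid G H) (r n) \<and> (\<forall>u\<in>units G. Re (r n u) \<le> M)"
proof (induction n)
  case 0
  show ?case using continuous_r0 pd_r0 M0 by simp
next
  case (Suc n)
  then have IH: "contH (r n)"
    "positive_definite (subgroupoid G H) (r n)" "\<And>u. u \<in> units G \<Longrightarrow> Re (r n u) \<le> M" by blast+
  note c = continuous_conv[OF continuous_k[of n] IH(1)]
  have P: "positive_definite G (P n)" unfolding P_def by (rule positive_definite_autocor[OF c])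
  have "contH (r (Suc n))"
    unfolding r_Suc[abs_def] P_def
    by (rule continuous_map_diff[OF IH(1) continuous_H_of_G[OF continuous_autocor[OF c]]])
  moreover have "positive_definite (subgroupoid G H) (r (Suc n))"
    unfolding positive_definite_H pd_kernel_def
  proof (intro ballI allI impI)
    fix u d assume u: "u \<in> units G" and d: "supported {y \<in> H. rng G y = u} d"
    have "Im (kform (K (r n)) d d) = 0" "Im (kform (K (P n)) d d) = 0"
      using IH(2) pd_H_of_G[OF P] u d unfolding positive_definite_H pd_kernel_def by blast+
    moreover have "Re (kform (K (P n)) d d) \<le> Re (kform (K (r n)) d d)"
      unfolding P_def
      by (rule kform_autocor_conv_le[OF continuous_k IH(1,2) IH(3) \<kappa> k_le masses const u d])
    ultimately show "Im (kform (K (r (Suc n))) d d) = 0 \<and> 0 \<le> Re (kform (K (r (Suc n))) d d)"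
      unfolding kform_K_Suc by simp
  qed
  moreover have "Re (r (Suc n) u) \<le> M" if u: "u \<in> units G" for u
    using IH(3)[OF u] positive_definite_unit(2)[OF P u] by (simp add: r_Suc del: r.simps)
  ultimately show ?case by blast
qed

lemma r_properties:
  shows "contH (r n)"
    and "positive_definite (subgroupoid G H) (r n)"
    and "u \<in> units G \<Longrightarrow> Re (r n u) \<le> M"
  using r_all_properties by blast+

lemma continuous_P: "contG (P n)"
  and pd_P: "positive_definite G (P n)"
  unfolding P_def
  by (intro continuous_autocor positive_definite_autocor continuous_conv continuous_k r_properties(1))+

lemma r_unit:
  assumes "u \<in> units G" shows "Im (r n u) = 0" "0 \<le> Re (r n u)" "Re (r (Suc n) u) \<le> Re (r n u)"
  using H.positive_definite_unit[OF r_properties(2) unit_H[OF assms]] positive_definite_unit(2)[OF pd_P assms]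
  by (simp_all add: r_Suc del: r.simps)

lemma kform_r_le:
  assumes u: "u \<in> units G" and c: "supported {y \<in> H. rng G y = u} c"
  shows "Re (kform (K (r n)) c c) \<le> Re (kform (K r\<^sub>0) c c)"
proof (induction n)
  case (Suc n)
  have "0 \<le> Re (kform (K (P n)) c c)"
    using pd_H_of_G[OF pd_P] u c unfolding positive_definite_H pd_kernel_def by blast
  then show ?case using Suc unfolding kform_K_Suc by simp
qed simp

lemma r_cmod_le:
  assumes "y \<in> H"
  shows "(cmod (r n y))\<^sup>2 \<le> Re (r n (rng G y)) * Re (r n (src G y))"
  using H.positive_definite_cmod_le[OF r_properties(2), of y n] assms unfolding H_arrows
  by (simp only: subgroupoid_simps)

lemma r_cmod_le_M:
  assumes y: "y \<in> H" shows "cmod (r n y) \<le> M"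
proof -
  have u: "rng G y \<in> units G" "src G y \<in> units G" using H_closure(1)[OF y] rng_closed src_closed by auto
  have "(cmod (r n y))\<^sup>2 \<le> M * M"
    using r_cmod_le[OF y, of n] mult_mono[OF r_properties(3)[OF u(1)] r_properties(3)[OF u(2)], of n n]
      r_unit(2)[OF u(2), of n] M0(2) by linarith
  then show ?thesis using M0(2) by (simp add: power2_eq_square[symmetric] power_mono_iff)
qed

text \<open>If \<open>Re (r n u)\<close> stays above \<open>c\<close>, then by equicontinuity \<open>Re (r n)\<close> is at least \<open>c / 2\<close> on a
  neighbourhood of \<open>u\<close> that does not depend on \<open>n\<close>. A bump \<open>b j\<close> supported there keeps
  \<open>conv (k n) (r n)\<close> away from zero near \<open>u\<close>, and then \<open>P n u\<close> away from zero, for all \<open>n\<close> with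
  \<open>fst (prod_decode n) = j\<close>. But \<open>P n u = r n u - r (Suc n) u\<close> tends to zero.\<close>
lemma r_unit_tendsto:
  assumes u: "u \<in> units G"
  shows "(\<lambda>n. Re (r n u)) \<longlonglongrightarrow> 0"
proof -
  have dec: "decseq (\<lambda>n. Re (r n u))" using r_unit(3)[OF u] by (intro decseq_SucI)
  have "\<forall>n. 0 \<le> Re (r n u)" using r_unit(2)[OF u] by blast
  then obtain c where c: "(\<lambda>n. Re (r n u)) \<longlonglongrightarrow> c" "\<forall>n. c \<le> Re (r n u)"
    by (rule decseq_convergent[OF dec])
  have "c = 0"
  proof (rule ccontr)
    assume "c \<noteq> 0"
    moreover have "0 \<le> c" using LIMSEQ_le_const[OF c(1)] r_unit(2)[OF u] by blast
    ultimately have c0: "c > 0" by simp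
    have uT: "u \<in> topspace (unit_space G)" "u \<in> topspace (unit_space (subgroupoid G H))"
      unfolding H_unit_space topspace_unit_space using u by auto
    have uH: "u \<in> H" "rng G u = u" "src G u = u" using u H_closure(2) rng_unit src_unit by auto
    have uf: "u \<in> fib u" "u \<in> H.fib u" using u uH by (auto simp: fib_iff H_fib_iff unit_arrow)

    \<comment> \<open>\<open>q\<close> is the last factor in \<open>positive_definite_H_diff_unit\<close>; it vanishes at \<open>u\<close>, and \<open>N\<close> is where it is small.\<close>
    define q where "q y = Re (r\<^sub>0 (src G y)) + Re (r\<^sub>0 (rng G y)) - 2 * Re (r\<^sub>0 y)" for y
    have "contH q"
    proof -
      have "continuous_map (arr_top (subgroupoid G H)) (arr_top (subgroupoid G H)) (src G)"
        "continuous_map (arr_top (subgroupoid G H)) (arr_top (subgroupoid G H)) (rng G)"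
        using H.continuous_src H.continuous_rng by (simp_all only: subgroupoid_simps)
      note * = this[THEN continuous_map_after[OF _ continuous_r0], THEN continuous_map_Re]
      have "continuous_map (arr_top (subgroupoid G H)) euclideanreal (\<lambda>y. 2 * Re (r\<^sub>0 y))"
        by (rule continuous_map_real_mult_left[OF continuous_map_Re[OF continuous_r0]])
      then show ?thesis unfolding q_def by (intro continuous_map_diff continuous_map_add *)
    qed
    then have "openin (arr_top (subgroupoid G H)) {y \<in> topspace (arr_top (subgroupoid G H)). q y \<in> {..<c\<^sup>2 / (4 * M)}}"
      by (rule openin_continuous_map_preimage) simp
    then have "openin (subtopology (arr_top G) H) {y \<in> H. q y < c\<^sup>2 / (4 * M)}"
      unfolding H_arrows by (simp add: subgroupoid_simps)
    then obtain N where N: "openin (arr_top G) N" "{y \<in> H. q y < c\<^sup>2 / (4 * M)} = N \<inter> H"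
      unfolding openin_subtopology by blast
    have "q u = 0" using uH by (simp add: q_def)
    moreover have "0 < c\<^sup>2 / (4 * M)" using c0 M0(2) by simp
    ultimately have "u \<in> {y \<in> H. q y < c\<^sup>2 / (4 * M)}" using uH(1) by simp
    then have "u \<in> N" unfolding N(2) by simp
    then obtain j where j: "b j u > 0" "\<forall>y\<in>arrows G - N. b j y = 0" using b_bump[OF N(1)] by blast
    have near: "cmod (r n y - r n u) \<le> c / 2" if y: "y \<in> H" "rng G y = u" "y \<in> N" for n y
    proof -
      have "(cmod (r n y - r n (rng G y)))\<^sup>2 \<le> Re (r n (rng G y)) * q y"
        unfolding q_def
        by (rule positive_definite_H_diff_unit[OF r_properties(2) y(1) _ pd_r0])
          (rule kform_r_le, use y(2) u in simp_all)
      also have "\<dots> \<le> M * (c\<^sup>2 / (4 * M))"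
      proof (rule order_trans[OF mult_left_mono mult_right_mono])
        have "y \<in> {y \<in> H. q y < c\<^sup>2 / (4 * M)}" unfolding N(2) using y by simp
        then show "q y \<le> c\<^sup>2 / (4 * M)" by simp
        show "0 \<le> Re (r n (rng G y))" "Re (r n (rng G y)) \<le> M"
          using r_unit(2)[OF u] r_properties(3)[OF u] y by auto
        show "0 \<le> c\<^sup>2 / (4 * M)" using M0(2) by simp
      qed
      also have "\<dots> = (c / 2)\<^sup>2" using M0(2) by (simp add: power2_eq_square)
      finally show ?thesis using c0 y(2) by (simp add: power_mono_iff)
    qed

    \<comment> \<open>A lower bound for the convolution at \<open>u\<close>; it decreases by at most \<open>M * d z\<close> as \<open>u\<close> moves to \<open>z\<close>.\<close>
    define \<delta> where "\<delta> = c / 2 * H.I u (b j)"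
    have bcont: "H.cont_on_fib u (b j)"
      by (intro H.cont_on_fib continuous_map_after[OF H_incl continuous_b])
    have "0 < H.I u (b j)"
      by (rule H.I_pos[OF uT(2) bcont _ uf(2) j(1)]) (use b_nonneg H_closure(1) in \<open>auto simp: H_fib_iff\<close>)
    then have \<delta>: "\<delta> > 0" using c0 by (simp add: \<delta>_def)

    define d where "d z = H.I u (\<lambda>y. \<bar>b j (ldiv z y) - b j y\<bar>)" for z
    have zcont: "continuous_map (subtopology (arr_top G) (fib u)) euclidean d"
    proof -
      let ?Z = "subtopology (arr_top G) (fib u)"
      let ?Q = "subtopology (prod_topology ?Z (arr_top (subgroupoid G H))) {(z, y). rng (subgroupoid G H) y = u}"
      have 1: "continuous_map ?Q (arr_top G) fst"
        by (rule continuous_map_after[OF continuous_map_sub_prod(1) continuous_map_from_subtopology]) simp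
      have 2: "continuous_map ?Q (arr_top G) snd"
        by (rule continuous_map_after[OF continuous_map_sub_prod(2) H_incl])
      have 3: "continuous_map ?Q (arr_top G) (\<lambda>q. ldiv (fst q) (snd q))"
        by (rule continuous_comp[OF continuous_inv[OF 1] 2]) (auto simp: fib_iff src_inv subgroupoid_simps)
      have "continuous_map ?Q euclidean
          (\<lambda>q. complex_of_real \<bar>b j (ldiv (fst q) (snd q)) - b j (snd q)\<bar>)"
        by (intro continuous_map_of_real continuous_map_real_abs continuous_map_diff
          continuous_map_after[OF 3 continuous_b] continuous_map_after[OF 2 continuous_b])
      then have "continuous_map ?Z euclidean
          (\<lambda>z. H.I u (\<lambda>y. complex_of_real \<bar>b j (ldiv z y) - b j y\<bar>))"
        by (intro H.continuous_parametric_I'[of ?Z "\<lambda>_. u"]) (use uT in auto)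
      from continuous_map_Re[OF this] show ?thesis
        unfolding d_def set_integral_complex_of_real by simp
    qed
    have du: "d u = 0"
    proof -
      have "d u = H.I u (\<lambda>_. 0)" unfolding d_def
        by (rule H.I_cong[OF uT(2)]) (use u H_closure(1) in \<open>simp add: H_fib_iff inv_unit unit_comp\<close>)
      then show ?thesis by simp
    qed
    define g where "g z = max 0 (\<delta> - M * d z)" for z
    have gcont: "cont_on_fib u g" unfolding g_def
      by (intro continuous_map_real_max continuous_map_canonical_const continuous_map_diff
        continuous_map_real_mult zcont)
    have low: "g z \<le> cmod (conv (k n) (r n) (arr_inv G z))"
      if n: "fst (prod_decode n) = j" and z: "z \<in> fib u" for n z
    proof -
      have kn: "k n = (\<lambda>w. of_real (b j w))" using n by (simp add: k_def[abs_def])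
      have z': "z \<in> arrows G" "rng G z = u" using z by (auto simp: fib_iff)
      let ?w = "arr_inv G z"
      let ?f = "\<lambda>y. of_real (b j y) * cnj (r n y)" and ?f' = "\<lambda>y. of_real (b j y) * cnj (r n u)"
        and ?g = "\<lambda>y. of_real (b j (arr_comp G ?w y)) * cnj (r n y)"
      let ?J = "H.I u (b j)"
      have w: "?w \<in> arrows G" "src G ?w = u" using z' by (auto simp: inv_closed src_inv)
      have rc: "H.cont_on_fib u (r n)" by (rule H.cont_on_fib[OF r_properties(1)])
      have wc: "H.cont_on_fib u (\<lambda>y. b j (arr_comp G ?w y))"
      proof -
        have "H.cont_on_fib u (\<lambda>y. k n (arr_comp G ?w y))"
          using continuous_conv_integrand(1)[OF continuous_k r_properties(1) w(1) uH(1)] w uH by simp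
        from continuous_map_Re[OF this] show ?thesis by (simp add: kn)
      qed
      have eq: "conv (k n) (r n) ?w = H.I u ?g"
        unfolding conv_def w(2) kn ..
      have rnu: "cnj (r n u) = of_real (Re (r n u))" using r_unit(1)[OF u] by (simp add: complex_eq_iff)
      have c1: "H.cont_on_fib u ?f"
        by (rule continuous_map_cmult[OF continuous_map_of_real[OF bcont] continuous_map_cnj[OF rc]])
      have c3: "H.cont_on_fib u ?g"
        by (rule continuous_map_cmult[OF continuous_map_of_real[OF wc] continuous_map_cnj[OF rc]])
      have 1: "cmod (H.I u ?f - of_real (?J) * cnj (r n u)) \<le> c / 2 * ?J"
      proof -
        have c2: "H.cont_on_fib u ?f'"
          by (rule continuous_map_cmult[OF continuous_map_of_real[OF bcont] continuous_map_canonical_const])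
        have "H.I u ?f - of_real (?J) * cnj (r n u)
            = H.I u ?f - H.I u ?f'"
          unfolding set_integral_mult_left set_integral_complex_of_real ..
        also have "\<dots> = H.I u (\<lambda>y. ?f y - ?f' y)"
          by (rule H.I_diff[OF uT(2) c1 c2, symmetric])
        finally have "cmod (H.I u ?f - of_real (?J) * cnj (r n u))
            \<le> H.I u (\<lambda>y. cmod (?f y - ?f' y))"
          using H.I_norm[OF uT(2) continuous_map_diff[OF c1 c2]] by (simp only:)
        also have "\<dots> \<le> H.I u (\<lambda>y. c / 2 * b j y)"
        proof (rule H.I_mono[OF uT(2)])
          show "H.cont_on_fib u (\<lambda>y. cmod (?f y - ?f' y))"
            by (rule continuous_map_cmod[OF continuous_map_diff[OF c1 c2]])
          show "H.cont_on_fib u (\<lambda>y. c / 2 * b j y)"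
            by (rule continuous_map_real_mult_left[OF bcont])
          fix y assume "y \<in> H.fib u"
          then have y: "y \<in> H" "rng G y = u" by (auto simp: H_fib_iff)
          then have y': "y \<in> arrows G" using H_closure by blast
          have "?f y - ?f' y = of_real (b j y) * cnj (r n y - r n u)"
            by (simp add: right_diff_distrib)
          then have "cmod (?f y - ?f' y) = b j y * cmod (r n y - r n u)"
            using b_nonneg[OF y'] by (simp only: norm_mult complex_mod_cnj norm_of_real abs_of_nonneg)
          also have "\<dots> \<le> c / 2 * b j y"
          proof (cases "y \<in> N")
            case True
            then show ?thesis using mult_left_mono[OF near[OF y True] b_nonneg[OF y']] by (simp add: mult.commute)
          next
            case False
            then show ?thesis using j(2) y' by simp
          qed
          finally show "cmod (?f y - ?f' y) \<le> c / 2 * b j y" .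
        qed
        also have "\<dots> = c / 2 * ?J" by (rule set_integral_mult_right)
        finally show ?thesis .
      qed
      have 2: "cmod (H.I u ?g - H.I u ?f) \<le> M * d z"
      proof -
        have "cmod (H.I u ?g - H.I u ?f)
            \<le> H.I u (\<lambda>y. cmod (?g y - ?f y))"
          unfolding H.I_diff[OF uT(2) c3 c1, symmetric]
          by (rule H.I_norm[OF uT(2) continuous_map_diff[OF c3 c1]])
        also have "\<dots> \<le> H.I u (\<lambda>y. M * \<bar>b j (arr_comp G ?w y) - b j y\<bar>)"
        proof (rule H.I_mono[OF uT(2)])
          show "H.cont_on_fib u (\<lambda>y. cmod (?g y - ?f y))"
            by (rule continuous_map_cmod[OF continuous_map_diff[OF c3 c1]])
          show "H.cont_on_fib u (\<lambda>y. M * \<bar>b j (arr_comp G ?w y) - b j y\<bar>)"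
            by (rule continuous_map_real_mult_left[OF continuous_map_real_abs[OF continuous_map_diff[OF wc bcont]]])
          fix y assume "y \<in> H.fib u"
          then have y: "y \<in> H" by (auto simp: H_fib_iff)
          have "?g y - ?f y
              = of_real (b j (arr_comp G ?w y) - b j y) * cnj (r n y)"
            by (simp add: left_diff_distrib)
          then have "cmod (?g y - ?f y)
              = \<bar>b j (arr_comp G ?w y) - b j y\<bar> * cmod (r n y)"
            by (simp only: norm_mult complex_mod_cnj norm_of_real)
          also have "\<dots> \<le> M * \<bar>b j (arr_comp G ?w y) - b j y\<bar>"
            using mult_left_mono[OF r_cmod_le_M[OF y, of n], of "\<bar>b j (arr_comp G ?w y) - b j y\<bar>"] by (simp add: mult.commute)
          finally show "cmod (?g y - ?f y)
              \<le> M * \<bar>b j (arr_comp G ?w y) - b j y\<bar>" .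
        qed
        also have "\<dots> = M * d z" unfolding d_def by (rule set_integral_mult_right)
        finally show ?thesis .
      qed
      have 3: "c * ?J \<le> cmod (of_real (?J) * cnj (r n u))"
      proof -
        have "c * ?J \<le> Re (r n u) * ?J"
          using c(2) \<open>0 < ?J\<close> by (intro mult_right_mono) auto
        also have "\<dots> \<le> \<bar>?J * Re (r n u)\<bar>"
          unfolding mult.commute[of "Re (r n u)"] by (rule abs_ge_self)
        also have "\<dots> = cmod (of_real (?J) * cnj (r n u))"
          unfolding rnu of_real_mult[symmetric] norm_of_real ..
        finally show ?thesis .
      qed
      have "\<delta> - M * d z \<le> cmod (conv (k n) (r n) ?w)"
        unfolding eq \<delta>_def using 1 2 3
          norm_triangle_ineq3[of "H.I u ?f" "of_real (?J) * cnj (r n u)"]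
          norm_triangle_ineq3[of "H.I u ?g" "H.I u ?f"]
        by linarith
      then show ?thesis by (simp add: g_def)
    qed

    define \<eta> where "\<eta> = I u (\<lambda>z. (g z)\<^sup>2)"
    have g2: "cont_on_fib u (\<lambda>z. (g z)\<^sup>2)" by (intro continuous_map_real_pow gcont)
    have "g u > 0" using \<delta> du by (simp add: g_def)
    then have \<eta>: "\<eta> > 0" unfolding \<eta>_def by (intro I_pos[OF uT(1) g2 _ uf(1)]) auto
    have Pn: "\<eta> \<le> Re (P n u)" if n: "fst (prod_decode n) = j" for n
    proof -
      note cc = continuous_conv[OF continuous_k[of n] r_properties(1)[of n]]
      have "\<eta> \<le> I u (\<lambda>z. (cmod (conv (k n) (r n) (arr_inv G z)))\<^sup>2)"
        unfolding \<eta>_def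
      proof (rule I_mono[OF uT(1) g2])
        show "cont_on_fib u (\<lambda>z. (cmod (conv (k n) (r n) (arr_inv G z)))\<^sup>2)"
          by (intro continuous_map_real_pow continuous_map_cmod cont_on_fib continuous_map_after[OF inv_continuous cc])
        show "(g z)\<^sup>2 \<le> (cmod (conv (k n) (r n) (arr_inv G z)))\<^sup>2" if "z \<in> fib u" for z
          by (rule power_mono[OF low[OF n that]]) (simp add: g_def)
      qed
      then show ?thesis unfolding P_def autocor_unit[OF cc u] by simp
    qed
    have "(\<lambda>n. Re (r n u) - Re (r (Suc n) u)) \<longlonglongrightarrow> c - c"
      by (intro tendsto_diff c(1) LIMSEQ_Suc[OF c(1)])
    then have "(\<lambda>n. Re (P n u)) \<longlonglongrightarrow> 0" by (simp add: r_Suc del: r.simps)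
    then have "\<forall>\<^sub>F n in sequentially. Re (P n u) < \<eta>" using \<eta> by (rule order_tendstoD(2))
    then obtain m where m: "\<And>n. n \<ge> m \<Longrightarrow> Re (P n u) < \<eta>" by (auto simp: eventually_sequentially)
    have "m \<le> prod_encode (j, m)" by (rule le_prod_encode_2)
    then show False using m[of "prod_encode (j, m)"] Pn[of "prod_encode (j, m)"] by simp
  qed
  then show ?thesis using c(1) by simp
qed

text \<open>Dini's theorem: the functions \<open>r n\<close> decrease to zero on the compact unit space.\<close>
lemma r_unit_uniform:
  assumes "\<epsilon> > 0"
  shows "\<exists>m. \<forall>n\<ge>m. \<forall>u\<in>units G. Re (r n u) < \<epsilon>"
proof -
  let ?B = "unit_space (subgroupoid G H)"
  define U where "U n = {u \<in> topspace ?B. Re (r n u) \<in> {..<\<epsilon>}}" for n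
  have B: "topspace ?B = units G" unfolding H_unit_space by (rule topspace_unit_space)
  have "openin ?B (U n)" for n
    unfolding U_def
    by (rule openin_continuous_map_preimage[OF continuous_map_Re[OF continuous_map_from_subtopology[OF r_properties(1)]]])
      simp
  then have op: "\<And>V. V \<in> range U \<Longrightarrow> openin ?B V" by blast
  have cover: "topspace ?B \<subseteq> \<Union> (range U)"
  proof
    fix u assume u: "u \<in> topspace ?B"
    then have "\<forall>\<^sub>F n in sequentially. Re (r n u) < \<epsilon>"
      using r_unit_tendsto assms unfolding B by (intro order_tendstoD(2))
    then obtain n where "Re (r n u) < \<epsilon>" by (auto simp: eventually_sequentially)
    then show "u \<in> \<Union> (range U)" using u by (auto simp: U_def)
  qed
  have "compactin ?B (topspace ?B)" using H.compact_units by (simp only: compact_space_def)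
  from this[unfolded compactin_def, THEN conjunct2, rule_format, of "range U"] op cover
  obtain \<F> where \<F>: "finite \<F>" "\<F> \<subseteq> range U" "topspace ?B \<subseteq> \<Union> \<F>" by blast
  obtain J where J: "finite J" "\<F> = U ` J" using finite_subset_image[OF \<F>(1,2)] by blast
  have "Re (r n u) < \<epsilon>" if n: "Max (insert 0 J) \<le> n" and u: "u \<in> units G" for n u
  proof -
    obtain j where j: "j \<in> J" "u \<in> U j" using \<F>(3) u unfolding J(2) B by blast
    have "j \<le> Max (insert 0 J)" using J(1) j(1) by simp
    then have "j \<le> n" using n by linarith
    have "decseq (\<lambda>n. Re (r n u))" using r_unit(3)[OF u] by (intro decseq_SucI)
    from decseqD[OF this \<open>j \<le> n\<close>] show ?thesis using j(2) by (simp add: U_def)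
  qed
  then show ?thesis by blast
qed

definition partial :: "nat \<Rightarrow> 'g \<Rightarrow> complex"
  where "partial n x = (\<Sum>i<n. P i x)"

lemma partial_eq: "partial n x = r\<^sub>0 x - r n x"
  by (induction n) (simp_all add: partial_def r_Suc del: r.simps(2))

lemma pd_partial_diff:
  assumes "m \<le> n" shows "positive_definite G (\<lambda>x. partial n x - partial m x)"
  using assms
proof (induction n rule: dec_induct)
  case base
  have "kform (\<lambda>s t. 0) c c = 0" for c :: "(complex \<times> 'g) list"
    using kform_diff[of "\<lambda>s t. 0" "\<lambda>s t. 0" c c] by simp
  then show ?case by (simp add: positive_definite_def pd_kernel_def)
next
  case (step n)
  have eq: "(\<lambda>x. partial (Suc n) x - partial m x) = (\<lambda>x. (partial n x - partial m x) + P n x)"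
    by (simp add: partial_def fun_eq_iff)
  show ?case unfolding eq
    using step.IH pd_P[of n] unfolding positive_definite_def
    by (intro ballI pd_kernel_add) blast+
qed

lemma pd_partial: "positive_definite G (partial n)"
  using pd_partial_diff[of 0 n] by (simp add: partial_def[of 0])

lemma continuous_partial: "contG (partial n)"
  unfolding partial_def by (induction n) (auto intro!: continuous_map_add continuous_P)

text \<open>A positive definite function is controlled by its values on units, where the difference of
  partial sums telescopes to \<open>r m - r n\<close>.\<close>
lemma partial_Cauchy:
  assumes "\<epsilon> > 0"
  shows "\<exists>m. \<forall>n\<ge>m. \<forall>x\<in>arrows G. cmod (partial n x - partial m x) < \<epsilon>"
proof -
  obtain m where m: "\<And>n u. n \<ge> m \<Longrightarrow> u \<in> units G \<Longrightarrow> Re (r n u) < \<epsilon>"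
    using r_unit_uniform[OF assms] by blast
  have "cmod (partial n x - partial m x) < \<epsilon>" if n: "n \<ge> m" and x: "x \<in> arrows G" for n x
  proof -
    have "0 \<le> Re (partial n u - partial m u)" "Re (partial n u - partial m u) < \<epsilon>" if u: "u \<in> units G" for u
    proof -
      have eq: "partial n u - partial m u = r m u - r n u" by (simp add: partial_eq)
      show "0 \<le> Re (partial n u - partial m u)"
        by (rule positive_definite_unit(2)[OF pd_partial_diff[OF n] u])
      show "Re (partial n u - partial m u) < \<epsilon>"
        unfolding eq using m[OF order_refl u] r_unit(2)[OF u, of n] by simp
    qed
    note * = this[OF rng_closed[OF x]] this[OF src_closed[OF x]]
    have "(cmod (partial n x - partial m x))\<^sup>2
        \<le> Re (partial n (rng G x) - partial m (rng G x)) * Re (partial n (src G x) - partial m (src G x))"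
      by (rule positive_definite_cmod_le[OF pd_partial_diff[OF n] x])
    also have "\<dots> < \<epsilon> * \<epsilon>" by (rule mult_strict_mono') (use * in simp_all)
    finally have "(cmod (partial n x - partial m x))\<^sup>2 < \<epsilon>\<^sup>2" by (simp add: power2_eq_square)
    then show ?thesis using assms by (intro power_less_imp_less_base[of _ 2 \<epsilon>]) simp_all
  qed
  then show ?thesis by blast
qed

definition extension :: "'g \<Rightarrow> complex"
  where "extension x = lim (\<lambda>n. partial n x)"

lemma partial_tendsto:
  assumes x: "x \<in> arrows G" shows "(\<lambda>n. partial n x) \<longlonglongrightarrow> extension x"
proof -
  have "Cauchy (\<lambda>n. partial n x)"
  proof (rule metric_CauchyI)
    fix e :: real assume "e > 0"
    then obtain m where m: "\<And>n. n \<ge> m \<Longrightarrow> cmod (partial n x - partial m x) < e / 2"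
      using partial_Cauchy[of "e / 2"] x by auto
    have "dist (partial i x) (partial n x) < e" if "i \<ge> m" "n \<ge> m" for i n
      using m[OF that(1)] m[OF that(2)] dist_triangle_half_r[of "partial m x" "partial i x" e "partial n x"]
      by (simp add: dist_norm norm_minus_commute)
    then show "\<exists>M. \<forall>m\<ge>M. \<forall>n\<ge>M. dist (partial m x) (partial n x) < e" by blast
  qed
  then show ?thesis
    unfolding extension_def by (simp add: Cauchy_convergent_iff convergent_LIMSEQ_iff)
qed

lemma extension_close:
  assumes "\<epsilon> > 0"
  shows "\<exists>m. \<forall>x\<in>arrows G. cmod (extension x - partial m x) < \<epsilon>"
proof -
  have "\<epsilon> / 2 > 0" using assms by simp
  from partial_Cauchy[OF this] obtain m where
    m: "\<And>n x. n \<ge> m \<Longrightarrow> x \<in> arrows G \<Longrightarrow> cmod (partial n x - partial m x) < \<epsilon> / 2"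
    by blast
  have "cmod (extension x - partial m x) < \<epsilon>" if x: "x \<in> arrows G" for x
  proof -
    have "cmod (extension x - partial m x) \<le> \<epsilon> / 2"
    proof (rule LIMSEQ_le_const2)
      show "(\<lambda>n. cmod (partial n x - partial m x)) \<longlonglongrightarrow> cmod (extension x - partial m x)"
        by (intro tendsto_norm tendsto_diff tendsto_const partial_tendsto x)
      show "\<exists>k. \<forall>n\<ge>k. cmod (partial n x - partial m x) \<le> \<epsilon> / 2"
        using m x less_imp_le by blast
    qed
    then show ?thesis using assms by linarith
  qed
  then show ?thesis by blast
qed

lemma continuous_extension: "contG extension"
proof (rule continuous_map_locally_uniform_limit)
  fix z and \<epsilon> :: real assume "z \<in> arrows G" "\<epsilon> > 0"
  moreover obtain m where "\<forall>x\<in>arrows G. cmod (extension x - partial m x) < \<epsilon>"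
    using extension_close[OF \<open>\<epsilon> > 0\<close>] by blast
  ultimately show "\<exists>U h. openin (arr_top G) U \<and> z \<in> U \<and> contG h \<and>
      (\<forall>w\<in>U. dist (extension w) (h w) < \<epsilon>)"
    unfolding dist_norm using continuous_partial openin_topspace by blast
qed

lemma pd_extension: "positive_definite G extension"
  unfolding positive_definite_def pd_kernel_def
proof (intro ballI allI impI)
  fix u c assume u: "u \<in> units G" and c: "supported {y \<in> arrows G. rng G y = u} c"
  have lim: "(\<lambda>n. kform (K (partial n)) c c) \<longlonglongrightarrow> kform (K extension) c c"
    by (rule tendsto_kform[OF c c]) (auto intro!: partial_tendsto inv_comp_closed)
  have p: "Im (kform (K (partial n)) c c) = 0" "0 \<le> Re (kform (K (partial n)) c c)" for n
    using pd_partial[of n] u c unfolding positive_definite_def pd_kernel_def by blast+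
  have "Im (kform (K extension) c c) = 0"
    using tendsto_Im[OF lim] unfolding p(1) by (simp add: LIMSEQ_const_iff)
  moreover have "0 \<le> Re (kform (K extension) c c)"
    by (rule LIMSEQ_le_const[OF tendsto_Re[OF lim]]) (use p(2) in blast)
  ultimately show "Im (kform (K extension) c c) = 0 \<and> 0 \<le> Re (kform (K extension) c c)" by blast
qed

lemma extension_H:
  assumes x: "x \<in> H" shows "extension x = r\<^sub>0 x"
proof -
  have u: "rng G x \<in> units G" "src G x \<in> units G" using H_closure(1)[OF x] rng_closed src_closed by auto
  have "(\<lambda>n. sqrt (Re (r n (rng G x)) * Re (r n (src G x)))) \<longlonglongrightarrow> sqrt (0 * 0)"
    by (intro tendsto_real_sqrt tendsto_mult r_unit_tendsto u)
  then have "(\<lambda>n. r n x) \<longlonglongrightarrow> 0"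
    by (intro Lim_null_comparison[OF always_eventually[OF allI[OF real_le_rsqrt[OF r_cmod_le[OF x]]]]]) simp
  from tendsto_diff[OF tendsto_const this] have "(\<lambda>n. partial n x) \<longlonglongrightarrow> r\<^sub>0 x"
    unfolding partial_eq by simp
  then show ?thesis using partial_tendsto[OF H_closure(1)[OF x]] LIMSEQ_unique by blast
qed

end

text \<open>The bumps are scaled by \<open>\<kappa>\<close>, which is chosen to give equality in \<open>const\<close>.\<close>
theorem (in haar_subgroupoid) positive_definite_extension:
  assumes cont: "contH \<phi>"
    and pd: "positive_definite (subgroupoid G H) \<phi>"
  obtains \<Phi> where "contG \<Phi>" "positive_definite G \<Phi>"
    "\<And>x. x \<in> H \<Longrightarrow> \<Phi> x = \<phi> x"
proof -
  have uT: "topspace (unit_space G) = units G" "topspace (unit_space (subgroupoid G H)) = units G"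
    unfolding H_unit_space by (rule topspace_unit_space)+
  obtain \<Lambda> where \<Lambda>: "\<Lambda> > 0" "\<And>u. u \<in> units G \<Longrightarrow> mass u \<le> \<Lambda>" using mass_bounded unfolding uT by blast
  obtain \<Lambda>' where \<Lambda>': "\<Lambda>' > 0" "\<And>u. u \<in> units G \<Longrightarrow> H.mass u \<le> \<Lambda>'"
    using H.mass_bounded unfolding uT by blast
  have "compactin (arr_top (subgroupoid G H)) H"
    using H.compact_arrows unfolding compact_space_def H_arrows .
  from image_compactin[OF this cont] have "bounded (\<phi> ` H)"
    by (simp only: compactin_euclidean_iff compact_imp_bounded)
  then obtain C where C: "\<And>x. x \<in> H \<Longrightarrow> cmod (\<phi> x) \<le> C" by (auto simp: bounded_iff)
  define M where "M = max C 1"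
  have M: "M > 0" "\<And>u. u \<in> units G \<Longrightarrow> Re (\<phi> u) \<le> M"
    using C[OF H_closure(2)] complex_Re_le_cmod by (auto simp: M_def intro: order_trans max.coboundedI1)
  obtain b :: "nat \<Rightarrow> 'g \<Rightarrow> real" where b: "\<And>j. continuous_map (arr_top G) euclideanreal (b j)"
    "\<And>j x. x \<in> arrows G \<Longrightarrow> 0 \<le> b j x" "\<And>j x. x \<in> arrows G \<Longrightarrow> b j x \<le> 1"
    "\<And>x N. openin (arr_top G) N \<Longrightarrow> x \<in> N \<Longrightarrow> \<exists>j. b j x > 0 \<and> (\<forall>y\<in>arrows G - N. b j y = 0)"
    by (rule compact_second_countable_bumps[OF compact_arrows Hausdorff second_countable], rule that, assumption+)
  define \<kappa> where "\<kappa> = 1 / (\<Lambda>' * sqrt (M * \<Lambda>))"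
  have \<kappa>: "\<kappa> > 0" using \<Lambda> \<Lambda>' M by (simp add: \<kappa>_def)
  interpret E: extension_sequence G lam H lamH \<phi> "\<lambda>j x. \<kappa> * b j x" M \<kappa> \<Lambda> \<Lambda>'
  proof
    show "(\<kappa> * \<Lambda>')\<^sup>2 * M * \<Lambda> \<le> 1"
      using \<Lambda> \<Lambda>' M by (simp add: \<kappa>_def power_divide power_mult_distrib)
    show "continuous_map (arr_top G) euclideanreal (\<lambda>x. \<kappa> * b j x)" for j
      by (rule continuous_map_real_mult_left[OF b(1)])
    show "0 \<le> \<kappa> * b j x" "\<kappa> * b j x \<le> \<kappa>" if "x \<in> arrows G" for j x
      using b(2,3)[OF that] \<kappa> by (simp_all add: mult_left_le)
    show "\<exists>j. 0 < \<kappa> * b j x \<and> (\<forall>y\<in>arrows G - N. \<kappa> * b j y = 0)"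
      if N: "openin (arr_top G) N" "x \<in> N" for x N
    proof -
      obtain j where "0 < b j x" "\<forall>y\<in>arrows G - N. b j y = 0" using b(4)[OF N] by blast
      then show ?thesis using \<kappa> by (intro exI[of _ j]) simp
    qed
  qed (use cont pd M \<kappa> \<Lambda> \<Lambda>' in simp_all)
  show thesis
    by (rule that[OF E.continuous_extension E.pd_extension E.extension_H])
qed

section \<open>The representation of a continuous positive definite function\<close>

text \<open>The fibre over \<open>u\<close> is the Hilbert space of the kernel on the arrows with range \<open>u\<close>, and arrows act by
  left translation. The point vector at \<open>y\<close> is the translate by \<open>y\<close> of the point vector at a unit, so
  \<open>\<Phi>\<close> is the coefficient of the section \<open>u \<mapsto> point u u\<close>.\<close>
locale positive_definite_representation = haar_groupoid G lam for G :: "'g groupoid_struct" and lam +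
  fixes \<Phi> :: "'g \<Rightarrow> complex"
  assumes continuous_\<Phi>: "contG \<Phi>" and pd_\<Phi>: "positive_definite G \<Phi>"
begin

definition K :: "'g \<Rightarrow> 'g \<Rightarrow> complex"
  where "K s t = \<Phi> (ldiv s t)"

lemma topspace_units: "u \<in> units G \<Longrightarrow> u \<in> topspace (unit_space G)"
  unfolding topspace_unit_space .

lemma pd_K: "pd_kernel (fib u) K"
proof (cases "u \<in> units G")
  case True
  show ?thesis using positive_definiteD[OF pd_\<Phi> True] unfolding K_def[abs_def] fib_def .
next
  case False
  then have "fib u = {}" using rng_closed by (auto simp: fib_iff)
  moreover have "c = []" if "supported {} c" for c :: "(complex \<times> 'g) list"
    using that by (cases c) auto
  ultimately show ?thesis unfolding pd_kernel_def by (force simp: kform_def)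
qed

sublocale W: kernel_space "fib u" K for u
  by unfold_locales (rule pd_K)

abbreviation point :: "'g \<Rightarrow> 'g \<Rightarrow> 'g \<Rightarrow> complex"
  where "point u y \<equiv> W.kf u [(1, y)]"

lemma point_space: "y \<in> fib u \<Longrightarrow> point u y \<in> W.space u"
  by (rule W.kf_space) simp

lemma K_diag: "y \<in> arrows G \<Longrightarrow> K y y = \<Phi> (src G y)"
  by (simp add: K_def comp_inv_left)

lemma eval_bound:
  assumes "f \<in> W.space u" "y \<in> fib u"
  shows "cmod (f y) \<le> W.N u f * sqrt (Re (\<Phi> (src G y)))"
  using W.N_bound[OF assms(1), of "[(1, y)]"] assms(2) by (simp add: W.nrm_def K_diag fib_iff)

lemma \<Phi>_bounded: "\<exists>M\<ge>0. \<forall>u\<in>units G. Re (\<Phi> u) \<le> M"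
proof -
  have "compactin (arr_top G) (arrows G)" using compact_arrows by (simp add: compact_space_def)
  from image_compactin[OF this continuous_\<Phi>] have "bounded (\<Phi> ` arrows G)"
    by (simp only: compactin_euclidean_iff compact_imp_bounded)
  then obtain C where C: "\<forall>x\<in>arrows G. cmod (\<Phi> x) \<le> C" by (auto simp: bounded_iff)
  have "Re (\<Phi> u) \<le> max C 0" if "u \<in> units G" for u
    using C[rule_format, OF unit_arrow[OF that]] complex_Re_le_cmod[of "\<Phi> u"] by linarith
  then show ?thesis by (intro exI[of _ "max C 0"]) simp
qed

lemma K_slice: assumes "s \<in> fib u" shows "cont_on_fib u (\<lambda>y. K s y)"
proof -
  have "continuous_map (subtopology (arr_top G) (fib u)) (arr_top G) (\<lambda>y. ldiv s y)"
    using assms by (intro continuous_comp continuous_map_from_subtopology[OF continuous_map_id[unfolded id_def]])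
      (auto simp: fib_iff inv_closed src_inv)
  from continuous_map_after[OF this continuous_\<Phi>] show ?thesis by (simp add: K_def)
qed

lemma ev_K_slice: "supported (fib u) c \<Longrightarrow> cont_on_fib u (\<lambda>y. ev c (\<lambda>s. K s y))"
proof (induction c)
  case (Cons p c)
  obtain a s where p: "p = (a, s)" by (cases p)
  show ?case using Cons unfolding p ev_simps
    by (intro continuous_map_add continuous_map_cmult continuous_map_canonical_const K_slice) auto
qed simp

lemma ev_K_eq:
  assumes c: "supported (fib u) c" and y: "y \<in> fib u"
  shows "ev c (\<lambda>s. K s y) = cnj (W.kf u c y)"
proof -
  have "kcomb K [(1, y)] = (\<lambda>s. K s y)" by (simp add: fun_eq_iff)
  then have "ev c (\<lambda>s. K s y) = kform K c [(1, y)]" by (simp add: kform_def)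
  also have "\<dots> = cnj (kform K [(1, y)] c)" using pd_kernel_cnj[OF pd_K _ c, of "[(1, y)]"] y by simp
  also have "kform K [(1, y)] c = W.kf u c y" using y by (simp add: kform_def W.kf_def)
  finally show ?thesis .
qed

text \<open>The integral of \<open>a y\<close> times the point vector at \<open>y\<close> over the fibre. Sections of this kind
  generate the continuous sections of the bundle.\<close>
definition avg :: "('g \<Rightarrow> complex) \<Rightarrow> 'g \<Rightarrow> 'g \<Rightarrow> complex"
  where "avg a u s = (if s \<in> fib u then I u (\<lambda>y. a y * K s y) else 0)"

context
  fixes a :: "'g \<Rightarrow> complex" and u :: 'g
  assumes a: "cont_on_fib u a" and u: "u \<in> units G"
begin

lemma ev_avg:
  assumes "supported (fib u) c"
  shows "ev c (avg a u) = I u (\<lambda>y. a y * ev c (\<lambda>s. K s y))"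
  using assms
proof (induction c)
  case (Cons p c)
  obtain b s where p: "p = (b, s)" by (cases p)
  have s: "s \<in> fib u" and c: "supported (fib u) c" using Cons.prems p by auto
  have "I u (\<lambda>y. a y * ev (p # c) (\<lambda>s. K s y)) = I u (\<lambda>y. cnj b * (a y * K s y) + a y * ev c (\<lambda>s. K s y))"
    by (simp add: p algebra_simps)
  also have "\<dots> = I u (\<lambda>y. cnj b * (a y * K s y)) + I u (\<lambda>y. a y * ev c (\<lambda>s. K s y))"
    by (rule I_add[OF topspace_units[OF u]
        continuous_map_cmult[OF continuous_map_canonical_const continuous_map_cmult[OF a K_slice[OF s]]]
        continuous_map_cmult[OF a ev_K_slice[OF c]]])
  also have "I u (\<lambda>y. cnj b * (a y * K s y)) = cnj b * avg a u s"
    using s by (simp add: avg_def)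
  finally show ?case using Cons.IH[OF c] by (simp add: p)
qed simp

lemma cmod_ev_K_le:
  assumes c: "supported (fib u) c" and y: "y \<in> fib u"
  shows "cmod (ev c (\<lambda>s. K s y)) \<le> W.nrm c * sqrt (Re (\<Phi> (src G y)))"
  using eval_bound[OF W.kf_space[OF c] y] W.N_kf[OF c] by (simp add: ev_K_eq[OF c y])

lemma avg_space: "avg a u \<in> W.space u"
proof -
  obtain M where M: "M \<ge> 0" "\<And>v. v \<in> units G \<Longrightarrow> Re (\<Phi> v) \<le> M" using \<Phi>_bounded by blast
  have "compactin (arr_top G) (fib u)" by (rule closedin_compact_space[OF compact_arrows closed_fib])
  then have "compactin (subtopology (arr_top G) (fib u)) (fib u)" by (simp add: compactin_subtopology)
  from image_compactin[OF this a] have "bounded (a ` fib u)"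
    by (simp only: compactin_euclidean_iff compact_imp_bounded)
  then obtain C where C: "\<forall>y\<in>fib u. cmod (a y) \<le> C" by (auto simp: bounded_iff)
  define C' where "C' = max C 0"
  have C': "C' \<ge> 0" "\<And>y. y \<in> fib u \<Longrightarrow> cmod (a y) \<le> C'" using C by (auto simp: C'_def le_max_iff_disj)
  show ?thesis
  proof (rule W.spaceI[of u _ "C' * sqrt M * mass u"])
    show "0 \<le> C' * sqrt M * mass u" using C' M mass_nonneg[OF topspace_units[OF u]] by simp
    fix c assume c: "supported (fib u) c"
    have "cmod (ev c (avg a u)) \<le> C' * (W.nrm c * sqrt M) * mass u"
      unfolding ev_avg[OF c]
    proof (rule I_bound[OF topspace_units[OF u] continuous_map_cmult[OF a ev_K_slice[OF c]]])
      fix y assume y: "y \<in> fib u"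
      have "sqrt (Re (\<Phi> (src G y))) \<le> sqrt M" using y M(2) src_closed by (auto simp: fib_iff)
      then have "cmod (ev c (\<lambda>s. K s y)) \<le> W.nrm c * sqrt M"
        using cmod_ev_K_le[OF c y] mult_left_mono[OF _ W.nrm_nonneg[OF c]] by (meson order_trans)
      then show "cmod (a y * ev c (\<lambda>s. K s y)) \<le> C' * (W.nrm c * sqrt M)"
        unfolding norm_mult using C' y by (intro mult_mono) auto
    qed
    then show "cmod (ev c (avg a u)) \<le> C' * sqrt M * mass u * W.nrm c" by (simp add: mult_ac)
  qed (simp add: avg_def)
qed

text \<open>A limit along \<open>approx w\<close>, whose functions converge to \<open>w\<close> uniformly on the fibre.\<close>
lemma inner_avg:
  assumes w: "w \<in> W.space u" and wc: "cont_on_fib u w"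
  shows "W.inner u (avg a u) w = I u (\<lambda>y. a y * cnj (w y))"
proof -
  note uT = topspace_units[OF u]
  obtain M where M: "M \<ge> 0" "\<And>v. v \<in> units G \<Longrightarrow> Re (\<Phi> v) \<le> M" using \<Phi>_bounded by blast
  let ?c = "W.approx u w"
  note c = W.approx(1)[OF w]
  have diff: "cmod (ev (?c n) (avg a u) - I u (\<lambda>y. a y * cnj (w y)))
      \<le> W.dst u w (W.kf u (?c n)) * (sqrt M * I u (\<lambda>y. cmod (a y)))" for n
  proof -
    let ?N = "W.dst u w (W.kf u (?c n))"
    have sp: "(\<lambda>x. w x - W.kf u (?c n) x) \<in> W.space u" by (rule W.space_diff(1)[OF w W.kf_space[OF c]])
    have 1: "cont_on_fib u (\<lambda>y. a y * ev (?c n) (\<lambda>s. K s y))" by (rule continuous_map_cmult[OF a ev_K_slice[OF c]])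
    have 2: "cont_on_fib u (\<lambda>y. a y * cnj (w y))" by (rule continuous_map_cmult[OF a continuous_map_cnj[OF wc]])
    have "cmod (ev (?c n) (avg a u) - I u (\<lambda>y. a y * cnj (w y)))
        = cmod (I u (\<lambda>y. a y * ev (?c n) (\<lambda>s. K s y) - a y * cnj (w y)))"
      unfolding ev_avg[OF c] I_diff[OF uT 1 2] ..
    also have "\<dots> \<le> I u (\<lambda>y. cmod (a y * ev (?c n) (\<lambda>s. K s y) - a y * cnj (w y)))"
      by (rule I_norm[OF uT continuous_map_diff[OF 1 2]])
    also have "\<dots> \<le> I u (\<lambda>y. (?N * sqrt M) * cmod (a y))"
    proof (rule I_mono[OF uT continuous_map_cmod[OF continuous_map_diff[OF 1 2]]
          continuous_map_real_mult_left[OF continuous_map_cmod[OF a]]])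
      fix y assume y: "y \<in> fib u"
      have "sqrt (Re (\<Phi> (src G y))) \<le> sqrt M" using y M(2) src_closed by (auto simp: fib_iff)
      then have "cmod (w y - W.kf u (?c n) y) \<le> ?N * sqrt M"
        using eval_bound[OF sp y] mult_left_mono[OF _ W.N_nonneg[OF sp]] by (meson order_trans)
      moreover have "a y * ev (?c n) (\<lambda>s. K s y) - a y * cnj (w y) = a y * cnj (W.kf u (?c n) y - w y)"
        by (simp add: ev_K_eq[OF c y] right_diff_distrib)
      then have "cmod (a y * ev (?c n) (\<lambda>s. K s y) - a y * cnj (w y)) = cmod (a y) * cmod (w y - W.kf u (?c n) y)"
        by (simp only: norm_mult complex_mod_cnj norm_minus_commute)
      ultimately show "cmod (a y * ev (?c n) (\<lambda>s. K s y) - a y * cnj (w y)) \<le> (?N * sqrt M) * cmod (a y)"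
        using mult_left_mono[of "cmod (w y - W.kf u (?c n) y)" "?N * sqrt M" "cmod (a y)"] by (simp add: mult.commute)
    qed
    also have "\<dots> = (?N * sqrt M) * I u (\<lambda>y. cmod (a y))" by (rule set_integral_mult_right)
    finally show ?thesis by (simp only: mult.assoc)
  qed
  have "(\<lambda>n. W.dst u w (W.kf u (?c n)) * (sqrt M * I u (\<lambda>y. cmod (a y)))) \<longlonglongrightarrow> 0 * (sqrt M * I u (\<lambda>y. cmod (a y)))"
    by (rule tendsto_mult[OF W.approx_lim[OF w] tendsto_const])
  then have L: "(\<lambda>n. W.dst u w (W.kf u (?c n)) * (sqrt M * I u (\<lambda>y. cmod (a y)))) \<longlonglongrightarrow> 0" by simp
  have "(\<lambda>n. ev (?c n) (avg a u) - I u (\<lambda>y. a y * cnj (w y))) \<longlonglongrightarrow> 0"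
    by (rule Lim_null_comparison[OF always_eventually[OF allI[OF diff]] L])
  then have "(\<lambda>n. ev (?c n) (avg a u)) \<longlonglongrightarrow> I u (\<lambda>y. a y * cnj (w y))" by (rule LIM_zero_cancel)
  then show ?thesis using W.inner_approx[OF avg_space w] by (rule LIMSEQ_unique[rotated])
qed

end

text \<open>An average of point vectors, with weights \<open>\<alpha>\<close> of total mass one, lies as close to \<open>w\<close> as the point
  vectors that enter it.\<close>
lemma avg_close:
  fixes \<alpha> :: "'g \<Rightarrow> real"
  assumes u: "u \<in> units G" and \<alpha>: "cont_on_fib u \<alpha>" "\<And>y. y \<in> fib u \<Longrightarrow> 0 \<le> \<alpha> y" "I u \<alpha> = 1"
    and w: "w \<in> W.space u" and \<epsilon>: "\<epsilon> \<ge> 0"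
    and close: "\<And>y. y \<in> fib u \<Longrightarrow> \<alpha> y \<noteq> 0 \<Longrightarrow> W.dst u (point u y) w \<le> \<epsilon>"
  shows "W.dst u w (avg (\<lambda>y. of_real (\<alpha> y)) u) \<le> \<epsilon>"
proof -
  note uT = topspace_units[OF u]
  let ?a = "\<lambda>y. complex_of_real (\<alpha> y)"
  have a: "cont_on_fib u ?a" by (rule continuous_map_of_real[OF \<alpha>(1)])
  have "W.dst u (avg ?a u) w \<le> \<epsilon>"
  proof (rule W.N_least[OF \<epsilon>])
    fix c assume c: "supported (fib u) c"
    have 1: "cont_on_fib u (\<lambda>y. ?a y * ev c (\<lambda>s. K s y))" by (rule continuous_map_cmult[OF a ev_K_slice[OF c]])
    have 2: "cont_on_fib u (\<lambda>y. ?a y * ev c w)" by (rule continuous_map_cmult[OF a continuous_map_canonical_const])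
    have "I u (\<lambda>y. ?a y * ev c w) = ev c w"
      unfolding set_integral_mult_left set_integral_complex_of_real \<alpha>(3) by simp
    then have "ev c (\<lambda>s. avg ?a u s - w s) = I u (\<lambda>y. ?a y * ev c (\<lambda>s. K s y)) - I u (\<lambda>y. ?a y * ev c w)"
      unfolding ev_diff ev_avg[OF a u c] by simp
    also have "\<dots> = I u (\<lambda>y. ?a y * ev c (\<lambda>s. K s y) - ?a y * ev c w)" by (rule I_diff[OF uT 1 2, symmetric])
    finally have "cmod (ev c (\<lambda>s. avg ?a u s - w s)) \<le> I u (\<lambda>y. cmod (?a y * ev c (\<lambda>s. K s y) - ?a y * ev c w))"
      using I_norm[OF uT continuous_map_diff[OF 1 2]] by (simp only:)
    also have "\<dots> \<le> I u (\<lambda>y. (\<epsilon> * W.nrm c) * \<alpha> y)"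
    proof (rule I_mono[OF uT continuous_map_cmod[OF continuous_map_diff[OF 1 2]]
          continuous_map_real_mult_left[OF \<alpha>(1)]])
      fix y assume y: "y \<in> fib u"
      have eq: "?a y * ev c (\<lambda>s. K s y) - ?a y * ev c w = ?a y * ev c (\<lambda>s. point u y s - w s)"
      proof -
        have "ev c (\<lambda>s. K s y) = ev c (point u y)" by (rule ev_cong[OF c]) (simp add: W.kf_def)
        then show ?thesis by (simp add: ev_diff right_diff_distrib)
      qed
      show "cmod (?a y * ev c (\<lambda>s. K s y) - ?a y * ev c w) \<le> (\<epsilon> * W.nrm c) * \<alpha> y"
      proof (cases "\<alpha> y = 0")
        case False
        have sp: "(\<lambda>s. point u y s - w s) \<in> W.space u" by (rule W.space_diff(1)[OF point_space[OF y] w])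
        have "cmod (ev c (\<lambda>s. point u y s - w s)) \<le> W.dst u (point u y) w * W.nrm c"
          by (rule W.N_bound[OF sp c])
        also have "\<dots> \<le> \<epsilon> * W.nrm c" by (rule mult_right_mono[OF close[OF y False] W.nrm_nonneg[OF c]])
        finally show ?thesis unfolding eq norm_mult norm_of_real
          using \<alpha>(2)[OF y] by (simp add: mult.commute mult_left_mono)
      qed simp
    qed
    also have "\<dots> = (\<epsilon> * W.nrm c) * I u \<alpha>" by (rule set_integral_mult_right)
    finally show "cmod (ev c (\<lambda>s. avg ?a u s - w s)) \<le> \<epsilon> * W.nrm c" by (simp add: \<alpha>(3))
  qed
  then show ?thesis using W.N_diff_commute[OF avg_space[OF a u] w] by simp
qed

lemma N_point_diff:
  assumes "y \<in> fib u" "z \<in> fib u"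
  shows "(W.dst u (point u y) (point u z))\<^sup>2 = Re (\<Phi> (src G y)) + Re (\<Phi> (src G z)) - 2 * Re (K z y)"
proof -
  note p = point_space[OF assms(1)] point_space[OF assms(2)]
  have "W.N2 u (\<lambda>s. point u y s - point u z s) = W.N2 u (point u y) - 2 * Re (point u y z) + (W.nrm [(1, z)])\<^sup>2"
    using W.N2_diff_kf[OF p(1), of "[(1, z)]"] assms by simp
  also have "W.N2 u (point u y) = Re (\<Phi> (src G y))"
    using W.N_sq[OF p(1), symmetric] W.N_kf[of u "[(1, y)]"] W.nrm_sq[of u "[(1, y)]"] assms
    by (simp add: K_diag fib_iff)
  also have "(W.nrm [(1, z)])\<^sup>2 = Re (\<Phi> (src G z))"
    using W.nrm_sq[of u "[(1, z)]"] assms by (simp add: K_diag fib_iff)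
  also have "point u y z = K z y" using assms by (simp add: W.kf_def)
  finally show ?thesis using W.N_sq[OF W.space_diff(1)[OF p]] by simp
qed

definition rep :: "'g \<Rightarrow> ('g \<Rightarrow> complex) \<Rightarrow> 'g \<Rightarrow> complex"
  where "rep x f y = (if y \<in> fib (rng G x) then f (ldiv x y) else 0)"

text \<open>The action of \<open>x\<close> on formal combinations. It maps \<open>kf\<close> to \<open>kf\<close> (\<open>rep_kf\<close>) and preserves \<open>nrm\<close>, which makes \<open>rep\<close>
  isometric by duality.\<close>
definition move :: "'g \<Rightarrow> (complex \<times> 'g) list \<Rightarrow> (complex \<times> 'g) list"
  where "move x c = map (\<lambda>(a, y). (a, arr_comp G x y)) c"

lemma move_simps [simp]: "move x [] = []" "move x ((a, y) # c) = (a, arr_comp G x y) # move x c"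
  by (simp_all add: move_def)

lemma ev_move: "ev (move x c) f = ev c (\<lambda>y. f (arr_comp G x y))"
  by (induction c) auto

context
  fixes x :: 'g assumes x: "x \<in> arrows G"
begin

lemma comp_fib: "y \<in> fib (src G x) \<Longrightarrow> arr_comp G x y \<in> fib (rng G x)"
  using x by (auto simp: fib_iff comp)

lemma inv_comp_fib: "y \<in> fib (rng G x) \<Longrightarrow> ldiv x y \<in> fib (src G x)"
  using x by (auto simp: fib_iff inv_comp_closed)

lemma supported_move: "supported (fib (src G x)) c \<Longrightarrow> supported (fib (rng G x)) (move x c)"
  by (induction c) (auto simp: comp_fib)

lemma K_move:
  assumes "s \<in> fib (rng G x)" "y \<in> fib (src G x)"
  shows "K s (arr_comp G x y) = K (ldiv x s) y"
  unfolding K_def using assms x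
  by (simp add: fib_iff inv_comp inv_closed src_inv rng_inv inv_inv assoc)

lemma kcomb_move:
  assumes "s \<in> fib (rng G x)" "supported (fib (src G x)) c"
  shows "kcomb K (move x c) s = kcomb K c (ldiv x s)"
  using assms(2) by (induction c) (auto simp: K_move[OF assms(1)])

lemma cancel_left: "y \<in> fib (src G x) \<Longrightarrow> ldiv x (arr_comp G x y) = y"
  using x by (intro inv_comp_cancel(1)) (auto simp: fib_iff)

lemma kform_move:
  assumes "supported (fib (src G x)) c" "supported (fib (src G x)) d"
  shows "kform K (move x c) (move x d) = kform K c d"
proof -
  have "kform K (move x c) (move x d) = ev c (\<lambda>y. kcomb K (move x d) (arr_comp G x y))"
    by (simp add: kform_def ev_move)
  also have "\<dots> = ev c (kcomb K d)"
    by (rule ev_cong[OF assms(1)]) (simp add: kcomb_move[OF comp_fib assms(2)] cancel_left)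
  finally show ?thesis by (simp add: kform_def)
qed

lemma nrm_move: "supported (fib (src G x)) c \<Longrightarrow> W.nrm (move x c) = W.nrm c"
  by (simp add: W.nrm_def kform_move)

lemma rep_kf:
  assumes "supported (fib (src G x)) c"
  shows "rep x (W.kf (src G x) c) = W.kf (rng G x) (move x c)"
proof
  fix s show "rep x (W.kf (src G x) c) s = W.kf (rng G x) (move x c) s"
    by (cases "s \<in> fib (rng G x)") (simp_all add: rep_def W.kf_def kcomb_move[OF _ assms] inv_comp_fib)
qed

end

lemma rep_space:
  assumes x: "x \<in> arrows G" and f: "f \<in> W.space (src G x)"
  shows "rep x f \<in> W.space (rng G x)" "W.N (rng G x) (rep x f) \<le> W.N (src G x) f"
proof -
  have ix: "arr_inv G x \<in> arrows G" "src G (arr_inv G x) = rng G x" "rng G (arr_inv G x) = src G x"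
    using x by (auto simp: inv_closed src_inv rng_inv)
  have bound: "cmod (ev d (rep x f)) \<le> W.N (src G x) f * W.nrm d" if d: "supported (fib (rng G x)) d" for d
  proof -
    have d': "supported (fib (src G (arr_inv G x))) d" using d ix by simp
    have "ev d (rep x f) = ev (move (arr_inv G x) d) f"
      unfolding ev_move by (rule ev_cong[OF d]) (simp add: rep_def)
    moreover have "supported (fib (src G x)) (move (arr_inv G x) d)"
      using supported_move[OF ix(1) d'] ix by simp
    ultimately show ?thesis
      using W.N_bound[OF f, of "move (arr_inv G x) d"] nrm_move[OF ix(1) d'] by simp
  qed
  show "rep x f \<in> W.space (rng G x)"
    by (rule W.spaceI[OF _ W.N_nonneg[OF f] bound]) (simp add: rep_def)
  show "W.N (rng G x) (rep x f) \<le> W.N (src G x) f"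
    by (rule W.N_least[OF W.N_nonneg[OF f] bound])
qed

lemma rep_unit:
  assumes "u \<in> units G" "f \<in> W.space u" shows "rep u f = f"
proof
  fix y show "rep u f y = f y"
    using assms W.space_outside[OF assms(2), of y]
    by (cases "y \<in> fib u") (simp_all add: rep_def rng_unit inv_unit unit_comp fib_iff)
qed

lemma rep_comp:
  assumes "x \<in> arrows G" "y \<in> arrows G" "src G x = rng G y"
  shows "rep x (rep y f) = rep (arr_comp G x y) f"
proof
  fix z
  show "rep x (rep y f) z = rep (arr_comp G x y) f z"
  proof (cases "z \<in> fib (rng G x)")
    case True
    then have z: "z \<in> arrows G" "rng G z = rng G x" by (auto simp: fib_iff)
    have "ldiv x z \<in> fib (rng G y)" using inv_comp_fib[OF assms(1) True] assms by simp
    moreover have "ldiv (arr_comp G x y) z = ldiv y (ldiv x z)"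
      using assms z by (simp add: inv_comp assoc inv_closed src_inv rng_inv)
    ultimately show ?thesis using True assms by (simp add: rep_def comp)
  qed (use assms in \<open>simp add: rep_def comp\<close>)
qed

lemma rep_inv_cancel:
  assumes x: "x \<in> arrows G"
  shows "f \<in> W.space (src G x) \<Longrightarrow> rep (arr_inv G x) (rep x f) = f"
    and "f \<in> W.space (rng G x) \<Longrightarrow> rep x (rep (arr_inv G x) f) = f"
  using rep_comp[of "arr_inv G x" x f] rep_comp[of x "arr_inv G x" f] x
  by (simp_all add: inv_closed src_inv rng_inv comp_inv_left comp_inv_right rep_unit src_closed rng_closed)

lemma rep_add: "rep x (\<lambda>y. f y + g y) = (\<lambda>y. rep x f y + rep x g y)"
  and rep_diff: "rep x (\<lambda>y. f y - g y) = (\<lambda>y. rep x f y - rep x g y)"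
  and rep_mult: "rep x (\<lambda>y. t * f y) = (\<lambda>y. t * rep x f y)"
  by (simp_all add: rep_def fun_eq_iff)

lemma rep_inner:
  assumes x: "x \<in> arrows G" and f: "f \<in> W.space (src G x)" and g: "g \<in> W.space (src G x)"
  shows "W.inner (rng G x) (rep x f) (rep x g) = W.inner (src G x) f g"
proof -
  let ?c = "W.approx (src G x) g"
  note c = W.approx(1)[OF g]
  have sp: "(\<lambda>y. g y - W.kf (src G x) (?c n) y) \<in> W.space (src G x)" for n
    by (rule W.space_diff(1)[OF g W.kf_space[OF c]])
  have "(\<lambda>n. W.dst (rng G x) (rep x g) (W.kf (rng G x) (move x (?c n)))) \<longlonglongrightarrow> 0"
  proof (rule Lim_null_comparison[OF always_eventually[OF allI] W.approx_lim[OF g]])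
    fix n
    have "(\<lambda>y. rep x g y - W.kf (rng G x) (move x (?c n)) y) = rep x (\<lambda>y. g y - W.kf (src G x) (?c n) y)"
      unfolding rep_diff rep_kf[OF x c] ..
    then show "norm (W.dst (rng G x) (rep x g) (W.kf (rng G x) (move x (?c n))))
        \<le> W.dst (src G x) g (W.kf (src G x) (?c n))"
      using rep_space[OF x sp[of n]] W.N_nonneg by simp
  qed
  then have "(\<lambda>n. ev (move x (?c n)) (rep x f)) \<longlonglongrightarrow> W.inner (rng G x) (rep x f) (rep x g)"
    by (rule W.inner_lim[OF rep_space(1)[OF x f] rep_space(1)[OF x g] supported_move[OF x c]])
  moreover have "ev (move x (?c n)) (rep x f) = ev (?c n) f" for n
    unfolding ev_move
    by (rule ev_cong[OF c]) (simp add: rep_def comp_fib[OF x] cancel_left[OF x])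
  ultimately have "(\<lambda>n. ev (?c n) f) \<longlonglongrightarrow> W.inner (rng G x) (rep x f) (rep x g)" by simp
  then show ?thesis using W.inner_approx[OF f g] LIMSEQ_unique by blast
qed

lemma rep_unitary:
  assumes x: "x \<in> arrows G"
  shows "unitary_map (W.hilbert (src G x)) (W.hilbert (rng G x)) (rep x)"
  unfolding unitary_map_def W.hilbert_simps
proof (intro conjI ballI allI)
  show "bij_betw (rep x) (W.space (src G x)) (W.space (rng G x))"
  proof (rule bij_betwI[of _ _ _ "rep (arr_inv G x)"])
    show "rep x \<in> W.space (src G x) \<rightarrow> W.space (rng G x)" using rep_space(1)[OF x] by blast
    show "rep (arr_inv G x) \<in> W.space (rng G x) \<rightarrow> W.space (src G x)"
      using rep_space(1)[of "arr_inv G x"] x by (simp add: inv_closed src_inv rng_inv)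
  qed (simp_all add: rep_inv_cancel[OF x])
qed (simp_all add: rep_add rep_mult rep_inner[OF x])

text \<open>The coefficient is a twofold integral of \<open>cnj (b s) a y \<Phi> (s\<inverse> x y)\<close>; the inner one depends on \<open>s\<inverse> x\<close>
  only, and is continuous in that arrow.\<close>
lemma continuous_inner_avg:
  assumes a: "contG a" and b: "contG b"
  shows "contG (\<lambda>x. W.inner (rng G x) (rep x (avg a (src G x))) (avg b (rng G x)))"
proof -
  define \<psi> where "\<psi> t = I (src G t) (\<lambda>y. a y * \<Phi> (arr_comp G t y))" for t
  have \<psi>: "contG \<psi>"
    unfolding \<psi>_def
  proof (rule continuous_parametric_I'[OF continuous_src_unit])
    let ?Q = "subtopology (prod_topology (arr_top G) (arr_top G)) {(t, y). rng G y = src G t}"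
    have "continuous_map ?Q (arr_top G) (\<lambda>q. arr_comp G (fst q) (snd q))"
      by (rule continuous_comp[OF continuous_map_sub_prod]) auto
    from continuous_map_after[OF this continuous_\<Phi>]
    show "continuous_map ?Q euclidean (\<lambda>q. a (snd q) * \<Phi> (arr_comp G (fst q) (snd q)))"
      by (rule continuous_map_cmult[OF continuous_map_after[OF continuous_map_sub_prod(2) a]])
  qed
  have "contG (\<lambda>x. I (rng G x) (\<lambda>s. b s * cnj (\<psi> (ldiv s x))))"
  proof (rule continuous_parametric_I'[OF continuous_rng_unit])
    let ?Q = "subtopology (prod_topology (arr_top G) (arr_top G)) {(x, s). rng G s = rng G x}"
    have "continuous_map ?Q (arr_top G) (\<lambda>q. ldiv (snd q) (fst q))"
      by (rule continuous_comp[OF continuous_inv[OF continuous_map_sub_prod(2)] continuous_map_sub_prod(1)])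
        (auto simp: src_inv)
    from continuous_map_cnj[OF continuous_map_after[OF this \<psi>]]
    show "continuous_map ?Q euclidean (\<lambda>q. b (snd q) * cnj (\<psi> (ldiv (snd q) (fst q))))"
      by (rule continuous_map_cmult[OF continuous_map_after[OF continuous_map_sub_prod(2) b]])
  qed
  from continuous_map_cnj[OF this] show ?thesis
  proof (rule continuous_map_eq)
    fix x assume x: "x \<in> arrows G"
    have u: "rng G x \<in> units G" "src G x \<in> units G" using x rng_closed src_closed by auto
    note av = avg_space[OF cont_on_fib[OF a] u(2)] avg_space[OF cont_on_fib[OF b] u(1)]
    have eq: "rep x (avg a (src G x)) s = \<psi> (ldiv s x)" if s: "s \<in> fib (rng G x)" for s
    proof -
      have s': "s \<in> arrows G" "rng G s = rng G x" using s by (auto simp: fib_iff)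
      have "rep x (avg a (src G x)) s = I (src G x) (\<lambda>y. a y * K (ldiv x s) y)"
        using s inv_comp_fib[OF x s] by (simp add: rep_def avg_def)
      also have "\<dots> = I (src G x) (\<lambda>y. a y * \<Phi> (arr_comp G (ldiv s x) y))"
      proof (rule I_cong[OF topspace_units[OF u(2)]])
        fix y assume "y \<in> fib (src G x)"
        then show "a y * K (ldiv x s) y = a y * \<Phi> (arr_comp G (ldiv s x) y)"
          using K_move[OF x s, of y] x s' by (simp add: K_def fib_iff assoc inv_closed src_inv)
      qed
      finally show ?thesis using x s' by (simp add: \<psi>_def inv_comp_closed)
    qed
    have "cont_on_fib (rng G x) (\<lambda>s. \<psi> (ldiv s x))"
      by (rule continuous_translate[OF \<psi>  u(1)]) (use x in \<open>simp add: fib_iff\<close>)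
    then have c: "cont_on_fib (rng G x) (rep x (avg a (src G x)))"
      by (rule continuous_map_eq) (simp add: eq)
    have "W.inner (rng G x) (rep x (avg a (src G x))) (avg b (rng G x))
        = cnj (W.inner (rng G x) (avg b (rng G x)) (rep x (avg a (src G x))))"
      by (rule W.inner_cnj[OF av(2) rep_space(1)[OF x av(1)]])
    also have "W.inner (rng G x) (avg b (rng G x)) (rep x (avg a (src G x)))
        = I (rng G x) (\<lambda>s. b s * cnj (rep x (avg a (src G x)) s))"
      by (rule inner_avg[OF cont_on_fib[OF b] u(1) rep_space(1)[OF x av(1)] c])
    also have "\<dots> = I (rng G x) (\<lambda>s. b s * cnj (\<psi> (ldiv s x)))"
      by (rule I_cong[OF topspace_units[OF u(1)]]) (simp add: eq)
    finally show "cnj (I (rng G x) (\<lambda>s. b s * cnj (\<psi> (ldiv s x))))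
        = W.inner (rng G x) (rep x (avg a (src G x))) (avg b (rng G x))" by simp
  qed
qed

lemma continuous_N_avg:
  assumes a: "contG a"
  shows "continuous_map (unit_space G) euclideanreal (\<lambda>u. W.N u (avg a u))"
proof -
  have "continuous_map (unit_space G) euclideanreal
      (\<lambda>x. sqrt (Re (W.inner (rng G x) (rep x (avg a (src G x))) (avg a (rng G x)))))"
    by (rule continuous_map_sqrt[OF continuous_map_Re[OF continuous_map_from_subtopology[OF continuous_inner_avg[OF a a]]]])
  then show ?thesis
  proof (rule continuous_map_eq)
    fix u assume "u \<in> topspace (unit_space G)"
    then have u: "u \<in> units G" unfolding topspace_unit_space .
    have sp: "avg a u \<in> W.space u" by (rule avg_space[OF cont_on_fib[OF a] u])
    show "sqrt (Re (W.inner (rng G u) (rep u (avg a (src G u))) (avg a (rng G u)))) = W.N u (avg a u)"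
      using u sp by (simp add: rng_unit src_unit rep_unit W.inner_self W.N_nonneg)
  qed
qed

text \<open>The local uniform closure of the space of sections \<open>avg a\<close>.\<close>
definition sections :: "('g \<Rightarrow> 'g \<Rightarrow> complex) set"
  where "sections = {\<eta> \<in> \<Pi>\<^sub>E u\<in>units G. W.space u. \<forall>u\<in>units G. \<forall>\<epsilon>>0. \<exists>U a.
    openin (unit_space G) U \<and> u \<in> U \<and> contG a \<and>
    (\<forall>v\<in>U. W.dst v (\<eta> v) (avg a v) < \<epsilon>)}"

abbreviation near :: "('g \<Rightarrow> 'g \<Rightarrow> complex) \<Rightarrow> 'g \<Rightarrow> real \<Rightarrow> bool"
  where "near \<eta> u \<epsilon> \<equiv> \<exists>U a. openin (unit_space G) U \<and> u \<in> U \<and> U \<subseteq> units G \<and> contG a \<and>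
    (\<forall>v\<in>U. W.dst v (\<eta> v) (avg a v) < \<epsilon>)"

lemma sections_space: "\<eta> \<in> sections \<Longrightarrow> u \<in> units G \<Longrightarrow> \<eta> u \<in> W.space u"
  unfolding sections_def by (drule CollectD) (drule conjunct1, erule PiE_mem)

lemma sections_approx:
  assumes "\<eta> \<in> sections" "u \<in> units G" "\<epsilon> > 0"
  shows "near \<eta> u \<epsilon>"
proof -
  have "\<forall>u\<in>units G. \<forall>\<epsilon>>0. \<exists>U a. openin (unit_space G) U \<and> u \<in> U \<and>
      contG a \<and> (\<forall>v\<in>U. W.dst v (\<eta> v) (avg a v) < \<epsilon>)"
    using assms(1) unfolding sections_def by blast
  then obtain U a where *: "openin (unit_space G) U" "u \<in> U" "contG a"
    "\<forall>v\<in>U. W.dst v (\<eta> v) (avg a v) < \<epsilon>" using assms(2,3) by blast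
  have "U \<subseteq> units G" using openin_subset[OF *(1)] unfolding topspace_unit_space .
  with * show ?thesis by blast
qed

lemma sectionsI:
  assumes "\<And>u. u \<in> units G \<Longrightarrow> \<eta> u \<in> W.space u"
    and "\<And>u \<epsilon>. u \<in> units G \<Longrightarrow> \<epsilon> > 0 \<Longrightarrow> near \<eta> u \<epsilon>"
  shows "restrict \<eta> (units G) \<in> sections"
proof -
  have "\<exists>U a. openin (unit_space G) U \<and> u \<in> U \<and> contG a \<and>
      (\<forall>v\<in>U. W.dst v (restrict \<eta> (units G) v) (avg a v) < \<epsilon>)" if u: "u \<in> units G" "\<epsilon> > 0" for u \<epsilon>
  proof -
    obtain U a where U: "openin (unit_space G) U" "u \<in> U" "U \<subseteq> units G" "contG a"
      "\<forall>v\<in>U. W.dst v (\<eta> v) (avg a v) < \<epsilon>" using assms(2)[OF u] by blast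
    have "\<forall>v\<in>U. W.dst v (restrict \<eta> (units G) v) (avg a v) < \<epsilon>"
    proof
      fix v assume v: "v \<in> U"
      then have "restrict \<eta> (units G) v = \<eta> v" using U(3) by (simp add: subsetD)
      then show "W.dst v (restrict \<eta> (units G) v) (avg a v) < \<epsilon>" using U(5) v by simp
    qed
    then show ?thesis using U by blast
  qed
  moreover have "restrict \<eta> (units G) \<in> (\<Pi>\<^sub>E u\<in>units G. W.space u)"
    using assms(1) by simp
  ultimately show ?thesis unfolding sections_def by blast
qed

lemma unit_space_open: "openin (unit_space G) (units G)"
  using openin_topspace[of "unit_space G"] unfolding topspace_unit_space .

lemma avg_section:
  assumes a: "contG a"
  shows "restrict (avg a) (units G) \<in> sections"
proof (rule sectionsI)
  show "avg a u \<in> W.space u" if "u \<in> units G" for u by (rule avg_space[OF cont_on_fib[OF a] that])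
  fix u and \<epsilon> :: real assume u: "u \<in> units G" "\<epsilon> > 0"
  have "W.dst v (avg a v) (avg a v) = 0" for v by (simp add: W.N_zero)
  then show "near (avg a) u \<epsilon>"
    using u a unit_space_open by (intro exI[of _ "units G"] exI[of _ a]) simp
qed

lemma avg_add:
  assumes "contG a" "contG b" "u \<in> units G"
  shows "avg (\<lambda>y. a y + b y) u s = avg a u s + avg b u s"
proof (cases "s \<in> fib u")
  case True
  have "I u (\<lambda>y. (a y + b y) * K s y) = I u (\<lambda>y. a y * K s y + b y * K s y)"
    by (simp only: distrib_right)
  also have "\<dots> = I u (\<lambda>y. a y * K s y) + I u (\<lambda>y. b y * K s y)"
    by (rule I_add[OF topspace_units[OF assms(3)] continuous_map_cmult[OF cont_on_fib[OF assms(1)] K_slice[OF True]]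
        continuous_map_cmult[OF cont_on_fib[OF assms(2)] K_slice[OF True]]])
  finally show ?thesis using True by (simp add: avg_def)
qed (simp add: avg_def)

lemma avg_mult: "avg (\<lambda>y. t * a y) u s = t * avg a u s"
  by (simp add: avg_def mult.assoc)

lemma sections_add:
  assumes \<xi>: "\<xi> \<in> sections" and \<eta>: "\<eta> \<in> sections"
  shows "(\<lambda>u\<in>units G. \<lambda>s. \<xi> u s + \<eta> u s) \<in> sections"
proof (rule sectionsI)
  show "(\<lambda>s. \<xi> u s + \<eta> u s) \<in> W.space u" if "u \<in> units G" for u
    by (rule W.space_add(1)[OF sections_space[OF \<xi> that] sections_space[OF \<eta> that]])
  fix u and \<epsilon> :: real assume u: "u \<in> units G" and "\<epsilon> > 0"
  then have e: "\<epsilon> / 2 > 0" by simp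
  obtain U a where U: "openin (unit_space G) U" "u \<in> U" "U \<subseteq> units G"
    "contG a" "\<forall>v\<in>U. W.dst v (\<xi> v) (avg a v) < \<epsilon> / 2"
    using sections_approx[OF \<xi> u e] by blast
  obtain V b where V: "openin (unit_space G) V" "u \<in> V" "V \<subseteq> units G"
    "contG b" "\<forall>v\<in>V. W.dst v (\<eta> v) (avg b v) < \<epsilon> / 2"
    using sections_approx[OF \<eta> u e] by blast
  have "W.N v (\<lambda>s. \<xi> v s + \<eta> v s - avg (\<lambda>y. a y + b y) v s) < \<epsilon>" if v: "v \<in> U \<inter> V" for v
  proof -
    have vu: "v \<in> units G" using v U(3) by blast
    note sp = sections_space[OF \<xi> vu] sections_space[OF \<eta> vu]
      avg_space[OF cont_on_fib[OF U(4)] vu] avg_space[OF cont_on_fib[OF V(4)] vu]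
    have eq: "(\<lambda>s. \<xi> v s + \<eta> v s - avg (\<lambda>y. a y + b y) v s)
        = (\<lambda>s. (\<xi> v s - avg a v s) + (\<eta> v s - avg b v s))"
      by (simp add: avg_add[OF U(4) V(4) vu] fun_eq_iff)
    have "W.N v (\<lambda>s. (\<xi> v s - avg a v s) + (\<eta> v s - avg b v s))
        \<le> W.dst v (\<xi> v) (avg a v) + W.dst v (\<eta> v) (avg b v)"
      by (rule W.space_add(2)[OF W.space_diff(1)[OF sp(1,3)] W.space_diff(1)[OF sp(2,4)]])
    then show ?thesis unfolding eq using bspec[OF U(5), of v] bspec[OF V(5), of v] v by simp
  qed
  moreover have "openin (unit_space G) (U \<inter> V)" using U(1) V(1) by (rule openin_Int)
  ultimately show "near (\<lambda>v s. \<xi> v s + \<eta> v s) u \<epsilon>"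
    using U(2,3) V(2) continuous_map_add[OF U(4) V(4)]
    by (intro exI[of _ "U \<inter> V"] exI[of _ "\<lambda>y. a y + b y"]) blast
qed

lemma sections_mult:
  assumes \<xi>: "\<xi> \<in> sections"
  shows "(\<lambda>u\<in>units G. \<lambda>s. t * \<xi> u s) \<in> sections"
proof (rule sectionsI)
  show "(\<lambda>s. t * \<xi> u s) \<in> W.space u" if "u \<in> units G" for u
    by (rule W.space_mult(1)[OF sections_space[OF \<xi> that]])
  fix u and \<epsilon> :: real assume u: "u \<in> units G" and "\<epsilon> > 0"
  define \<delta> where "\<delta> = \<epsilon> / (cmod t + 1)"
  have t: "0 < cmod t + 1" by (simp add: add_nonneg_pos)
  then have \<delta>: "\<delta> > 0" "(cmod t + 1) * \<delta> = \<epsilon>" using \<open>\<epsilon> > 0\<close> by (simp_all add: \<delta>_def)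
  obtain U a where U: "openin (unit_space G) U" "u \<in> U" "U \<subseteq> units G"
    "contG a" "\<forall>v\<in>U. W.dst v (\<xi> v) (avg a v) < \<delta>"
    using sections_approx[OF \<xi> u \<delta>(1)] by blast
  have "W.N v (\<lambda>s. t * \<xi> v s - avg (\<lambda>y. t * a y) v s) < \<epsilon>" if v: "v \<in> U" for v
  proof -
    have vu: "v \<in> units G" using v U(3) by blast
    have sp: "(\<lambda>s. \<xi> v s - avg a v s) \<in> W.space v"
      by (rule W.space_diff(1)[OF sections_space[OF \<xi> vu] avg_space[OF cont_on_fib[OF U(4)] vu]])
    have eq: "(\<lambda>s. t * \<xi> v s - avg (\<lambda>y. t * a y) v s) = (\<lambda>s. t * (\<xi> v s - avg a v s))"
      by (simp add: avg_mult right_diff_distrib)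
    have "W.N v (\<lambda>s. t * (\<xi> v s - avg a v s)) \<le> cmod t * W.dst v (\<xi> v) (avg a v)"
      by (rule W.space_mult(2)[OF sp])
    also have "\<dots> \<le> (cmod t + 1) * W.dst v (\<xi> v) (avg a v)"
      by (rule mult_right_mono[OF _ W.N_nonneg[OF sp]]) simp
    also have "\<dots> < (cmod t + 1) * \<delta>" by (rule mult_strict_left_mono[OF bspec[OF U(5) v] t])
    finally show ?thesis unfolding eq \<delta>(2) .
  qed
  then show "near (\<lambda>v s. t * \<xi> v s) u \<epsilon>"
    using U(1,2,3) continuous_map_cmult[OF continuous_map_canonical_const U(4)]
    by (intro exI[of _ U] exI[of _ "\<lambda>y. t * a y"]) blast
qed

lemma sections_closed:
  assumes \<xi>: "\<xi> \<in> (\<Pi>\<^sub>E u\<in>units G. W.space u)"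
    and close: "\<And>u \<epsilon>. u \<in> units G \<Longrightarrow> \<epsilon> > 0 \<Longrightarrow> \<exists>U \<eta>. openin (unit_space G) U \<and> u \<in> U \<and> \<eta> \<in> sections \<and>
      (\<forall>v\<in>U. W.dst v (\<xi> v) (\<eta> v) < \<epsilon>)"
  shows "\<xi> \<in> sections"
proof -
  have "restrict \<xi> (units G) \<in> sections"
  proof (rule sectionsI)
    show sp: "\<xi> u \<in> W.space u" if "u \<in> units G" for u by (rule PiE_mem[OF \<xi> that])
    fix u and \<epsilon> :: real assume u: "u \<in> units G" and "\<epsilon> > 0"
    then have e: "\<epsilon> / 2 > 0" by simp
    obtain U \<eta> where U: "openin (unit_space G) U" "u \<in> U" "\<eta> \<in> sections"
      "\<forall>v\<in>U. W.dst v (\<xi> v) (\<eta> v) < \<epsilon> / 2" using close[OF u e] by blast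
    obtain V a where V: "openin (unit_space G) V" "u \<in> V" "V \<subseteq> units G"
      "contG a" "\<forall>v\<in>V. W.dst v (\<eta> v) (avg a v) < \<epsilon> / 2"
      using sections_approx[OF U(3) u e] by blast
    have "W.dst v (\<xi> v) (avg a v) < \<epsilon>" if v: "v \<in> U \<inter> V" for v
    proof -
      have vu: "v \<in> units G" using v V(3) by blast
      have "W.dst v (\<xi> v) (avg a v) \<le> W.dst v (\<xi> v) (\<eta> v) + W.dst v (\<eta> v) (avg a v)"
        by (rule W.N_triangle[OF sp[OF vu] sections_space[OF U(3) vu] avg_space[OF cont_on_fib[OF V(4)] vu]])
      then show ?thesis using U(4) bspec[OF V(5), of v] v by fastforce
    qed
    moreover have "openin (unit_space G) (U \<inter> V)" using U(1) V(1) by (rule openin_Int)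
    ultimately show "near \<xi> u \<epsilon>"
      using U(2) V(2,3,4) by (intro exI[of _ "U \<inter> V"] exI[of _ a]) blast
  qed
  moreover have "restrict \<xi> (units G) = \<xi>" by (rule PiE_restrict[OF \<xi>])
  ultimately show ?thesis by simp
qed

lemma sections_norm_continuous:
  assumes \<xi>: "\<xi> \<in> sections"
  shows "continuous_map (unit_space G) euclideanreal (\<lambda>u. W.N u (\<xi> u))"
proof (rule continuous_map_locally_uniform_limit)
  fix u and \<epsilon> :: real assume "u \<in> topspace (unit_space G)" and e: "\<epsilon> > 0"
  then have u: "u \<in> units G" unfolding topspace_unit_space by simp
  obtain U a where U: "openin (unit_space G) U" "u \<in> U" "U \<subseteq> units G"
    "contG a" "\<forall>v\<in>U. W.dst v (\<xi> v) (avg a v) < \<epsilon>"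
    using sections_approx[OF \<xi> u e] by blast
  have "dist (W.N v (\<xi> v)) (W.N v (avg a v)) < \<epsilon>" if v: "v \<in> U" for v
  proof -
    have vu: "v \<in> units G" using v U(3) by blast
    have "\<bar>W.N v (\<xi> v) - W.N v (avg a v)\<bar> \<le> W.dst v (\<xi> v) (avg a v)"
      by (rule W.N_reverse_triangle[OF sections_space[OF \<xi> vu] avg_space[OF cont_on_fib[OF U(4)] vu]])
    then show ?thesis using bspec[OF U(5) v] by (simp add: dist_real_def)
  qed
  then show "\<exists>U h. openin (unit_space G) U \<and> u \<in> U \<and> continuous_map (unit_space G) euclideanreal h \<and>
      (\<forall>v\<in>U. dist (W.N v (\<xi> v)) (h v) < \<epsilon>)"
    using U(1,2) continuous_N_avg[OF U(4)] by (intro exI[of _ U] exI[of _ "\<lambda>v. W.N v (avg a v)"]) blast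
qed

lemma sections_bounded:
  assumes \<xi>: "\<xi> \<in> sections"
  shows "\<exists>A\<ge>0. \<forall>u\<in>units G. W.N u (\<xi> u) \<le> A"
proof -
  from image_compactin[OF compact_units[unfolded compact_space_def] sections_norm_continuous[OF \<xi>]]
  have "bounded ((\<lambda>u. W.N u (\<xi> u)) ` units G)"
    unfolding topspace_unit_space by (simp only: compactin_euclidean_iff compact_imp_bounded)
  then obtain A where A: "\<forall>u\<in>units G. \<bar>W.N u (\<xi> u)\<bar> \<le> A" by (auto simp: bounded_iff)
  have "W.N u (\<xi> u) \<le> max A 0" if "u \<in> units G" for u using A[rule_format, OF that] by linarith
  then show ?thesis by (intro exI[of _ "max A 0"]) simp
qed

text \<open>Locally uniformly approximated by the coefficients in \<open>continuous_inner_avg\<close>, because \<open>rep\<close> is isometric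
  and sections are bounded on the compact unit space.\<close>
lemma sections_coeff_continuous:
  assumes \<xi>: "\<xi> \<in> sections" and \<eta>: "\<eta> \<in> sections"
  shows "contG (\<lambda>x. W.inner (rng G x) (rep x (\<xi> (src G x))) (\<eta> (rng G x)))"
proof (rule continuous_map_locally_uniform_limit)
  fix x and \<epsilon> :: real assume x: "x \<in> arrows G" and e: "\<epsilon> > 0"
  obtain A where A: "A \<ge> 0" "\<And>u. u \<in> units G \<Longrightarrow> W.N u (\<xi> u) \<le> A" using sections_bounded[OF \<xi>] by blast
  obtain B where B: "B \<ge> 0" "\<And>u. u \<in> units G \<Longrightarrow> W.N u (\<eta> u) \<le> B" using sections_bounded[OF \<eta>] by blast
  define \<delta> where "\<delta> = min 1 (\<epsilon> / (A + B + 2))"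
  have AB: "0 < A + B + 2" using A(1) B(1) by linarith
  have \<delta>: "\<delta> > 0" "\<delta> \<le> 1" using e AB by (simp_all add: \<delta>_def)
  have "\<delta> * (A + B + 2) \<le> \<epsilon>"
    using AB mult_right_mono[of \<delta> "\<epsilon> / (A + B + 2)" "A + B + 2"] by (simp add: \<delta>_def)
  moreover have "\<delta> * (A + B + 1) < \<delta> * (A + B + 2)" using \<delta>(1) by (intro mult_strict_left_mono) simp_all
  ultimately have small: "\<delta> * (A + B + 1) < \<epsilon>" by linarith
  obtain U a where U: "openin (unit_space G) U" "src G x \<in> U" "U \<subseteq> units G"
    "contG a" "\<forall>v\<in>U. W.dst v (\<xi> v) (avg a v) < \<delta>"
    using sections_approx[OF \<xi> src_closed[OF x] \<delta>(1)] by blast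
  obtain V b where V: "openin (unit_space G) V" "rng G x \<in> V" "V \<subseteq> units G"
    "contG b" "\<forall>v\<in>V. W.dst v (\<eta> v) (avg b v) < \<delta>"
    using sections_approx[OF \<eta> rng_closed[OF x] \<delta>(1)] by blast
  define O' where "O' = {z \<in> arrows G. src G z \<in> U} \<inter> {z \<in> arrows G. rng G z \<in> V}"
  have O': "openin (arr_top G) O'"
    unfolding O'_def
    by (rule openin_Int[OF openin_continuous_map_preimage[OF continuous_src_unit U(1)]
        openin_continuous_map_preimage[OF continuous_rng_unit V(1)]])
  have "dist (W.inner (rng G z) (rep z (\<xi> (src G z))) (\<eta> (rng G z)))
      (W.inner (rng G z) (rep z (avg a (src G z))) (avg b (rng G z))) < \<epsilon>" if "z \<in> O'" for z
  proof -
    have z: "z \<in> arrows G" and sU: "src G z \<in> U" and rV: "rng G z \<in> V" using that by (auto simp: O'_def)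
    have u: "src G z \<in> units G" "rng G z \<in> units G" using z src_closed rng_closed by auto
    note s = sections_space[OF \<xi> u(1)] avg_space[OF cont_on_fib[OF U(4)] u(1)]
      sections_space[OF \<eta> u(2)] avg_space[OF cont_on_fib[OF V(4)] u(2)]
    note r = rep_space(1)[OF z s(1)] rep_space(1)[OF z s(2)]
    have 1: "W.dst (rng G z) (rep z (\<xi> (src G z))) (rep z (avg a (src G z))) \<le> \<delta>"
      using rep_space(2)[OF z W.space_diff(1)[OF s(1,2)]] bspec[OF U(5) sU] unfolding rep_diff by linarith
    have "W.N (src G z) (avg a (src G z)) \<le> A + \<delta>"
      using W.N_reverse_triangle[OF s(1,2)] bspec[OF U(5) sU] A(2)[OF u(1)] by linarith
    then have 2: "W.N (rng G z) (rep z (avg a (src G z))) \<le> A + 1"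
      using rep_space(2)[OF z s(2)] \<delta>(2) by linarith
    have "cmod (W.inner (rng G z) (rep z (\<xi> (src G z))) (\<eta> (rng G z))
        - W.inner (rng G z) (rep z (avg a (src G z))) (avg b (rng G z)))
      \<le> W.dst (rng G z) (rep z (\<xi> (src G z))) (rep z (avg a (src G z))) * W.N (rng G z) (\<eta> (rng G z))
        + W.N (rng G z) (rep z (avg a (src G z))) * W.dst (rng G z) (\<eta> (rng G z)) (avg b (rng G z))"
      by (rule W.inner_diff_bound[OF r s(3,4)])
    also have "\<dots> \<le> \<delta> * B + (A + 1) * \<delta>"
      using A(1) \<delta>(1) bspec[OF V(5) rV]
      by (intro add_mono mult_mono 1 2 B(2) u W.N_nonneg W.space_diff(1) s r) simp_all
    also have "\<dots> = \<delta> * (A + B + 1)" by (simp add: algebra_simps)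
    finally show ?thesis unfolding dist_norm using small by linarith
  qed
  moreover have "x \<in> O'" using x U(2) V(2) by (simp add: O'_def)
  ultimately show "\<exists>U h. openin (arr_top G) U \<and> x \<in> U \<and> contG h \<and>
      (\<forall>z\<in>U. dist (W.inner (rng G z) (rep z (\<xi> (src G z))) (\<eta> (rng G z))) (h z) < \<epsilon>)"
    using O' continuous_inner_avg[OF U(4) V(4)]
    by (intro exI[of _ O'] exI[of _ "\<lambda>z. W.inner (rng G z) (rep z (avg a (src G z))) (avg b (rng G z))"]) blast
qed

lemma bump:
  assumes "openin (arr_top G) N" "x \<in> N"
  shows "\<exists>b. continuous_map (arr_top G) euclideanreal b \<and> (\<forall>y\<in>arrows G. 0 \<le> b y) \<and> 0 < b x \<and>
    (\<forall>y\<in>arrows G. b y \<noteq> 0 \<longrightarrow> y \<in> N)"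
proof (rule compact_second_countable_bumps[OF compact_arrows Hausdorff second_countable])
  fix b :: "nat \<Rightarrow> 'g \<Rightarrow> real"
  assume b: "\<And>j. continuous_map (arr_top G) euclideanreal (b j)" "\<And>j x. x \<in> arrows G \<Longrightarrow> 0 \<le> b j x"
    "\<And>x N. openin (arr_top G) N \<Longrightarrow> x \<in> N \<Longrightarrow> \<exists>j. b j x > 0 \<and> (\<forall>y\<in>arrows G - N. b j y = 0)"
  obtain j where j: "b j x > 0" "\<forall>y\<in>arrows G - N. b j y = 0" using b(3)[OF assms] by blast
  show ?thesis
  proof (intro exI[of _ "b j"] conjI ballI impI)
    show "y \<in> N" if "y \<in> arrows G" "b j y \<noteq> 0" for y using j(2) that by blast
  qed (use b(1,2) j(1) in simp_all)
qed

text \<open>Average over a bump near \<open>y\<close>, where \<open>q\<close> is the squared distance from the point vector at \<open>y\<close>.\<close>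
lemma avg_near_point:
  assumes u: "u \<in> units G" and y: "y \<in> fib u" and e: "\<epsilon> > 0"
  shows "\<exists>a. contG a \<and> W.dst u (point u y) (avg a u) \<le> \<epsilon>"
proof -
  define q where "q z = Re (\<Phi> (src G z)) + Re (\<Phi> (src G y)) - 2 * Re (K y z)" for z
  have "continuous_map (subtopology (arr_top G) (fib u)) (arr_top G) (src G)"
    by (rule continuous_map_from_subtopology[OF continuous_src])
  from continuous_map_Re[OF continuous_map_after[OF this continuous_\<Phi>]]
  have "cont_on_fib u q" unfolding q_def
    by (rule continuous_map_diff[OF continuous_map_add[OF _ continuous_map_canonical_const]
        continuous_map_real_mult_left[OF continuous_map_Re[OF K_slice[OF y]]]])
  then have "openin (subtopology (arr_top G) (fib u)) {z \<in> topspace (subtopology (arr_top G) (fib u)). q z \<in> {..<\<epsilon>\<^sup>2}}"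
    by (rule openin_continuous_map_preimage) simp
  then obtain N where N: "openin (arr_top G) N"
    "{z \<in> topspace (subtopology (arr_top G) (fib u)). q z \<in> {..<\<epsilon>\<^sup>2}} = N \<inter> fib u"
    unfolding openin_subtopology by blast
  have N': "z \<in> N \<longleftrightarrow> q z < \<epsilon>\<^sup>2" if "z \<in> fib u" for z
    using that N(2) fibD(1)[OF that] by auto
  have "q y = 0" using y by (simp add: q_def K_diag fib_iff)
  then have "y \<in> N" using N'[OF y] e by simp
  then obtain b where "continuous_map (arr_top G) euclideanreal b \<and> (\<forall>z\<in>arrows G. 0 \<le> b z) \<and> 0 < b y \<and>
      (\<forall>z\<in>arrows G. b z \<noteq> 0 \<longrightarrow> z \<in> N)"
    using bump[OF N(1)] by blast
  then have b: "continuous_map (arr_top G) euclideanreal b" "\<And>z. z \<in> arrows G \<Longrightarrow> 0 \<le> b z" "0 < b y"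
    "\<And>z. z \<in> arrows G \<Longrightarrow> b z \<noteq> 0 \<Longrightarrow> z \<in> N"
    by simp_all
  define m where "m = I u b"
  have m: "m > 0" unfolding m_def
    by (rule I_pos[OF topspace_units[OF u] cont_on_fib[OF b(1)] b(2) y b(3)]) (rule fibD(1))
  define \<alpha> where "\<alpha> z = b z * (1 / m)" for z
  have \<alpha>: "continuous_map (arr_top G) euclideanreal \<alpha>" unfolding \<alpha>_def
    by (rule continuous_map_real_mult[OF b(1) continuous_map_canonical_const])
  have I\<alpha>: "I u \<alpha> = 1"
  proof -
    have "I u \<alpha> = I u b * (1 / m)" unfolding \<alpha>_def by (rule set_integral_mult_left)
    then show ?thesis using m by (simp add: m_def)
  qed
  have "W.dst u (point u y) (avg (\<lambda>z. of_real (\<alpha> z)) u) \<le> \<epsilon>"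
  proof (rule avg_close[OF u cont_on_fib[OF \<alpha>] _ I\<alpha> point_space[OF y] less_imp_le[OF e]])
    show "0 \<le> \<alpha> z" if "z \<in> fib u" for z using b(2)[OF fibD(1)[OF that]] m by (simp add: \<alpha>_def)
    fix z assume z: "z \<in> fib u" "\<alpha> z \<noteq> 0"
    then have "z \<in> N" using b(4)[OF fibD(1)[OF z(1)]] by (simp add: \<alpha>_def)
    then have "(W.dst u (point u z) (point u y))\<^sup>2 \<le> \<epsilon>\<^sup>2"
      unfolding N_point_diff[OF z(1) y] using N'[OF z(1)] by (simp add: q_def)
    then show "W.dst u (point u z) (point u y) \<le> \<epsilon>" by (rule power2_le_imp_le) (use e in simp)
  qed
  then show ?thesis using continuous_map_of_real[OF \<alpha>] by blast
qed

lemma avg_near_kf: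
  assumes u: "u \<in> units G"
  shows "supported (fib u) c \<Longrightarrow> \<epsilon> > 0 \<Longrightarrow>
    \<exists>a. contG a \<and> W.dst u (W.kf u c) (avg a u) \<le> \<epsilon>"
proof (induction c arbitrary: \<epsilon>)
  case Nil
  have c0: "contG (\<lambda>_. 0 :: complex)" by (rule continuous_map_canonical_const)
  have "(\<lambda>s. W.kf u [] s - avg (\<lambda>_. 0) u s) = (\<lambda>_. 0)" by (simp add: W.kf_def avg_def fun_eq_iff)
  then have "W.dst u (W.kf u []) (avg (\<lambda>_. 0) u) \<le> \<epsilon>"
    using Nil(2) by (simp only: W.N_zero less_imp_le)
  then show ?case using c0 by blast
next
  case (Cons p c)
  obtain t y where p: "p = (t, y)" by (cases p)
  have y: "y \<in> fib u" and c: "supported (fib u) c" using Cons.prems p by auto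
  define \<delta> where "\<delta> = (\<epsilon> / 2) / (cmod t + 1)"
  have t: "0 < cmod t + 1" by (simp add: add_nonneg_pos)
  then have \<delta>: "\<delta> > 0" using Cons.prems(2) by (simp add: \<delta>_def)
  have \<delta>': "(cmod t + 1) * \<delta> = \<epsilon> / 2"
    using t unfolding \<delta>_def by (intro nonzero_mult_div_cancel_left[of "cmod t + 1" "\<epsilon> / 2", folded times_divide_eq_right]) simp
  obtain a where a: "contG a" "W.dst u (point u y) (avg a u) \<le> \<delta>"
    using avg_near_point[OF u y \<delta>] by blast
  obtain b where b: "contG b" "W.dst u (W.kf u c) (avg b u) \<le> \<epsilon> / 2"
    using Cons.IH[OF c, of "\<epsilon> / 2"] Cons.prems(2) by auto
  have ta: "contG (\<lambda>y. t * a y)"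
    by (rule continuous_map_cmult[OF continuous_map_canonical_const a(1)])
  have sp: "(\<lambda>s. point u y s - avg a u s) \<in> W.space u" "(\<lambda>s. W.kf u c s - avg b u s) \<in> W.space u"
    by (rule W.space_diff(1)[OF point_space[OF y] avg_space[OF cont_on_fib[OF a(1)] u]]
        W.space_diff(1)[OF W.kf_space[OF c] avg_space[OF cont_on_fib[OF b(1)] u]])+
  have eq: "(\<lambda>s. W.kf u (p # c) s - avg (\<lambda>y. t * a y + b y) u s)
      = (\<lambda>s. t * (point u y s - avg a u s) + (W.kf u c s - avg b u s))"
    unfolding avg_add[OF ta b(1) u] avg_mult by (auto simp: p W.kf_def fun_eq_iff algebra_simps)
  have "W.N u (\<lambda>s. t * (point u y s - avg a u s) + (W.kf u c s - avg b u s))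
      \<le> W.N u (\<lambda>s. t * (point u y s - avg a u s)) + W.dst u (W.kf u c) (avg b u)"
    by (rule W.space_add(2)[OF W.space_mult(1)[OF sp(1)] sp(2)])
  also have "\<dots> \<le> cmod t * \<delta> + \<epsilon> / 2"
    using W.space_mult(2)[OF sp(1), of t] mult_left_mono[OF a(2), of "cmod t"] b(2) by simp
  also have "cmod t * \<delta> \<le> (cmod t + 1) * \<delta>" using \<delta> by (intro mult_right_mono) simp_all
  finally have "W.dst u (W.kf u (p # c)) (avg (\<lambda>y. t * a y + b y) u) \<le> \<epsilon>"
    unfolding eq \<delta>' by simp
  then show ?case using continuous_map_add[OF ta b(1)] by blast
qed

lemma sections_dense:
  assumes u: "u \<in> units G" and w: "w \<in> W.space u" and e: "\<epsilon> > 0"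
  shows "\<exists>\<xi>\<in>sections. W.dst u (\<xi> u) w < \<epsilon>"
proof -
  have e2: "\<epsilon> / 2 > 0" using e by simp
  obtain c where c: "supported (fib u) c" "W.dst u w (W.kf u c) < \<epsilon> / 2"
    using W.kf_dense[OF w e2] by blast
  obtain a where a: "contG a" "W.dst u (W.kf u c) (avg a u) \<le> \<epsilon> / 2"
    using avg_near_kf[OF u c(1) e2] by blast
  have sp: "avg a u \<in> W.space u" by (rule avg_space[OF cont_on_fib[OF a(1)] u])
  have "W.dst u (avg a u) w < \<epsilon>"
    using W.N_triangle[OF w W.kf_space[OF c(1)] sp] W.N_diff_commute[OF w sp] c(2) a(2) by linarith
  then show ?thesis using u avg_section[OF a(1)] by (intro bexI[of _ "restrict (avg a) (units G)"]) simp_all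
qed

text \<open>A bump \<open>b\<close> near \<open>u\<close>, normalized on each fibre near \<open>u\<close>; the maximum keeps the denominator
  away from zero on the other fibres.\<close>
lemma point_section: "restrict (\<lambda>u. point u u) (units G) \<in> sections"
proof (rule sectionsI)
  have uf: "u \<in> fib u" if "u \<in> units G" for u using that by (simp add: fib_iff unit_arrow rng_unit)
  show "point u u \<in> W.space u" if "u \<in> units G" for u by (rule point_space[OF uf[OF that]])
  fix u and \<epsilon> :: real assume u: "u \<in> units G" and e: "\<epsilon> > 0"
  define q where "q z = Re (\<Phi> (src G z)) + Re (\<Phi> (rng G z)) - 2 * Re (\<Phi> z)" for z
  have "continuous_map (arr_top G) euclideanreal q" unfolding q_def
    by (rule continuous_map_diff[OF continuous_map_add[OF
          continuous_map_Re[OF continuous_map_after[OF continuous_src continuous_\<Phi>]]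
          continuous_map_Re[OF continuous_map_after[OF continuous_rng continuous_\<Phi>]]]
        continuous_map_real_mult_left[OF continuous_map_Re[OF continuous_\<Phi>]]])
  then have Q: "openin (arr_top G) {z \<in> arrows G. q z \<in> {..<(\<epsilon> / 2)\<^sup>2}}"
    by (rule openin_continuous_map_preimage) simp
  have "q u = 0" using u by (simp add: q_def src_unit rng_unit)
  then have "u \<in> {z \<in> arrows G. q z \<in> {..<(\<epsilon> / 2)\<^sup>2}}" using u e by (simp add: unit_arrow)
  then obtain b where "continuous_map (arr_top G) euclideanreal b \<and> (\<forall>z\<in>arrows G. 0 \<le> b z) \<and> 0 < b u \<and>
      (\<forall>z\<in>arrows G. b z \<noteq> 0 \<longrightarrow> z \<in> {z \<in> arrows G. q z \<in> {..<(\<epsilon> / 2)\<^sup>2}})"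
    using bump[OF Q] by blast
  then have b: "continuous_map (arr_top G) euclideanreal b" "\<And>z. z \<in> arrows G \<Longrightarrow> 0 \<le> b z" "0 < b u"
    "\<And>z. z \<in> arrows G \<Longrightarrow> b z \<noteq> 0 \<Longrightarrow> z \<in> {z \<in> arrows G. q z \<in> {..<(\<epsilon> / 2)\<^sup>2}}"
    by simp_all
  define m where "m v = I v b" for v
  have mu: "m u > 0" unfolding m_def
    by (rule I_pos[OF topspace_units[OF u] cont_on_fib[OF b(1)] b(2) uf[OF u] b(3)]) (rule fibD(1))
  have m: "continuous_map (unit_space G) euclideanreal m"
  proof -
    have c: "contG (\<lambda>z. complex_of_real (b z))" by (rule continuous_map_of_real[OF b(1)])
    then have "(\<lambda>z. complex_of_real (b z)) \<in> Cc (arr_top G)" by (simp only: Cc_iff)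
    from continuous_map_Re[OF continuous_integral[OF this]] show ?thesis
    proof (rule continuous_map_eq)
      fix v assume "v \<in> topspace (unit_space G)"
      from I_eq_integral[OF this c] show "Re (integral\<^sup>L (lam v) (\<lambda>z. complex_of_real (b z))) = m v"
        unfolding m_def set_integral_complex_of_real by (metis Re_complex_of_real)
    qed
  qed
  define U where "U = {v \<in> topspace (unit_space G). m v \<in> {m u / 2<..}}"
  have U: "openin (unit_space G) U" unfolding U_def by (rule openin_continuous_map_preimage[OF m]) simp
  have U': "v \<in> U \<longleftrightarrow> v \<in> units G \<and> m u / 2 < m v" for v
    unfolding U_def topspace_unit_space by simp
  define \<alpha> where "\<alpha> z = b z * inverse (max (m u / 2) (m (rng G z)))" for z
  have \<alpha>: "continuous_map (arr_top G) euclideanreal \<alpha>" unfolding \<alpha>_def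
  proof (rule continuous_map_real_mult[OF b(1) continuous_map_real_inverse])
    show "continuous_map (arr_top G) euclideanreal (\<lambda>z. max (m u / 2) (m (rng G z)))"
      by (rule continuous_map_real_max[OF continuous_map_canonical_const continuous_map_after[OF continuous_rng_unit m]])
    show "max (m u / 2) (m (rng G z)) \<noteq> 0" for z using mu by (simp add: max_def)
  qed
  have "W.dst v (point v v) (avg (\<lambda>z. of_real (\<alpha> z)) v) < \<epsilon>" if "v \<in> U" for v
  proof -
    have v: "v \<in> units G" "m u / 2 < m v" using that U' by blast+
    have \<alpha>v: "\<alpha> z = b z * (1 / m v)" if "z \<in> fib v" for z
      using that v mu by (simp add: \<alpha>_def fib_iff max_def inverse_eq_divide)
    have I\<alpha>: "I v \<alpha> = 1"
    proof -
      have "I v \<alpha> = I v (\<lambda>z. b z * (1 / m v))" by (rule I_cong[OF topspace_units[OF v(1)] \<alpha>v])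
      also have "\<dots> = I v b * (1 / m v)" by (rule set_integral_mult_left)
      finally show ?thesis using v mu by (simp add: m_def)
    qed
    have "W.dst v (point v v) (avg (\<lambda>z. of_real (\<alpha> z)) v) \<le> \<epsilon> / 2"
    proof (rule avg_close[OF v(1) cont_on_fib[OF \<alpha>] _ I\<alpha> point_space[OF uf[OF v(1)]]])
      show "0 \<le> \<alpha> z" if "z \<in> fib v" for z
        using \<alpha>v[OF that] b(2)[OF fibD(1)[OF that]] v mu by simp
      show "0 \<le> \<epsilon> / 2" using e by simp
      fix z assume z: "z \<in> fib v" "\<alpha> z \<noteq> 0"
      then have "q z < (\<epsilon> / 2)\<^sup>2" using b(4)[OF fibD(1)[OF z(1)]] \<alpha>v[OF z(1)] by simp
      moreover have "K v z = \<Phi> z" using v z(1) by (simp add: K_def inv_unit unit_comp fib_iff)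
      ultimately have "(W.dst v (point v z) (point v v))\<^sup>2 \<le> (\<epsilon> / 2)\<^sup>2"
        unfolding N_point_diff[OF z(1) uf[OF v(1)]] using v(1) z(1) by (simp add: q_def src_unit fib_iff)
      then show "W.dst v (point v z) (point v v) \<le> \<epsilon> / 2" by (rule power2_le_imp_le) (use e in simp)
    qed
    then show ?thesis using e by linarith
  qed
  moreover have "u \<in> U" "U \<subseteq> units G" using U' u mu by auto
  ultimately show "near (\<lambda>v. point v v) u \<epsilon>"
    using U continuous_map_of_real[OF \<alpha>] by (intro exI[of _ U] exI[of _ "\<lambda>z. of_real (\<alpha> z)"]) blast
qed

lemma sections_bundle: "hilbert_bundle (unit_space G) W.hilbert sections"
proof (rule hilbert_bundle.intro, unfold topspace_unit_space)
  fix u assume "u \<in> units G"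
  show "complex_hilbert_space (W.hilbert u)" by (rule W.hilbert)
next
  show "sections \<subseteq> (\<Pi>\<^sub>E u\<in>units G. carrier (W.hilbert u))"
    unfolding W.hilbert_simps sections_def by blast
next
  have "restrict (avg (\<lambda>_. 0)) (units G) \<in> sections" by (rule avg_section[OF continuous_map_canonical_const])
  moreover have "avg (\<lambda>_. 0) = (\<lambda>_ _. 0)" by (simp add: avg_def fun_eq_iff)
  ultimately show "(\<lambda>u\<in>units G. \<zero>\<^bsub>W.hilbert u\<^esub>) \<in> sections" unfolding W.hilbert_simps by simp
next
  fix \<xi> \<eta> assume "\<xi> \<in> sections" "\<eta> \<in> sections"
  then show "(\<lambda>u\<in>units G. \<xi> u \<oplus>\<^bsub>W.hilbert u\<^esub> \<eta> u) \<in> sections" unfolding W.hilbert_simps by (rule sections_add)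
next
  fix \<xi> a assume "\<xi> \<in> sections"
  then show "(\<lambda>u\<in>units G. a \<odot>\<^bsub>W.hilbert u\<^esub> \<xi> u) \<in> sections" unfolding W.hilbert_simps by (rule sections_mult)
next
  fix u w and \<epsilon> :: real assume u: "u \<in> units G" and w: "w \<in> carrier (W.hilbert u)" and e: "0 < \<epsilon>"
  have w': "w \<in> W.space u" using w unfolding W.hilbert_simps .
  obtain \<xi> where \<xi>: "\<xi> \<in> sections" "W.dst u (\<xi> u) w < \<epsilon>" using sections_dense[OF u w' e] by blast
  have "hnorm (W.hilbert u) (\<xi> u \<ominus>\<^bsub>W.hilbert u\<^esub> w) = W.dst u (\<xi> u) w"
    unfolding W.hilbert_minus[OF sections_space[OF \<xi>(1) u] w']
    by (rule W.hnorm_hilbert[OF W.space_diff(1)[OF sections_space[OF \<xi>(1) u] w']])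
  then show "\<exists>\<xi>\<in>sections. hnorm (W.hilbert u) (\<xi> u \<ominus>\<^bsub>W.hilbert u\<^esub> w) < \<epsilon>"
    using \<xi>(2) by (intro bexI[OF _ \<xi>(1)]) simp
next
  fix \<xi> assume \<xi>: "\<xi> \<in> sections"
  from sections_norm_continuous[OF \<xi>]
  show "continuous_map (unit_space G) euclideanreal (\<lambda>u. hnorm (W.hilbert u) (\<xi> u))"
  proof (rule continuous_map_eq)
    fix u assume "u \<in> topspace (unit_space G)"
    then have "u \<in> units G" unfolding topspace_unit_space .
    from W.hnorm_hilbert[OF sections_space[OF \<xi> this]]
    show "W.N u (\<xi> u) = hnorm (W.hilbert u) (\<xi> u)" by simp
  qed
next
  fix \<xi> :: "'g \<Rightarrow> 'g \<Rightarrow> complex"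
  assume \<xi>: "\<xi> \<in> (\<Pi>\<^sub>E u\<in>units G. carrier (W.hilbert u))"
    and close: "\<And>u \<epsilon>. u \<in> units G \<Longrightarrow> 0 < \<epsilon> \<Longrightarrow> \<exists>U \<eta>. openin (unit_space G) U \<and> u \<in> U \<and> \<eta> \<in> sections \<and>
      (\<forall>v\<in>U. hnorm (W.hilbert v) (\<xi> v \<ominus>\<^bsub>W.hilbert v\<^esub> \<eta> v) < \<epsilon>)"
  have \<xi>': "\<xi> \<in> (\<Pi>\<^sub>E u\<in>units G. W.space u)" using \<xi> unfolding W.hilbert_simps .
  show "\<xi> \<in> sections"
  proof (rule sections_closed[OF \<xi>'])
    fix u and \<epsilon> :: real assume u: "u \<in> units G" "0 < \<epsilon>"
    obtain U \<eta> where U: "openin (unit_space G) U" "u \<in> U" "\<eta> \<in> sections"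
      "\<forall>v\<in>U. hnorm (W.hilbert v) (\<xi> v \<ominus>\<^bsub>W.hilbert v\<^esub> \<eta> v) < \<epsilon>" using close[OF u] by blast
    have "W.dst v (\<xi> v) (\<eta> v) < \<epsilon>" if v: "v \<in> U" for v
    proof -
      have "v \<in> units G" using openin_subset[OF U(1)] v unfolding topspace_unit_space by blast
      note sp = PiE_mem[OF \<xi>' this] sections_space[OF U(3) this]
      have "hnorm (W.hilbert v) (\<xi> v \<ominus>\<^bsub>W.hilbert v\<^esub> \<eta> v) = W.dst v (\<xi> v) (\<eta> v)"
        unfolding W.hilbert_minus[OF sp] by (rule W.hnorm_hilbert[OF W.space_diff(1)[OF sp]])
      then show ?thesis using bspec[OF U(4) v] by (simp only:)
    qed
    then show "\<exists>U \<eta>. openin (unit_space G) U \<and> u \<in> U \<and> \<eta> \<in> sections \<and> (\<forall>v\<in>U. W.dst v (\<xi> v) (\<eta> v) < \<epsilon>)"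
      using U by blast
  qed
qed

lemma representation: "unitary_representation G W.hilbert sections rep"
proof (intro unitary_representation.intro sections_bundle unitary_representation_axioms.intro)
  show "unitary_map (W.hilbert (src G x)) (W.hilbert (rng G x)) (rep x)" if "x \<in> arrows G" for x
    by (rule rep_unitary[OF that])
  show "rep u v = v" if "u \<in> units G" "v \<in> carrier (W.hilbert u)" for u v
    using rep_unit that unfolding W.hilbert_simps by blast
  show "rep x (rep y v) = rep (arr_comp G x y) v" if "(x, y) \<in> composable G" for x y v
    using rep_comp that unfolding composable_iff by blast
  show "inv_into (carrier (W.hilbert (src G x))) (rep x) v = rep (arr_inv G x) v"
    if x: "x \<in> arrows G" and v: "v \<in> carrier (W.hilbert (rng G x))" for x v
  proof (rule inv_into_f_eq)
    have "bij_betw (rep x) (carrier (W.hilbert (src G x))) (carrier (W.hilbert (rng G x)))"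
      using rep_unitary[OF x] unfolding unitary_map_def by blast
    then show "inj_on (rep x) (carrier (W.hilbert (src G x)))" by (rule bij_betw_imp_inj_on)
    have v': "v \<in> W.space (rng G x)" using v unfolding W.hilbert_simps .
    show "rep (arr_inv G x) v \<in> carrier (W.hilbert (src G x))"
      using rep_space(1)[of "arr_inv G x" v] v' x by (simp add: inv_closed src_inv rng_inv)
    show "rep x (rep (arr_inv G x) v) = v" by (rule rep_inv_cancel(2)[OF x v'])
  qed
  show "contG (rep_coeff G W.hilbert rep \<xi> \<eta>)"
    if "\<xi> \<in> C0_sections (unit_space G) W.hilbert sections" "\<eta> \<in> C0_sections (unit_space G) W.hilbert sections" for \<xi> \<eta>
  proof -
    have "\<xi> \<in> sections" "\<eta> \<in> sections" using that unfolding C0_sections_def by blast+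
    then show ?thesis unfolding rep_coeff_def W.hilbert_simps restrict_continuous_map
      by (rule sections_coeff_continuous)
  qed
qed

theorem pos_def_function: "restrict \<Phi> (arrows G) \<in> pos_def_functions TYPE('g \<Rightarrow> complex) G"
proof -
  define \<xi> where "\<xi> = restrict (\<lambda>u. point u u) (units G)"
  have \<xi>: "\<xi> \<in> sections" unfolding \<xi>_def by (rule point_section)
  obtain A where A: "\<And>u. u \<in> units G \<Longrightarrow> W.N u (\<xi> u) \<le> A" using sections_bounded[OF \<xi>] by blast
  have "\<forall>u\<in>topspace (unit_space G). hnorm (W.hilbert u) (\<xi> u) \<le> A"
    unfolding topspace_unit_space using A W.hnorm_hilbert[OF sections_space[OF \<xi>]] by simp
  then have Cb: "\<xi> \<in> Cb_sections (unit_space G) W.hilbert sections"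
    unfolding Cb_sections_def using \<xi> by blast
  have coeff: "rep_coeff G W.hilbert rep \<xi> \<xi> = restrict \<Phi> (arrows G)"
    unfolding rep_coeff_def W.hilbert_simps
  proof (rule restrict_ext)
    fix x assume x: "x \<in> arrows G"
    have u: "rng G x \<in> units G" "src G x \<in> units G" using x rng_closed src_closed by auto
    have f: "rng G x \<in> fib (rng G x)" "src G x \<in> fib (src G x)"
      using u by (auto simp: fib_iff unit_arrow rng_unit)
    have "W.inner (rng G x) (rep x (\<xi> (src G x))) (\<xi> (rng G x)) = rep x (point (src G x) (src G x)) (rng G x)"
      using W.inner_kf[OF rep_space(1)[OF x point_space[OF f(2)]], of "[(1, rng G x)]"] f u by (simp add: \<xi>_def)
    also have "\<dots> = K (arr_inv G x) (src G x)"
      using f inv_comp_fib[OF x f(1)] comp_src[OF inv_closed[OF x]] x by (simp add: rep_def W.kf_def src_inv)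
    also have "\<dots> = \<Phi> x" using x by (simp add: K_def inv_inv comp_src)
    finally show "W.inner (rng G x) (rep x (\<xi> (src G x))) (\<xi> (rng G x)) = \<Phi> x" .
  qed
  show ?thesis unfolding pos_def_functions_def
    by (intro CollectI exI[of _ W.hilbert] exI[of _ sections] exI[of _ rep] exI[of _ \<xi>] conjI representation Cb)
      (rule coeff[symmetric])
qed

end

section \<open>Coefficients of representations are positive definite\<close>

context complex_hilbert_space
begin

lemma ip_zero_left: "z \<in> carrier V \<Longrightarrow> ip V \<zero> z = 0"
  using ip_add[of \<zero> \<zero> z] by simp

lemma ip_zero_right: "z \<in> carrier V \<Longrightarrow> ip V z \<zero> = 0"
  using ip_cnj[of \<zero> z] by (simp add: ip_zero_left)

lemma ip_add_right:
  "\<lbrakk>v \<in> carrier V; w \<in> carrier V; z \<in> carrier V\<rbrakk> \<Longrightarrow> ip V z (v \<oplus> w) = ip V z v + ip V z w"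
  using ip_cnj[of "v \<oplus> w" z] ip_cnj[of v z] ip_cnj[of w z] by (simp add: ip_add)

lemma smult_carrier: "v \<in> carrier V \<Longrightarrow> a \<odot> v \<in> carrier V"
  using smult_closed[of a v] by (simp add: ring_of_type_algebra_def)

lemma ip_scale_right:
  "\<lbrakk>v \<in> carrier V; z \<in> carrier V\<rbrakk> \<Longrightarrow> ip V z (a \<odot> v) = cnj a * ip V z v"
  using ip_cnj[of "a \<odot> v" z] ip_cnj[of v z] by (simp add: ip_scale smult_carrier)

text \<open>The form of \<open>c\<close> is the inner product of \<open>vec c\<close> with itself.\<close>
lemma gram_kernel:
  assumes e: "\<And>y. y \<in> S \<Longrightarrow> e y \<in> carrier V"
  shows "pd_kernel S (\<lambda>s t. ip V (e t) (e s))"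
proof -
  define vec where "vec c = foldr (\<lambda>(a, y) v. a \<odot> e y \<oplus> v) c \<zero>" for c :: "(complex \<times> 'a) list"
  have vec: "vec [] = \<zero>" "vec ((a, y) # c) = a \<odot> e y \<oplus> vec c" for a y c
    by (simp_all add: vec_def)
  have carr: "supported S c \<Longrightarrow> vec c \<in> carrier V" for c
  proof (induction c)
    case (Cons p c)
    then show ?case by (cases p) (simp add: vec smult_carrier e)
  qed (simp add: vec)
  have 1: "kcomb (\<lambda>s t. ip V (e t) (e s)) d s = ip V (vec d) (e s)" if s: "s \<in> S" and d: "supported S d" for s d
    using d
  proof (induction d)
    case (Cons p d)
    then show ?case using e[OF s] by (cases p) (simp add: vec smult_carrier e carr ip_add ip_scale)
  qed (use e[OF s] in \<open>simp add: vec ip_zero_left\<close>)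
  have 2: "ev c (\<lambda>s. ip V v (e s)) = ip V v (vec c)" if v: "v \<in> carrier V" and c: "supported S c" for c v
    using c
  proof (induction c)
    case (Cons p c)
    then show ?case using v by (cases p) (simp add: vec smult_carrier e carr ip_add_right ip_scale_right)
  qed (use v in \<open>simp add: vec ip_zero_right\<close>)
  have eq: "kform (\<lambda>s t. ip V (e t) (e s)) c c = ip V (vec c) (vec c)" if c: "supported S c" for c
  proof -
    have "kform (\<lambda>s t. ip V (e t) (e s)) c c = ev c (\<lambda>s. ip V (vec c) (e s))"
      unfolding kform_def by (rule ev_cong[OF c]) (rule 1[OF _ c])
    then show ?thesis using 2[OF carr[OF c] c] by simp
  qed
  show ?thesis
    unfolding pd_kernel_def
  proof (intro allI impI)
    fix c assume c: "supported S c"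
    have "ip V (vec c) (vec c) = cnj (ip V (vec c) (vec c))" by (rule ip_cnj[OF carr[OF c] carr[OF c]])
    then have "Im (ip V (vec c) (vec c)) = 0" by (simp add: complex_eq_iff)
    then show "Im (kform (\<lambda>s t. ip V (e t) (e s)) c c) = 0 \<and> 0 \<le> Re (kform (\<lambda>s t. ip V (e t) (e s)) c c)"
      unfolding eq[OF c] using ip_nonneg[OF carr[OF c]] by blast
  qed
qed

end

text \<open>The coefficient at \<open>s\<inverse> t\<close> is the inner product of the vectors \<open>\<pi> t (\<xi> (d t))\<close> and \<open>\<pi> s (\<xi> (d s))\<close> in the fibre over
  the common range, because \<open>\<pi> s\<close> is unitary.\<close>
lemma (in groupoid) positive_definite_coeff:
  assumes rep: "unitary_representation G V \<Gamma> \<pi>" and \<xi>: "\<xi> \<in> \<Gamma>"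
  shows "positive_definite G (rep_coeff G V \<pi> \<xi> \<xi>)"
  unfolding positive_definite_def
proof
  interpret R: unitary_representation G V \<Gamma> \<pi> by (rule rep)
  fix u assume u: "u \<in> units G"
  have tu: "topspace (unit_space G) = units G" using unit_arrow by auto
  interpret V: complex_hilbert_space "V u" by (rule R.fibre) (use u tu in simp)
  let ?S = "{y \<in> arrows G. rng G y = u}"
  define e where "e y = \<pi> y (\<xi> (src G y))" for y
  have sec: "\<xi> v \<in> carrier (V v)" if "v \<in> units G" for v
    using R.sections \<xi> that unfolding tu by (blast dest: PiE_mem)
  have maps: "\<pi> x v \<in> carrier (V (rng G x))" if "x \<in> arrows G" "v \<in> carrier (V (src G x))" for x v
    using R.unitary[OF that(1)] that(2) unfolding unitary_map_def by (blast dest: bij_betw_apply)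
  have ecar: "e y \<in> carrier (V u)" if "y \<in> ?S" for y
    using maps[of y "\<xi> (src G y)"] sec[of "src G y"] src_closed that by (auto simp: e_def)
  have "pd_kernel ?S (\<lambda>s t. ip (V u) (e t) (e s))" by (rule V.gram_kernel[OF ecar])
  moreover have "rep_coeff G V \<pi> \<xi> \<xi> (ldiv s t) = ip (V u) (e t) (e s)" if s: "s \<in> ?S" and t: "t \<in> ?S" for s t
  proof -
    have st: "s \<in> arrows G" "t \<in> arrows G" "rng G s = u" "rng G t = u" using s t by auto
    note c = inv_comp_closed[OF st(1,2)]
    have \<xi>s: "\<xi> (src G s) \<in> carrier (V (src G s))" "\<xi> (src G t) \<in> carrier (V (src G t))"
      using st sec src_closed by auto
    define w where "w = \<pi> (ldiv s t) (\<xi> (src G t))"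
    have w: "w \<in> carrier (V (src G s))"
      using maps[of "ldiv s t" "\<xi> (src G t)"] c st \<xi>s by (simp add: w_def)
    have "\<pi> s w = \<pi> (arr_comp G s (ldiv s t)) (\<xi> (src G t))"
      unfolding w_def by (rule R.rep_comp) (use st c \<xi>s in \<open>simp_all add: composable_iff\<close>)
    also have "\<dots> = e t" using st by (simp add: inv_comp_cancel e_def)
    finally have sw: "\<pi> s w = e t" .
    have "ip (V (rng G s)) (\<pi> s w) (\<pi> s (\<xi> (src G s))) = ip (V (src G s)) w (\<xi> (src G s))"
      using R.unitary[OF st(1)] w \<xi>s unfolding unitary_map_def by blast
    moreover have "rep_coeff G V \<pi> \<xi> \<xi> (ldiv s t) = ip (V (src G s)) w (\<xi> (src G s))"
      using c st by (simp add: rep_coeff_def w_def)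
    ultimately show ?thesis using sw st by (simp add: e_def)
  qed
  ultimately show "pd_kernel ?S (\<lambda>s t. rep_coeff G V \<pi> \<xi> \<xi> (ldiv s t))"
    by (rule pd_kernel_cong)
qed

text \<open>On a compact unit space every section vanishes at infinity.\<close>
lemma (in haar_groupoid) continuous_coeff:
  assumes rep: "unitary_representation G V \<Gamma> \<pi>" and \<xi>: "\<xi> \<in> \<Gamma>"
  shows "contG (rep_coeff G V \<pi> \<xi> \<xi>)"
proof -
  interpret R: unitary_representation G V \<Gamma> \<pi> by (rule rep)
  have "compactin (unit_space G) (topspace (unit_space G))" using compact_units unfolding compact_space_def .
  then have "\<xi> \<in> C0_sections (unit_space G) V \<Gamma>" 
    unfolding C0_sections_def by (intro CollectI conjI \<xi> allI impI exI[of _ "topspace (unit_space G)"]) simp_all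
  from R.coeff_continuous[OF this this] show ?thesis .
qed

lemma haar_groupoid_subgroupoid:
  assumes G: "lch_groupoid G" and compact: "compact_space (arr_top G)"
    and wide: "wide_subgroupoid H G" and closed: "closedin (arr_top G) H"
    and haar: "haar_system (subgroupoid G H) lamH"
  shows "haar_groupoid (subgroupoid G H) lamH"
proof -
  interpret lch_groupoid G by (rule G)
  have H: "H \<subseteq> arrows G" "units G \<subseteq> H" "\<And>x y. x \<in> H \<Longrightarrow> y \<in> H \<Longrightarrow> src G x = rng G y \<Longrightarrow> arr_comp G x y \<in> H"
    "\<And>x. x \<in> H \<Longrightarrow> arr_inv G x \<in> H"
    using wide unfolding wide_subgroupoid_def by blast+
  have arr: "arrows (subgroupoid G H) = H" "units (subgroupoid G H) = units G"
    using H(1,2) by (auto simp: subgroupoid_simps)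
  have HA: "x \<in> H \<Longrightarrow> x \<in> arrows G" for x using H(1) by blast
  have comp: "(x, y) \<in> composable (subgroupoid G H) \<longleftrightarrow> x \<in> H \<and> y \<in> H \<and> src G x = rng G y" for x y
    unfolding composable_def arr by (simp add: subgroupoid_simps)
  have grp: "groupoid (subgroupoid G H)"
    by (rule groupoid.intro)
      (simp_all add: arr comp subgroupoid_simps(3-6) H HA rng_closed src_closed rng_unit src_unit
        groupoid.comp[OF groupoid_axioms] assoc comp_rng comp_src rng_inv src_inv comp_inv_right comp_inv_left)
  have comp_cont: "continuous_map (subtopology (prod_topology (arr_top (subgroupoid G H)) (arr_top (subgroupoid G H)))
      (composable (subgroupoid G H))) (arr_top (subgroupoid G H)) (\<lambda>(x, y). arr_comp (subgroupoid G H) x y)"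
  proof -
    let ?Q = "subtopology (prod_topology (subtopology (arr_top G) H) (subtopology (arr_top G) H)) (composable (subgroupoid G H))"
    have q: "fst q \<in> H \<and> snd q \<in> H \<and> src G (fst q) = rng G (snd q)" if "q \<in> topspace ?Q" for q
      using that comp[of "fst q" "snd q"] by simp
    have "continuous_map (subtopology (arr_top G) H) (arr_top G) (\<lambda>x. x)"
      by (simp add: continuous_map_from_subtopology)
    note i = continuous_map_after[OF continuous_map_sub_prod(1) this] continuous_map_after[OF continuous_map_sub_prod(2) this]
    have "continuous_map ?Q (arr_top G) (\<lambda>q. arr_comp G (fst q) (snd q))"
      by (rule continuous_comp[OF i]) (use q in blast)
    then have "continuous_map ?Q (subtopology (arr_top G) H) (\<lambda>q. arr_comp G (fst q) (snd q))"
      by (rule continuous_map_into_subtopology) (use q H(3) in blast)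
    then show ?thesis by (simp only: subgroupoid_simps case_prod_beta')
  qed
  have inv_cont: "continuous_map (arr_top (subgroupoid G H)) (arr_top (subgroupoid G H)) (arr_inv (subgroupoid G H))"
    unfolding subgroupoid_simps
    by (rule continuous_map_into_subtopology[OF continuous_map_from_subtopology[OF inv_continuous]]) (use H(4) in auto)
  have cpt: "compact_space (arr_top (subgroupoid G H))"
    unfolding subgroupoid_simps using closedin_compact_space[OF compact closed] by (simp add: compact_space_subtopology)
  have Hd: "Hausdorff_space (arr_top (subgroupoid G H))"
    unfolding subgroupoid_simps by (rule Hausdorff_space_subtopology[OF Hausdorff])
  have "lch_groupoid (subgroupoid G H)"
  proof (intro lch_groupoid.intro grp lch_groupoid_axioms.intro comp_cont inv_cont Hd)
    show "second_countable (arr_top (subgroupoid G H))"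
      unfolding subgroupoid_simps by (rule second_countable_subtopology[OF second_countable])
    show "locally_compact_space (arr_top (subgroupoid G H))"
      using cpt compact_imp_locally_compact_space by blast
  qed
  then show ?thesis using cpt haar by (intro haar_groupoid.intro haar_groupoid_axioms.intro)
qed

section \<open>Extension of coefficients\<close>

theorem corollary6p4:
  fixes G :: "'g groupoid_struct" and H :: "'g set"
    and lam lamH :: "'g \<Rightarrow> 'g measure" and \<mu> :: "'g \<Rightarrow> 'g set measure"
    and \<phi> :: "'g \<Rightarrow> complex"
  assumes "lch_groupoid G" and "haar_system G lam"
    and "compact_space (arr_top G)" and "transitive_groupoid G"
    and "wide_subgroupoid H G" and "closedin (arr_top G) H"
    and "transitive_groupoid (subgroupoid G H)"
    and "normalized_haar_system (subgroupoid G H) lamH"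
    and "full_equivariant_system G (coset_space G H) (coset_rng G) (coset_act G H) \<mu>"
    and "\<phi> \<in> pos_def_functions TYPE('e) (subgroupoid G H)"
  shows "\<exists>\<Phi> \<in> pos_def_functions TYPE('g \<Rightarrow> complex) G. restrict \<Phi> H = \<phi>"
proof -
  have G: "haar_groupoid G lam"
    using assms(1,2,3) by (intro haar_groupoid.intro haar_groupoid_axioms.intro)
  have "haar_system (subgroupoid G H) lamH"
    using assms(8) unfolding normalized_haar_system_def by blast
  then have "haar_groupoid (subgroupoid G H) lamH"
    by (rule haar_groupoid_subgroupoid[OF assms(1,3,5,6)])
  then interpret haar_subgroupoid G lam H lamH
    using G assms(5) by (intro haar_subgroupoid.intro haar_subgroupoid_axioms.intro)
  obtain fib :: "'g \<Rightarrow> 'e hilbert_struct" and \<Gamma> \<pi> \<xi> where \<phi>: "\<phi> = rep_coeff (subgroupoid G H) fib \<pi> \<xi> \<xi>"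
    and rep: "unitary_representation (subgroupoid G H) fib \<Gamma> \<pi>"
    and \<xi>: "\<xi> \<in> Cb_sections (unit_space (subgroupoid G H)) fib \<Gamma>"
    using assms(10) unfolding pos_def_functions_def by blast
  have "\<xi> \<in> \<Gamma>" using \<xi> unfolding Cb_sections_def by blast
  note coeff = H.continuous_coeff[OF rep this] H.positive_definite_coeff[OF rep this]
  obtain \<Phi> where \<Phi>: "continuous_map (arr_top G) euclidean \<Phi>" "positive_definite G \<Phi>"
    "\<And>x. x \<in> H \<Longrightarrow> \<Phi> x = \<phi> x"
    by (rule positive_definite_extension[OF coeff[folded \<phi>]], rule that, assumption+)
  interpret R: positive_definite_representation G lam \<Phi>
    using \<Phi>(1,2) by unfold_locales
  have "restrict (restrict \<Phi> (arrows G)) H = \<phi>"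
  proof
    fix x show "restrict (restrict \<Phi> (arrows G)) H x = \<phi> x"
    proof (cases "x \<in> H")
      case True
      then show ?thesis using H_closure(1)[OF True] \<Phi>(3)[OF True] by simp
    next
      case False
      then have "x \<notin> arrows (subgroupoid G H)" using H_arrows by simp
      then show ?thesis using False unfolding \<phi> rep_coeff_def by simp
    qed
  qed
  then show ?thesis using R.pos_def_function by blast
qed

end
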